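(* Let $\mathbf w=\{w_j\}_{j=2}^\infty$ be a sequence of positive real numbers with $\sigma_{\mathbf w}<+\infty$ and $\delta_{\mathbf w}\in\mathbb R$. Suppose that $\mathbf w$ is additive, i.e., $w_{mn}=w_m+w_n$ for all integers $m,n\geq2$ with $\gcd(m,n)=1$, and that $$\frac{w_{p^{j-1}}}{w_{p^j}}\leq p^{-\delta_{\mathbf w}}\quad\text{for all integers } j\geq2 \text{ and all prime numbers } p.$$ If $\delta_{\mathbf w}\leq0$, then the multiplier algebra $\mathcal M(\mathscr H_{\mathbf w})$ is isometrically isomorphic to $H^\infty(\mathbb H_{\delta_{\mathbf w}/2})\cap\mathcal D$.
   Context: For $\rho\in\mathbb R$, $\mathbb H_\rho=\{s\in\mathbb C:\Re(s)>\rho\}$ (and $\mathbb H_{-\infty}=\mathbb C$). For an integer $n\geq 2$, $\mathrm{gpf}(n)$ is the greatest prime factor of $n$; $\{p_j\}_{j\geq1}$ is the increasing enumeration of the primes. For a sequence $\mathbf x=\{x_j\}_{j\geq2}$ of non-negative reals, $$\sigma_{\mathbf x}=\inf\Big\{\Re(s):\sum_{j=2}^\infty x_jj^{-s}<\infty\Big\},\qquad \delta_{\mathbf x}=\inf\Big\{\Re(s):\sum_{j\geq2,\ \mathrm{gpf}(j)\leq p_n}x_jj^{-s}<\infty\ \text{for all integers } n\geq1\Big\},$$ so that $\delta_{\mathbf x}\leq\sigma_{\mathbf x}$. For a sequence $\mathbf w=\{w_j\}_{j\geq 2}$ of positive reals, $\mathscr H_{\mathbf w}$ is the Hilbert space of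 Dirichlet series $f(s)=\sum_{j=2}^\infty\hat f(j)j^{-s}$ with $\|f\|_{\mathbf w}^2=\sum_{j=2}^\infty|\hat f(j)|^2/w_j<\infty$. If $\sigma_{\mathbf w}<+\infty$, it is a reproducing kernel Hilbert space of holomorphic functions on $\mathbb H_{\sigma_{\mathbf w}/2}$ with kernel $\kappa_{\mathbf w}(s,u)=\sum_{j=2}^\infty w_jj^{-s-\overline u}$. A multiplier of $\mathscr H_{\mathbf w}$ is a function $\varphi:\mathbb H_{\sigma_{\mathbf w}/2}\to\mathbb C$ with $\varphi f\in\mathscr H_{\mathbf w}$ for every $f\in\mathscr H_{\mathbf w}$. $\mathcal M(\mathscr H_{\mathbf w})$ is the algebra of all multipliers, normed by the operator norm of the multiplication operator $M_{\varphi,\mathbf w}:f\mapsto\varphi f$ on $\mathscr H_{\mathbf w}$. $H^\infty(X)$ is the Banach space of bounded holomorphic functions on the open set $X\subseteq\mathbb C$ with the supremum norm, and $\mathcal D$ is the set of all functions representable by a convergent Dirichlet series $\sum_{j\geq1}a_jj^{-s}$ in some right half-plane; $H^\infty(X)\cap\mathcal D$ carries the supremum norm over $X$. *)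

theory Defs
  imports
    "HOL-Complex_Analysis.Complex_Analysis"
    "HOL-Computational_Algebra.Computational_Algebra"
begin

definition half_plane :: "ereal \<Rightarrow> complex set" where
  "half_plane \<rho> = {s. \<rho> < ereal (Re s)}"

text \<open>A function on a set \<open>X\<close> is encoded as a total function that is \<open>0\<close> off \<open>X\<close>; sums, products
  and scalar multiples of such functions are then the pointwise ones.\<close>
definition funs_on :: "complex set \<Rightarrow> (complex \<Rightarrow> complex) set" where
  "funs_on X = {f. \<forall>s. s \<notin> X \<longrightarrow> f s = 0}"

definition gpf :: "nat \<Rightarrow> nat" where
  "gpf n = Max (prime_factors n)"


subsection \<open>Abscissae\<close>

text \<open>The values may be infinite, so they are extended reals.  The sums run over index sets without
  a chosen order, and \<open>< \<infinity>\<close> is rendered as summability of the family; for complex families this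
  is absolute convergence.  As the coefficients are non-negative, ordinary convergence at \<open>s\<close> gives
  absolute convergence at all points of larger real part, so the infima do not depend on this.\<close>

definition sigma_abs :: "(nat \<Rightarrow> real) \<Rightarrow> ereal" where
  "sigma_abs x = Inf {ereal (Re s) |s::complex.
     (\<lambda>j. complex_of_real (x j) * of_nat j powr (- s)) summable_on {2..}}"

definition delta_abs :: "(nat \<Rightarrow> real) \<Rightarrow> ereal" where
  "delta_abs x = Inf {ereal (Re s) |s::complex. \<forall>p. prime p \<longrightarrow>
     (\<lambda>j. complex_of_real (x j) * of_nat j powr (- s)) summable_on {j. 2 \<le> j \<and> gpf j \<le> p}}"


subsection \<open>Dirichlet series and the space of a weight\<close>

text \<open>The term with index \<open>0\<close> vanishes because \<open>0 powr z = 0\<close>, so this is the series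
  over \<open>j \<ge> 1\<close>.\<close>
definition has_dseries_on :: "(complex \<Rightarrow> complex) \<Rightarrow> (nat \<Rightarrow> complex) \<Rightarrow> complex set \<Rightarrow> bool" where
  "has_dseries_on f a X \<longleftrightarrow> (\<forall>s\<in>X. (\<lambda>j. a j * of_nat j powr (- s)) sums f s)"

definition dirichlet_functions :: "(complex \<Rightarrow> complex) set" where
  "dirichlet_functions = {f. \<exists>a (\<rho>::real). has_dseries_on f a (half_plane (ereal \<rho>))}"

definition weight_domain :: "(nat \<Rightarrow> real) \<Rightarrow> complex set" where
  "weight_domain w = half_plane (sigma_abs w / 2)"

text \<open>Only the values \<open>w j\<close> with \<open>j \<ge> 2\<close> matter, as the series start at \<open>j = 2\<close>.\<close>
definition dspace_coeffs :: "(nat \<Rightarrow> real) \<Rightarrow> (nat \<Rightarrow> complex) set" where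
  "dspace_coeffs w = {a. a 0 = 0 \<and> a 1 = 0 \<and> summable (\<lambda>j. (cmod (a j))\<^sup>2 / w j)}"

definition dspace :: "(nat \<Rightarrow> real) \<Rightarrow> (complex \<Rightarrow> complex) set" where
  "dspace w = {f \<in> funs_on (weight_domain w).
     \<exists>a \<in> dspace_coeffs w. has_dseries_on f a (weight_domain w)}"

text \<open>For \<open>f\<close> in \<open>dspace w\<close> the sequence is unique when \<open>sigma_abs w < \<infinity>\<close>, because a Dirichlet
  series determines its coefficients.\<close>
definition dspace_coeff :: "(nat \<Rightarrow> real) \<Rightarrow> (complex \<Rightarrow> complex) \<Rightarrow> nat \<Rightarrow> complex" where
  "dspace_coeff w f = (THE a. a \<in> dspace_coeffs w \<and> has_dseries_on f a (weight_domain w))"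

definition dspace_norm :: "(nat \<Rightarrow> real) \<Rightarrow> (complex \<Rightarrow> complex) \<Rightarrow> real" where
  "dspace_norm w f = sqrt (\<Sum>j. (cmod (dspace_coeff w f j))\<^sup>2 / w j)"


subsection \<open>Multipliers\<close>

definition multipliers :: "(nat \<Rightarrow> real) \<Rightarrow> (complex \<Rightarrow> complex) set" where
  "multipliers w = {\<phi> \<in> funs_on (weight_domain w). \<forall>f \<in> dspace w. (\<lambda>s. \<phi> s * f s) \<in> dspace w}"

text \<open>The norms below are suprema in the extended reals, so that equality of norms
  includes finiteness.\<close>

definition multiplier_norm :: "(nat \<Rightarrow> real) \<Rightarrow> (complex \<Rightarrow> complex) \<Rightarrow> ereal" where
  "multiplier_norm w \<phi> =
     (SUP f \<in> {f \<in> dspace w. dspace_norm w f \<le> 1}. ereal (dspace_norm w (\<lambda>s. \<phi> s * f s)))"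


subsection \<open>Bounded holomorphic functions and isometric isomorphism\<close>

definition Hinf :: "complex set \<Rightarrow> (complex \<Rightarrow> complex) set" where
  "Hinf X = {f \<in> funs_on X. f holomorphic_on X \<and> bounded (f ` X)}"

definition sup_norm_on :: "complex set \<Rightarrow> (complex \<Rightarrow> complex) \<Rightarrow> ereal" where
  "sup_norm_on X f = (SUP s \<in> X. ereal (cmod (f s)))"

text \<open>Isometric isomorphism of complex algebras of functions with pointwise operations.\<close>
definition isometrically_isomorphic ::
  "(complex \<Rightarrow> complex) set \<Rightarrow> ((complex \<Rightarrow> complex) \<Rightarrow> ereal) \<Rightarrow>
   (complex \<Rightarrow> complex) set \<Rightarrow> ((complex \<Rightarrow> complex) \<Rightarrow> ereal) \<Rightarrow> bool" where
  "isometrically_isomorphic A normA B normB \<longleftrightarrow>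
     (\<exists>\<Phi>. bij_betw \<Phi> A B \<and>
        (\<forall>f\<in>A. \<forall>g\<in>A. \<Phi> (\<lambda>s. f s + g s) = (\<lambda>s. \<Phi> f s + \<Phi> g s)) \<and>
        (\<forall>c. \<forall>f\<in>A. \<Phi> (\<lambda>s. c * f s) = (\<lambda>s. c * \<Phi> f s)) \<and>
        (\<forall>f\<in>A. \<forall>g\<in>A. \<Phi> (\<lambda>s. f s * g s) = (\<lambda>s. \<Phi> f s * \<Phi> g s)) \<and>
        (\<forall>f\<in>A. normB (\<Phi> f) = normA f))"

end

theory Submission
  imports Defs
begin

text \<open>On coefficients, multiplication by a function with Dirichlet coefficients \<open>a\<close> is the Dirichlet
  convolution \<open>A f = a * f\<close>, and the multiplier norm is the operator norm of \<open>A\<close> on the sequences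
  with squared norm \<open>\<Sum> |f j|^2 / w j\<close>.  Two norm inequalities have to be proved.

  A function \<open>\<psi>\<close> with \<open>|\<psi>| \<le> B\<close> on \<open>Re s > \<delta>/2\<close> multiplies with norm at most \<open>B\<close>.  In dual form
  this is \<open>\<Sum> w m |A' g m|^2 \<le> B^2 \<Sum> w m |g m|^2\<close> with \<open>A' g m = \<Sum> cnj (a k) g (m k)\<close>, an
  inequality that is linear in the weight.  For the weight \<open>m powr \<delta>\<close> it says that \<open>\<psi>\<close> multiplies
  the Hardy space of Dirichlet series on that half-plane, and mean values on vertical lines prove it
  (\<open>adjoint_conv_bound\<close>).  Since \<open>A'\<close> commutes with \<open>g \<mapsto> (\<lambda>n. g (d n))\<close>, the inequality
  passes to the weights \<open>[d dvd m] m powr \<delta>\<close>, and so to \<open>m powr \<delta> * u m\<close> for all \<open>u\<close> in the cone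
  generated by the indicators \<open>[d dvd m]\<close> (\<open>adjoint_conv_cone_bound\<close>).  This cone is closed under
  products, because \<open>[d dvd m] [e dvd m] = [lcm d e dvd m]\<close>, and contains the non-negative
  nondecreasing functions of the exponent of a prime in \<open>m\<close>.  Additivity writes \<open>w m * m powr (-\<delta>)\<close> as
  a sum over primes \<open>p\<close> of products of such functions: the factor at \<open>p\<close> has the values
  \<open>w (p^k) p^(-\<delta> k)\<close>, nondecreasing by the hypothesis on ratios, and the factor at another prime \<open>q\<close>
  is \<open>q^(-\<delta> k)\<close>, nondecreasing because \<open>\<delta> \<le> 0\<close> (\<open>additive_weight_in_divisor_cone\<close>).

  Conversely, a multiplier is a bounded operator, by a gliding hump that uses the triangular shape of
  \<open>A\<close> (\<open>dirichlet_conv_bounded\<close>).  Deleting all indices with a prime factor above \<open>p\<close>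
  is compatible with convolution.  On the remaining indices the kernel functions of all points with
  \<open>Re u > \<delta>/2\<close> exist, by the definition of \<open>\<delta>\<close>, and bound the corresponding part of the multiplier
  there by the multiplier norm (\<open>smooth_multiplier_bound\<close>).  By Montel's theorem a subsequence of these
  parts converges as \<open>p\<close> grows, and its limit extends the multiplier to \<open>Re s > \<delta>/2\<close> with the same
  bound (\<open>multiplier_extends\<close>).\<close>

section \<open>Dirichlet series and Dirichlet convolution\<close>

lemma mem_half_plane [simp]: "s \<in> half_plane (ereal r) \<longleftrightarrow> r < Re s"
  by (simp add: half_plane_def)

lemma open_half_plane: "open (half_plane (ereal r))"
  by (simp add: half_plane_def open_halfspace_Re_gt)

lemma convex_half_plane: "convex (half_plane (ereal r))"
  by (simp add: half_plane_def convex_halfspace_Re_gt)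

lemma norm_nat_powr: "cmod (of_nat j powr s) = real j powr Re s"
  using norm_powr_real_powr[of "of_nat j" s] by simp

definition dirichlet_sum :: "(nat \<Rightarrow> complex) \<Rightarrow> complex \<Rightarrow> complex" where
  "dirichlet_sum a s = (\<Sum>j. a j * of_nat j powr (- s))"

text \<open>The term at index \<open>0\<close> vanishes, as it does in the series itself, because \<open>0 powr y = 0\<close>.\<close>
definition abs_conv :: "(nat \<Rightarrow> complex) \<Rightarrow> real \<Rightarrow> bool" where
  "abs_conv a x \<longleftrightarrow> summable (\<lambda>j. cmod (a j) * real j powr (- x))"

lemma norm_dirichlet_term: "cmod (a j * of_nat j powr (- s)) = cmod (a j) * real j powr (- Re s)"
  by (simp add: norm_mult norm_nat_powr)

lemma abs_conv_mono:
  assumes "abs_conv a x" "x \<le> y"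
  shows "abs_conv a y"
  unfolding abs_conv_def
proof (rule summable_comparison_test')
  show "summable (\<lambda>j. cmod (a j) * real j powr (- x))"
    using assms(1) by (simp add: abs_conv_def)
  fix j :: nat
  have "real j powr (- y) \<le> real j powr (- x)"
    using assms(2) by (cases "j = 0") (auto intro: powr_mono)
  then show "norm (cmod (a j) * real j powr (- y)) \<le> cmod (a j) * real j powr (- x)"
    by (simp add: mult_left_mono)
qed

lemma abs_conv_summable_norm:
  assumes "abs_conv a (Re s)"
  shows "summable (\<lambda>j. cmod (a j * of_nat j powr (- s)))"
  using assms by (simp add: abs_conv_def norm_dirichlet_term)

lemma abs_conv_sums:
  assumes "abs_conv a (Re s)"
  shows "(\<lambda>j. a j * of_nat j powr (- s)) sums dirichlet_sum a s"
  unfolding dirichlet_sum_def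
  by (intro summable_sums summable_norm_cancel[OF abs_conv_summable_norm] assms)

text \<open>The terms at \<open>s\<close> are bounded, and moving two units to the right gains the summable factor
  \<open>1 / j^2\<close>.\<close>
lemma convergent_imp_abs_conv:
  assumes "summable (\<lambda>j. a j * of_nat j powr (- s))"
  shows "abs_conv a (Re s + 2)"
proof -
  have "Bseq (\<lambda>j. a j * of_nat j powr (- s))"
    using summable_LIMSEQ_zero[OF assms] convergentI convergent_imp_Bseq by blast
  then obtain B where B: "\<And>j. cmod (a j * of_nat j powr (- s)) \<le> B"
    by (auto simp: Bseq_def)
  show ?thesis
    unfolding abs_conv_def
  proof (rule summable_comparison_test')
    show "summable (\<lambda>j. B * inverse (real j ^ 2))"
      by (intro summable_mult inverse_power_summable) auto
    fix j :: nat
    have "real j powr (- (Re s + 2)) = real j powr (- Re s) * inverse (real j ^ 2)"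
      by (cases "j = 0") (simp_all add: powr_diff powr_numeral field_simps)
    then have "cmod (a j) * real j powr (- (Re s + 2))
        = cmod (a j * of_nat j powr (- s)) * inverse (real j ^ 2)"
      by (simp add: norm_dirichlet_term)
    also have "\<dots> \<le> B * inverse (real j ^ 2)"
      by (intro mult_right_mono B) auto
    finally show "norm (cmod (a j) * real j powr (- (Re s + 2))) \<le> B * inverse (real j ^ 2)"
      by simp
  qed
qed

lemma has_dseries_on_imp_abs_conv:
  assumes "has_dseries_on f a (half_plane (ereal r))"
  obtains r' where "\<And>s. r' \<le> Re s \<Longrightarrow> abs_conv a (Re s)"
    "\<And>s. r' \<le> Re s \<Longrightarrow> f s = dirichlet_sum a s"
proof
  fix s assume s: "r + 3 \<le> Re s"
  have "(\<lambda>j. a j * of_nat j powr (- of_real (r + 1))) sums f (of_real (r + 1))"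
    using assms unfolding has_dseries_on_def by (metis mem_half_plane Re_complex_of_real less_add_one)
  then have "abs_conv a (Re (of_real (r + 1)) + 2)"
    by (intro convergent_imp_abs_conv) (auto simp: sums_iff)
  then show "abs_conv a (Re s)"
    by (rule abs_conv_mono) (use s in auto)
  have "(\<lambda>j. a j * of_nat j powr (- s)) sums f s"
    using assms s unfolding has_dseries_on_def by auto
  then show "f s = dirichlet_sum a s"
    by (simp add: dirichlet_sum_def sums_iff)
qed

lemma holomorphic_dirichlet_sum:
  assumes "\<And>x. r < x \<Longrightarrow> abs_conv a x"
  shows "dirichlet_sum a holomorphic_on half_plane (ereal r)"
proof (rule holomorphic_uniform_sequence[OF open_half_plane])
  show "(\<lambda>s. \<Sum>j<n. a j * of_nat j powr (- s)) holomorphic_on half_plane (ereal r)" for n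
    by (intro holomorphic_intros)
  fix s assume s: "s \<in> half_plane (ereal r)"
  define e where "e = (Re s - r) / 2"
  have e: "e > 0" using s by (simp add: e_def)
  have *: "r + e \<le> Re z" if "z \<in> cball s e" for z
    using that abs_Re_le_cmod[of "s - z"] by (auto simp: e_def dist_norm field_simps)
  have "uniform_limit (cball s e) (\<lambda>n s. \<Sum>j<n. a j * of_nat j powr (- s))
      (dirichlet_sum a) sequentially"
    unfolding dirichlet_sum_def[abs_def]
  proof (rule Weierstrass_m_test)
    show "summable (\<lambda>j. cmod (a j) * real j powr (- (r + e)))"
      using assms[of "r + e"] e by (simp add: abs_conv_def)
    fix j z assume z: "z \<in> cball s e"
    have "real j powr (- Re z) \<le> real j powr (- (r + e))"
      using *[OF z] by (cases "j = 0") (auto intro: powr_mono)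
    then show "cmod (a j * of_nat j powr (- z)) \<le> cmod (a j) * real j powr (- (r + e))"
      by (simp add: norm_dirichlet_term mult_left_mono)
  qed
  moreover have "cball s e \<subseteq> half_plane (ereal r)"
    using * e by force
  ultimately show "\<exists>d>0. cball s d \<subseteq> half_plane (ereal r) \<and>
     uniform_limit (cball s d) (\<lambda>n s. \<Sum>j<n. a j * of_nat j powr (- s)) (dirichlet_sum a) sequentially"
    using e by blast
qed

text \<open>At \<open>n = 0\<close> every natural number is a divisor, and the sum over this infinite set is \<open>0\<close>.\<close>
definition dirichlet_conv :: "(nat \<Rightarrow> complex) \<Rightarrow> (nat \<Rightarrow> complex) \<Rightarrow> nat \<Rightarrow> complex" where
  "dirichlet_conv a b n = (\<Sum>d | d dvd n. a d * b (n div d))"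

lemma dirichlet_conv_0 [simp]: "dirichlet_conv a b 0 = 0"
  by (simp add: dirichlet_conv_def)

lemma dirichlet_conv_1 [simp]: "dirichlet_conv a b (Suc 0) = a 1 * b 1"
proof -
  have "{d. d dvd Suc 0} = {1}" by auto
  then show ?thesis by (simp add: dirichlet_conv_def)
qed

text \<open>The product of two absolutely convergent series may be summed over all pairs of indices, and then
  grouped by the product of the indices.\<close>
lemma dirichlet_conv_abs:
  assumes "abs_conv a (Re s)" "abs_conv b (Re s)"
  shows "abs_conv (dirichlet_conv a b) (Re s)"
    and "dirichlet_sum (dirichlet_conv a b) s = dirichlet_sum a s * dirichlet_sum b s"
proof -
  define A where "A k = a k * of_nat k powr (- s)" for k
  define B where "B k = b k * of_nat k powr (- s)" for k
  have nA: "summable (\<lambda>k. norm (A k))" and nB: "summable (\<lambda>k. norm (B k))"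
    using assms by (auto simp: A_def B_def intro!: abs_conv_summable_norm)
  have hsA: "(A has_sum dirichlet_sum a s) UNIV" and hsB: "(B has_sum dirichlet_sum b s) UNIV"
    using nA nB abs_conv_sums assms by (auto simp: A_def[abs_def] B_def[abs_def] intro!: norm_summable_imp_has_sum)
  have aA: "(\<lambda>k. norm (A k)) summable_on UNIV" and aB: "(\<lambda>k. norm (B k)) summable_on UNIV"
    using nA nB by (auto simp: summable_on_UNIV_nonneg_real_iff)
  let ?F = "\<lambda>(k, m). A k * B m"
  have absF: "(\<lambda>p. norm (?F p)) summable_on UNIV \<times> UNIV"
    unfolding Infinite_Sum.abs_summable_on_Sigma_iff
    using aA aB
    by (auto simp: norm_mult infsum_cmult_right' abs_mult
        intro!: summable_on_cmult_right summable_on_cmult_left)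
  then have "?F summable_on UNIV \<times> UNIV"
    by (rule abs_summable_summable)
  then have prod: "(?F has_sum dirichlet_sum a s * dirichlet_sum b s) (UNIV \<times> UNIV)"
    by (intro has_sum_SigmaI[where g = "\<lambda>k. A k * dirichlet_sum b s"])
       (auto intro!: has_sum_cmult_right has_sum_cmult_left hsA hsB)
  let ?P = "{1..} \<times> {1..} :: (nat \<times> nat) set"
  let ?D = "Sigma {1..} (\<lambda>n. {d. d dvd n}) :: (nat \<times> nat) set"
  let ?G = "\<lambda>(n, d). A d * B (n div d)"
  \<comment> \<open>Terms with index \<open>0\<close> vanish, and \<open>(k, m) \<mapsto> (k m, k)\<close> identifies the pairs of positive integers with
    the divisors of positive integers.\<close>
  have prodP: "(?F has_sum dirichlet_sum a s * dirichlet_sum b s) ?P"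
  proof -
    have "?F p = 0" if "p \<notin> ?P" for p
      using that by (cases p) (auto simp: A_def B_def not_le)
    then have "(?F has_sum S) ?P \<longleftrightarrow> (?F has_sum S) (UNIV \<times> UNIV)" for S
      by (intro has_sum_cong_neutral) auto
    then show ?thesis using prod by blast
  qed
  have inD: "(n, d) \<in> ?D \<Longrightarrow> n div d \<ge> 1 \<and> d \<ge> 1" for n d :: nat
    by (auto elim!: dvdE)
  have reindex: "(f \<circ> (\<lambda>(n, d). (d, n div d)) has_sum S) ?D \<longleftrightarrow> (f has_sum S) ?P" for f S
    by (rule has_sum_reindex_bij_witness[of _ "\<lambda>(k, m). (k * m, k)" "\<lambda>(n, d). (d, n div d)"])
       (use inD in auto)
  have GF: "?G = ?F \<circ> (\<lambda>(n, d). (d, n div d))"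
    by (auto simp: fun_eq_iff)
  have hsG: "(?G has_sum dirichlet_sum a s * dirichlet_sum b s) ?D"
    unfolding GF reindex by (rule prodP)
  have absG: "(\<lambda>p. norm (?G p)) summable_on ?D"
  proof -
    have "(\<lambda>p. norm (?F p)) summable_on ?P"
      by (rule summable_on_subset_banach[OF absF]) auto
    then have "((\<lambda>x. norm (?F x)) has_sum infsum (\<lambda>x. norm (?F x)) ?P) ?P"
      by simp
    then have "((\<lambda>x. norm (?F x)) \<circ> (\<lambda>(n, d). (d, n div d)) has_sum infsum (\<lambda>x. norm (?F x)) ?P) ?D"
      unfolding reindex .
    then show ?thesis
      by (auto simp: summable_on_def o_def case_prod_unfold)
  qed
  have fin: "finite {d. d dvd n}" if "n \<in> {1..}" for n :: nat
    using that by auto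
  have inner: "(\<Sum>d | d dvd n. A d * B (n div d)) = dirichlet_conv a b n * of_nat n powr (- s)"
    if "n \<ge> 1" for n
    unfolding dirichlet_conv_def sum_distrib_right
  proof (rule sum.cong[OF refl])
    fix d assume "d \<in> {d. d dvd n}"
    then obtain m where m: "n = d * m" by auto
    with that have "d \<ge> 1" "m \<ge> 1" by auto
    then have "(of_nat n :: complex) powr (- s) = of_nat d powr (- s) * of_nat m powr (- s)"
      by (simp add: m powr_times_real)
    then show "A d * B (n div d) = a d * b (n div d) * of_nat n powr (- s)"
      using \<open>d \<ge> 1\<close> by (simp add: A_def B_def m)
  qed
  have "((\<lambda>n. dirichlet_conv a b n * of_nat n powr (- s)) has_sum
      dirichlet_sum a s * dirichlet_sum b s) {1..}"
    by (rule has_sum_SigmaD[OF hsG])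
       (use fin inner in \<open>auto intro!: has_sum_finiteI\<close>)
  moreover have "((\<lambda>n. dirichlet_conv a b n * of_nat n powr (- s)) has_sum S) UNIV \<longleftrightarrow>
      ((\<lambda>n. dirichlet_conv a b n * of_nat n powr (- s)) has_sum S) {1..}" for S
    by (rule has_sum_cong_neutral) (auto simp: not_le)
  ultimately have hs: "((\<lambda>n. dirichlet_conv a b n * of_nat n powr (- s)) has_sum
      dirichlet_sum a s * dirichlet_sum b s) UNIV"
    by blast
  show "dirichlet_sum (dirichlet_conv a b) s = dirichlet_sum a s * dirichlet_sum b s"
    using has_sum_imp_sums[OF hs] by (simp add: dirichlet_sum_def[of "dirichlet_conv a b"] sums_iff)
  have "(\<lambda>n. norm (dirichlet_conv a b n * of_nat n powr (- s))) summable_on UNIV"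
    by (rule summable_on_iff_abs_summable_on_complex[THEN iffD1, OF has_sum_imp_summable[OF hs]])
  then show "abs_conv (dirichlet_conv a b) (Re s)"
    unfolding abs_conv_def norm_dirichlet_term[symmetric]
    by (simp add: summable_on_UNIV_nonneg_real_iff)
qed

section \<open>Mean values on vertical lines\<close>

text \<open>The Bohr mean of a function on the real line.  For \<open>t \<mapsto> f (Complex x t)\<close> it picks out Dirichlet
  coefficients of \<open>f\<close>.\<close>
definition has_mean :: "(real \<Rightarrow> complex) \<Rightarrow> complex \<Rightarrow> bool" where
  "has_mean f L \<longleftrightarrow> ((\<lambda>T. integral {-T..T} f / of_real (2 * T)) \<longlongrightarrow> L) at_top"

lemma has_mean_unique: "has_mean f L \<Longrightarrow> has_mean f M \<Longrightarrow> L = M"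
  unfolding has_mean_def using tendsto_unique trivial_limit_at_top_linorder by blast

lemma continuous_integrable:
  fixes f :: "real \<Rightarrow> complex"
  assumes "continuous_on UNIV f"
  shows "f integrable_on {a..b}"
  by (rule integrable_continuous_real) (rule continuous_on_subset[OF assms], simp)

lemma has_mean_0: "has_mean (\<lambda>t. 0) 0"
  by (simp add: has_mean_def)

lemma has_mean_add:
  assumes "has_mean f L" "has_mean g M" "continuous_on UNIV f" "continuous_on UNIV g"
  shows "has_mean (\<lambda>t. f t + g t) (L + M)"
  using tendsto_add[OF assms(1,2)[unfolded has_mean_def]] assms(3,4)
  by (simp add: has_mean_def integral_add continuous_integrable add_divide_distrib)

lemma has_mean_cmult:
  assumes "has_mean f L"
  shows "has_mean (\<lambda>t. c * f t) (c * L)"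
  using tendsto_mult_left[OF assms[unfolded has_mean_def], of c]
  by (simp add: has_mean_def)

lemma has_mean_sum:
  assumes "\<And>i. i \<in> I \<Longrightarrow> has_mean (f i) (L i)" "\<And>i. i \<in> I \<Longrightarrow> continuous_on UNIV (f i)"
  shows "has_mean (\<lambda>t. \<Sum>i\<in>I. f i t) (\<Sum>i\<in>I. L i)"
  using assms
  by (induction I rule: infinite_finite_induct)
     (auto intro!: has_mean_0 has_mean_add continuous_on_sum)

text \<open>The positivity of the mean, which turns pointwise bounds into bounds for coefficients.\<close>
lemma has_mean_Re_mono:
  assumes "has_mean f L" "has_mean g M" "continuous_on UNIV f" "continuous_on UNIV g"
    and le: "\<And>t. Re (f t) \<le> Re (g t)"
  shows "Re L \<le> Re M"
proof (rule tendsto_le[OF trivial_limit_at_top_linorder])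
  show "((\<lambda>T. Re (integral {-T..T} g / of_real (2 * T))) \<longlongrightarrow> Re M) at_top"
    "((\<lambda>T. Re (integral {-T..T} f / of_real (2 * T))) \<longlongrightarrow> Re L) at_top"
    by (intro tendsto_Re assms(1,2)[unfolded has_mean_def])+
  have le': "Re (integral {-T..T} f / of_real (2 * T)) \<le> Re (integral {-T..T} g / of_real (2 * T))"
    if "T > 0" for T
  proof -
    have *: "Re (integral {-T..T} h / of_real (2 * T)) = integral {-T..T} (\<lambda>t. Re (h t)) / (2 * T)"
      if "continuous_on UNIV h" for h
      using integral_linear[OF continuous_integrable[OF that] bounded_linear_Re, of "-T" T]
      by (simp add: o_def)
    have "integral {-T..T} (\<lambda>t. Re (f t)) \<le> integral {-T..T} (\<lambda>t. Re (g t))"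
      using assms(3,4) le
      by (intro integral_le integrable_continuous_real continuous_intros)
         (auto intro: continuous_on_subset)
    then show ?thesis
      using that unfolding *[OF assms(3)] *[OF assms(4)] by (intro divide_right_mono) auto
  qed
  show "\<forall>\<^sub>F T in at_top. Re (integral {-T..T} f / of_real (2 * T))
      \<le> Re (integral {-T..T} g / of_real (2 * T))"
    by (rule eventually_mono[OF eventually_gt_at_top[of 0] le'])
qed

text \<open>Only the growth of the integral matters: a bounded difference disappears after division by
  \<open>2 * T\<close>.\<close>
lemma has_mean_bounded_diff:
  assumes f: "has_mean f L"
    and B: "\<And>T. T > 0 \<Longrightarrow> cmod (integral {-T..T} g - integral {-T..T} f) \<le> B"
  shows "has_mean g L"
proof -
  have "((\<lambda>T. (integral {-T..T} g - integral {-T..T} f) / of_real (2 * T)) \<longlongrightarrow> 0) at_top"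
  proof (rule Lim_null_comparison)
    show "((\<lambda>T. B / (2 * T)) \<longlongrightarrow> 0) at_top"
      by real_asymp
    show "\<forall>\<^sub>F T in at_top. cmod ((integral {-T..T} g - integral {-T..T} f) / of_real (2 * T)) \<le> B / (2 * T)"
      using eventually_gt_at_top[of 0]
      by eventually_elim (use B in \<open>auto simp: norm_divide intro!: divide_right_mono\<close>)
  qed
  from tendsto_add[OF this f[unfolded has_mean_def]] show ?thesis
    by (simp add: has_mean_def diff_divide_distrib)
qed

lemma has_mean_cis: "has_mean (\<lambda>t. cis (c * t)) (if c = 0 then 1 else 0)"
proof (cases "c = 0")
  case True
  have "\<forall>\<^sub>F T in at_top. integral {-T..T} (\<lambda>t. 1::complex) / of_real (2 * T) = 1"
    using eventually_gt_at_top[of "0::real"] by eventually_elim (auto simp: scaleR_conv_of_real)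
  then show ?thesis
    using True by (auto simp: has_mean_def intro: tendsto_eventually)
next
  case False
  have "has_mean (\<lambda>t. cis (c * t)) 0"
  proof (rule has_mean_bounded_diff[OF has_mean_0])
    fix T :: real assume "T > 0"
    have "((\<lambda>t. cis (c * t)) has_integral cis (c * T) / (\<i> * c) - cis (c * (- T)) / (\<i> * c)) {-T..T}"
    proof (rule fundamental_theorem_of_calculus)
      fix t
      have "((\<lambda>z. exp (\<i> * (c * z)) / (\<i> * c)) has_field_derivative exp (\<i> * (c * of_real t))) (at (of_real t))"
        using False by (auto intro!: derivative_eq_intros simp: field_simps)
      from has_vector_derivative_real_field[OF this]
      show "((\<lambda>t. cis (c * t) / (\<i> * c)) has_vector_derivative cis (c * t)) (at t within {-T..T})"
        by (simp add: cis_conv_exp)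
    qed (use \<open>T > 0\<close> in simp)
    then have "cmod (integral {-T..T} (\<lambda>t. cis (c * t)))
        = cmod (cis (c * T) / (\<i> * c) - cis (c * (- T)) / (\<i> * c))"
      by (simp add: integral_unique)
    also have "\<dots> \<le> cmod (cis (c * T) / (\<i> * c)) + cmod (cis (c * (- T)) / (\<i> * c))"
      by (rule norm_triangle_ineq4)
    also have "\<dots> = 2 / \<bar>c\<bar>" by (simp add: norm_divide norm_mult)
    finally show "cmod (integral {-T..T} (\<lambda>t. cis (c * t)) - integral {-T..T} (\<lambda>t. 0)) \<le> 2 / \<bar>c\<bar>"
      by simp
  qed
  then show ?thesis using False by simp
qed

text \<open>The averages over \<open>{-T..T}\<close> converge uniformly in \<open>T\<close>, so the two limits may be interchanged.\<close>
lemma has_mean_uniform_limit: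
  assumes u: "uniform_limit UNIV f g sequentially"
    and f: "\<And>n. has_mean (f n) (L n)" "\<And>n. continuous_on UNIV (f n)"
    and L: "L \<longlonglongrightarrow> M"
  shows "has_mean g M"
proof -
  have g: "continuous_on UNIV g"
    using f(2) by (intro uniform_limit_theorem[OF _ u]) auto
  have unif: "uniform_limit {0<..} (\<lambda>n T. integral {-T..T} (f n) / of_real (2 * T))
      (\<lambda>T. integral {-T..T} g / of_real (2 * T)) sequentially"
    unfolding uniform_limit_iff
  proof (intro allI impI)
    fix e :: real assume "e > 0"
    then have "\<forall>\<^sub>F n in sequentially. \<forall>t\<in>UNIV. dist (f n t) (g t) < e / 2"
      using u unfolding uniform_limit_iff by (meson half_gt_zero)
    then show "\<forall>\<^sub>F n in sequentially. \<forall>T\<in>{0<..}.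
       dist (integral {-T..T} (f n) / of_real (2 * T)) (integral {-T..T} g / of_real (2 * T)) < e"
    proof eventually_elim
      case (elim n)
      show ?case
      proof
        fix T :: real assume T: "T \<in> {0<..}"
        have "norm (integral {-T..T} (\<lambda>t. f n t - g t)) \<le> e / 2 * (T - (- T))"
        proof (rule integral_bound)
          show "continuous_on {-T..T} (\<lambda>t. f n t - g t)"
            by (intro continuous_on_diff continuous_on_subset[OF f(2)] continuous_on_subset[OF g]) auto
          show "norm (f n t - g t) \<le> e / 2" for t
            using elim by (auto simp: dist_norm intro: less_imp_le)
        qed (use T in simp)
        then have "norm (integral {-T..T} (f n) - integral {-T..T} g) \<le> e * T"
          using f(2) g by (simp add: integral_diff continuous_integrable)
        then have "norm (integral {-T..T} (f n) - integral {-T..T} g) / (2 * T) \<le> e / 2"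
          using T by (simp add: field_simps)
        then show "dist (integral {-T..T} (f n) / of_real (2 * T)) (integral {-T..T} g / of_real (2 * T)) < e"
          using T \<open>e > 0\<close>
          by (simp add: dist_norm diff_divide_distrib[symmetric] norm_divide)
      qed
    qed
  qed
  show ?thesis
    unfolding has_mean_def
  proof (rule swap_uniform_limit'[OF _ L])
    show "\<forall>\<^sub>F n in sequentially. ((\<lambda>T. integral {-T..T} (f n) / of_real (2 * T)) \<longlongrightarrow> L n) (at_top)"
      using f(1) by (simp add: has_mean_def)
    show "uniform_limit {0<..} (\<lambda>n T. integral {-T..T} (f n) / of_real (2 * T))
      (\<lambda>T. integral {-T..T} g / of_real (2 * T)) sequentially"
      by (rule unif)
  qed (use eventually_gt_at_top[of "0::real"] in auto)
qed

lemma nat_powr_Complex: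
  assumes "n \<ge> 1"
  shows "of_nat n powr Complex x t = of_real (real n powr x) * cis (ln (real n) * t)"
proof -
  have "of_nat n powr Complex x t = exp (Complex x t * of_real (ln (real n)))"
    using assms by (simp add: powr_def Ln_of_nat)
  also have "Complex x t * of_real (ln (real n)) = of_real (x * ln (real n)) + \<i> * of_real (ln (real n) * t)"
    by (simp add: complex_eq_iff)
  also have "exp \<dots> = of_real (exp (x * ln (real n))) * cis (ln (real n) * t)"
    by (simp only: exp_add exp_of_real cis_conv_exp)
  finally show ?thesis
    using assms by (simp add: powr_def mult.commute)
qed

text \<open>The function \<open>(n/m) powr s\<close>, whose product with a Dirichlet series moves the frequency \<open>n/m\<close> to
  \<open>0\<close>, where the mean sees it.\<close>
definition twist :: "nat \<Rightarrow> nat \<Rightarrow> complex \<Rightarrow> complex" where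
  "twist m n s = of_nat m powr (- s) * of_nat n powr s"

lemma norm_twist: "cmod (twist m n s) = real m powr (- Re s) * real n powr Re s"
  by (simp add: twist_def norm_mult norm_nat_powr)

lemma continuous_on_nat_powr:
  "continuous_on UNIV (\<lambda>t. of_nat n powr (Complex x (e * t)))"
  "continuous_on UNIV (\<lambda>t. of_nat n powr (- Complex x t))"
  "continuous_on UNIV (\<lambda>t. of_nat n powr (Complex x t))"
  by (cases "n = 0"; auto simp: Complex_eq intro!: continuous_intros)+

lemma continuous_on_twist: "continuous_on UNIV (\<lambda>t. twist m n (Complex x t))"
  unfolding twist_def by (intro continuous_intros continuous_on_nat_powr)

lemma has_mean_twist:
  assumes "k \<ge> 1" "m \<ge> 1" "n \<ge> 1"
  shows "has_mean (\<lambda>t. of_nat k powr (- Complex x t) * twist m n (Complex x t)) (if k * m = n then 1 else 0)"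
proof -
  define q where "q = real n / (real k * real m)"
  have q: "q > 0" using assms by (simp add: q_def)
  have lnq: "ln q = - ln k - ln m + ln n"
    using assms by (simp add: q_def ln_div ln_mult)
  have pq: "q powr x = real k powr (- x) * real m powr (- x) * real n powr x"
    using assms by (simp add: q_def powr_divide powr_mult powr_minus field_simps)
  have neg: "- Complex x t = Complex (- x) (- t)" for t by (simp add: complex_eq_iff)
  have "of_nat k powr (- Complex x t) * twist m n (Complex x t) = of_real (q powr x) * cis (ln q * t)" for t
    using assms unfolding twist_def neg
    by (simp add: nat_powr_Complex pq lnq cis_mult algebra_simps)
  moreover have "ln q = 0 \<longleftrightarrow> k * m = n"
  proof -
    have "ln q = 0 \<longleftrightarrow> q = 1" using q by simp
    also have "\<dots> \<longleftrightarrow> real (k * m) = real n" using assms by (auto simp: q_def)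
    finally show ?thesis unfolding of_nat_eq_iff .
  qed
  moreover have "q = 1" if "k * m = n"
    using that assms by (auto simp: q_def)
  ultimately show ?thesis
    using has_mean_cmult[OF has_mean_cis[of "ln q"], of "of_real (q powr x)"] by (auto split: if_splits)
qed

lemma has_mean_dirichlet_sum:
  assumes a: "abs_conv a x" and mn: "m \<ge> 1" "n \<ge> 1"
  shows "has_mean (\<lambda>t. dirichlet_sum a (Complex x t) * twist m n (Complex x t))
           (if m dvd n then a (n div m) else 0)"
proof (rule has_mean_uniform_limit)
  let ?c = "\<lambda>k t. a k * (of_nat k powr (- Complex x t) * twist m n (Complex x t))"
  let ?l = "\<lambda>k. if k * m = n then a k else 0"
  have c: "continuous_on UNIV (?c k)" for k
    by (intro continuous_intros continuous_on_nat_powr continuous_on_twist)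
  have mean_term: "has_mean (?c k) (?l k)" for k
  proof (cases "k = 0")
    case True
    then show ?thesis using mn by (simp add: has_mean_0)
  next
    case False
    then have "has_mean (?c k) (a k * (if k * m = n then 1 else 0))"
      using mn by (intro has_mean_cmult has_mean_twist) auto
    then show ?thesis by (simp split: if_splits)
  qed
  show "has_mean (\<lambda>t. \<Sum>k<K. ?c k t) (\<Sum>k<K. ?l k)" for K
    by (intro has_mean_sum mean_term c)
  show "continuous_on UNIV (\<lambda>t. \<Sum>k<K. ?c k t)" for K
    by (intro continuous_on_sum c)
  have "(\<lambda>K. \<Sum>k<K. ?l k) \<longlonglongrightarrow> (\<Sum>k\<in>{..n}. ?l k)"
  proof -
    have "?l sums (\<Sum>k\<in>{..n}. ?l k)"
      using mn by (intro sums_finite) (auto simp: not_le)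
    then show ?thesis by (simp add: sums_def)
  qed
  also have "(\<Sum>k\<in>{..n}. ?l k) = (if m dvd n then a (n div m) else 0)"
  proof (cases "m dvd n")
    case True
    then have "k * m = n \<longleftrightarrow> k = n div m" for k using mn by auto
    then show ?thesis using True by (simp add: sum.delta)
  next
    case False
    then have "k * m \<noteq> n" for k by auto
    then show ?thesis using False by simp
  qed
  finally show "(\<lambda>K. \<Sum>k<K. ?l k) \<longlonglongrightarrow> (if m dvd n then a (n div m) else 0)" .
  have "uniform_limit UNIV (\<lambda>K t. \<Sum>k<K. ?c k t) (\<lambda>t. \<Sum>k. ?c k t) sequentially"
  proof (rule Weierstrass_m_test)
    show "summable (\<lambda>k. cmod (a k) * real k powr (- x) * (real m powr (- x) * real n powr x))"
      using a by (intro summable_mult2) (simp add: abs_conv_def)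
    show "cmod (?c k t) \<le> cmod (a k) * real k powr (- x) * (real m powr (- x) * real n powr x)" for k t
      by (simp add: norm_mult norm_nat_powr norm_twist)
  qed
  moreover have "(\<Sum>k. ?c k t) = dirichlet_sum a (Complex x t) * twist m n (Complex x t)" for t
    using sums_mult2[OF abs_conv_sums[of a "Complex x t"], of "twist m n (Complex x t)"] a
    by (simp add: sums_iff mult.assoc)
  ultimately show "uniform_limit UNIV (\<lambda>K t. \<Sum>k<K. ?c k t)
      (\<lambda>t. dirichlet_sum a (Complex x t) * twist m n (Complex x t)) sequentially"
    by simp
qed

text \<open>The coefficients are means of the function on a single vertical line.\<close>
lemma dirichlet_sum_unique:
  assumes "abs_conv a x" "abs_conv b x" "n \<ge> 1"
    and eq: "\<And>s. Re s = x \<Longrightarrow> dirichlet_sum a s = dirichlet_sum b s"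
  shows "a n = b n"
proof -
  have "has_mean (\<lambda>t. dirichlet_sum a (Complex x t) * twist 1 n (Complex x t)) (a n)"
    "has_mean (\<lambda>t. dirichlet_sum b (Complex x t) * twist 1 n (Complex x t)) (b n)"
    using has_mean_dirichlet_sum[OF assms(1), of 1 n] has_mean_dirichlet_sum[OF assms(2), of 1 n] assms(3)
    by auto
  then show ?thesis
    using eq by (auto intro: has_mean_unique)
qed

text \<open>Contour shift by means of a primitive \<open>P\<close> of \<open>h\<close>: the integrals over the two segments are
  differences of values of \<open>P\<close> at their end points, and these values differ by at most
  \<open>B * \<bar>y - x\<bar>\<close> between the two lines, whatever \<open>T\<close> is.\<close>
lemma has_mean_shift:
  assumes hol: "h holomorphic_on half_plane (ereal r)" and "r < x" "r < y"
    and B: "\<And>s. min x y \<le> Re s \<Longrightarrow> Re s \<le> max x y \<Longrightarrow> cmod (h s) \<le> B"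
    and mean: "has_mean (\<lambda>t. h (Complex x t)) L"
  shows "has_mean (\<lambda>t. h (Complex y t)) L"
proof -
  obtain P where "\<And>s. s \<in> half_plane (ereal r) \<Longrightarrow> (P has_field_derivative h s) (at s within half_plane (ereal r))"
    using holomorphic_convex_primitive'[OF convex_half_plane open_half_plane hol] by blast
  then have P: "(P has_field_derivative h s) (at s)" if "r < Re s" for s
    using that at_within_open[OF _ open_half_plane] by (metis mem_half_plane)
  have int: "integral {-T..T} (\<lambda>t. h (Complex u t)) = (P (Complex u T) - P (Complex u (-T))) / \<i>"
    if "r < u" "T > 0" for u T
  proof -
    have "((\<lambda>t. h (Complex u t)) has_integral P (Complex u T) / \<i> - P (Complex u (-T)) / \<i>) {-T..T}"
    proof (rule fundamental_theorem_of_calculus)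
      fix t
      have "((\<lambda>t. Complex u t) has_vector_derivative \<i>) (at t within {-T..T})"
        unfolding Complex_eq by (auto intro!: derivative_eq_intros)
      from field_vector_diff_chain_within[OF this, of P "h (Complex u t)"]
      have "((\<lambda>t. P (Complex u t)) has_vector_derivative \<i> * h (Complex u t)) (at t within {-T..T})"
        using P[of "Complex u t"] \<open>r < u\<close> by (simp add: o_def has_field_derivative_at_within)
      from has_vector_derivative_divide[OF this, of \<i>]
      show "((\<lambda>t. P (Complex u t) / \<i>) has_vector_derivative h (Complex u t)) (at t within {-T..T})"
        by simp
    qed (use that in simp)
    then show ?thesis by (simp only: integral_unique diff_divide_distrib)
  qed
  have diff: "cmod (P (Complex y T) - P (Complex x T)) \<le> B * \<bar>y - x\<bar>" for T
  proof -
    have "cmod (P (Complex y T) - P (Complex x T)) \<le> B * cmod (Complex y T - Complex x T)"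
    proof (rule field_differentiable_bound)
      have "{s. min x y \<le> Re s \<and> Re s \<le> max x y} = {s. min x y \<le> Re s} \<inter> {s. Re s \<le> max x y}" by auto
      then show "convex {s. min x y \<le> Re s \<and> Re s \<le> max x y}"
        by (simp add: convex_Int convex_halfspace_Re_ge convex_halfspace_Re_le)
      show "(P has_field_derivative h s) (at s within {s. min x y \<le> Re s \<and> Re s \<le> max x y})"
        if "s \<in> {s. min x y \<le> Re s \<and> Re s \<le> max x y}" for s
        using that assms(2,3) by (intro has_field_derivative_at_within[OF P]) (auto simp: min_def split: if_splits)
    qed (use B in auto)
    also have "Complex y T - Complex x T = of_real (y - x)" by (simp add: complex_eq_iff)
    finally show ?thesis by (simp only: norm_of_real)
  qed
  show ?thesis
  proof (rule has_mean_bounded_diff[OF mean])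
    fix T :: real assume T: "T > 0"
    have "integral {-T..T} (\<lambda>t. h (Complex y t)) - integral {-T..T} (\<lambda>t. h (Complex x t))
        = ((P (Complex y T) - P (Complex x T)) - (P (Complex y (-T)) - P (Complex x (-T)))) / \<i>"
      using T assms(2,3) by (simp add: int field_simps)
    also have "cmod \<dots> \<le> cmod (P (Complex y T) - P (Complex x T)) + cmod (P (Complex y (-T)) - P (Complex x (-T)))"
      unfolding norm_divide using norm_triangle_ineq4 by simp
    also have "\<dots> \<le> 2 * B * \<bar>y - x\<bar>"
      using diff[of T] diff[of "-T"] by simp
    finally show "cmod (integral {-T..T} (\<lambda>t. h (Complex y t)) - integral {-T..T} (\<lambda>t. h (Complex x t)))
        \<le> 2 * B * \<bar>y - x\<bar>" .
  qed
qed

text \<open>The coefficient formula holds on every line in the half-plane where \<open>f\<close> is bounded, even where the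
  Dirichlet series is not known to converge: it holds far to the right, and the line may be shifted.\<close>
lemma has_mean_bounded_dirichlet:
  assumes hol: "f holomorphic_on half_plane (ereal r)"
    and bd: "\<And>s. r < Re s \<Longrightarrow> cmod (f s) \<le> B"
    and f: "\<And>s. r' \<le> Re s \<Longrightarrow> abs_conv a (Re s)" "\<And>s. r' \<le> Re s \<Longrightarrow> f s = dirichlet_sum a s"
    and "r < x" and mn: "m \<ge> 1" "n \<ge> 1"
  shows "has_mean (\<lambda>t. f (Complex x t) * twist m n (Complex x t)) (if m dvd n then a (n div m) else 0)"
proof -
  \<comment> \<open>a line on which the series converges absolutely\<close>
  define y where "y = max r' x"
  show ?thesis
  proof (rule has_mean_shift[of "\<lambda>s. f s * twist m n s" r y x])
    show "(\<lambda>s. f s * twist m n s) holomorphic_on half_plane (ereal r)"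
      unfolding twist_def using mn by (intro holomorphic_intros hol) auto
    show "r < y" "r < x" using \<open>r < x\<close> by (auto simp: y_def)
    have "abs_conv a y" using f(1)[of "of_real y"] by (simp add: y_def)
    then have "has_mean (\<lambda>t. dirichlet_sum a (Complex y t) * twist m n (Complex y t))
        (if m dvd n then a (n div m) else 0)"
      by (rule has_mean_dirichlet_sum[OF _ mn])
    moreover have "f (Complex y t) = dirichlet_sum a (Complex y t)" for t
      using f(2)[of "Complex y t"] by (simp add: y_def)
    ultimately show "has_mean (\<lambda>t. f (Complex y t) * twist m n (Complex y t))
        (if m dvd n then a (n div m) else 0)"
      by simp
    fix s assume s: "min y x \<le> Re s" "Re s \<le> max y x"
    then have s': "x \<le> Re s" "Re s \<le> y" by (auto simp: y_def)
    have "cmod (f s) \<le> B" using bd s' \<open>r < x\<close> by auto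
    moreover have "cmod (twist m n s) \<le> real m powr (- x) * real n powr y"
      unfolding norm_twist using s' mn by (intro mult_mono powr_mono) auto
    ultimately show "cmod (f s * twist m n s) \<le> B * (real m powr (- x) * real n powr y)"
      unfolding norm_mult using order_trans[OF norm_ge_zero \<open>cmod (f s) \<le> B\<close>]
      by (intro mult_mono) auto
  qed
qed

text \<open>Orthogonality of the functions \<open>t \<mapsto> n powr (i e t)\<close>.  The parameter \<open>e\<close> is used with both signs,
  for a Dirichlet polynomial and for a polynomial in the conjugate functions.\<close>
lemma has_mean_norm_square:
  assumes "e \<noteq> 0"
  shows "has_mean (\<lambda>t. of_real ((cmod (\<Sum>m\<in>{1..N}. c m * of_nat m powr (Complex x (e * t))))\<^sup>2))
    (of_real (\<Sum>m\<in>{1..N}. (cmod (c m))\<^sup>2 * real m powr (2 * x)))"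
proof -
  let ?h = "\<lambda>m t. of_nat m powr Complex x (e * t)"
  have pair: "has_mean (\<lambda>t. (c m * cnj (c n)) * (?h m t * cnj (?h n t)))
      (if m = n then of_real ((cmod (c m))\<^sup>2 * real m powr (2 * x)) else 0)"
    if "m \<in> {1..N}" "n \<in> {1..N}" for m n
  proof -
    let ?d = "e * (ln (real m) - ln (real n))"
    have 1: "?h m t * cnj (?h n t) = of_real (real m powr x * real n powr x) * cis (?d * t)" for t
      using that by (simp add: nat_powr_Complex cis_cnj cis_mult algebra_simps)
    have 2: "?d = 0 \<longleftrightarrow> m = n" using that assms by auto
    have eq: "(c m * cnj (c n)) * (of_real (real m powr x * real n powr x) * (if ?d = 0 then 1 else 0))
      = (if m = n then of_real ((cmod (c m))\<^sup>2 * real m powr (2 * x)) else 0)"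
    proof (cases "m = n")
      case True
      have "real n powr (2 * x) = real n powr x * real n powr x"
        by (simp flip: powr_add)
      then show ?thesis
        using True 2 by (simp only: complex_norm_square of_real_mult if_True mult_1_right simp_thms)
    qed (use 2 in simp)
    show ?thesis unfolding 1 eq[symmetric] by (intro has_mean_cmult has_mean_cis)
  qed
  have "has_mean (\<lambda>t. \<Sum>m\<in>{1..N}. \<Sum>n\<in>{1..N}. (c m * cnj (c n)) * (?h m t * cnj (?h n t)))
      (\<Sum>m\<in>{1..N}. \<Sum>n\<in>{1..N}. if m = n then of_real ((cmod (c m))\<^sup>2 * real m powr (2 * x)) else 0)"
    by (intro has_mean_sum pair continuous_on_sum continuous_on_mult continuous_on_const
        continuous_on_cnj continuous_on_nat_powr)
  also have "(\<Sum>m\<in>{1..N}. \<Sum>n\<in>{1..N}. if m = n then of_real ((cmod (c m))\<^sup>2 * real m powr (2 * x)) else 0)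
      = (of_real (\<Sum>m\<in>{1..N}. (cmod (c m))\<^sup>2 * real m powr (2 * x)) :: complex)"
    by (simp add: sum.delta)
  also have "(\<lambda>t. \<Sum>m\<in>{1..N}. \<Sum>n\<in>{1..N}. (c m * cnj (c n)) * (?h m t * cnj (?h n t))) =
      (\<lambda>t. of_real ((cmod (\<Sum>m\<in>{1..N}. c m * ?h m t))\<^sup>2))"
    unfolding complex_norm_square cnj_sum sum_product
    by (intro ext sum.cong refl) (simp add: ac_simps)
  finally show ?thesis .
qed


section \<open>The adjoint of a convolution and the weights of vertical lines\<close>

text \<open>The adjoint of \<open>dirichlet_conv a\<close> on sequences supported in \<open>{1..N}\<close>; the cut-off keeps all sums
  finite.\<close>
definition adjoint_conv :: "(nat \<Rightarrow> complex) \<Rightarrow> nat \<Rightarrow> (nat \<Rightarrow> complex) \<Rightarrow> nat \<Rightarrow> complex" where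
  "adjoint_conv a N g m = (\<Sum>n | n \<in> {1..N} \<and> m dvd n. cnj (a (n div m)) * g n)"

text \<open>With \<open>F\<close> and \<open>G\<close> the Dirichlet polynomials with coefficients \<open>m powr (2 * x) * adjoint_conv a N g m\<close>
  and \<open>cnj (g n)\<close>, the second one taken with the opposite sign of the frequencies, the mean of
  \<open>f * F * G\<close> is the left-hand side \<open>X\<close>.  The mean of \<open>|F|^2\<close> is \<open>X\<close> as well, and that of \<open>|G|^2\<close> is
  the sum \<open>Y\<close> on the right, so that \<open>|f * F * G| \<le> (|F|^2 + B^2 |G|^2) / 2\<close> gives
  \<open>X \<le> (X + B^2 Y) / 2\<close>.\<close>
lemma adjoint_conv_line_bound:
  assumes hol: "f holomorphic_on half_plane (ereal r)"
    and bd: "\<And>s. r < Re s \<Longrightarrow> cmod (f s) \<le> B"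
    and f: "\<And>s. r' \<le> Re s \<Longrightarrow> abs_conv a (Re s)" "\<And>s. r' \<le> Re s \<Longrightarrow> f s = dirichlet_sum a s"
    and "r < x"
  shows "(\<Sum>m\<in>{1..N}. real m powr (2 * x) * (cmod (adjoint_conv a N g m))\<^sup>2)
    \<le> B\<^sup>2 * (\<Sum>m\<in>{1..N}. real m powr (2 * x) * (cmod (g m))\<^sup>2)"
proof -
  define u where "u m = of_real (real m powr (2 * x)) * adjoint_conv a N g m" for m
  define F where "F t = (\<Sum>m\<in>{1..N}. u m * of_nat m powr (Complex (- x) (- 1 * t)))" for t
  define G where "G t = (\<Sum>n\<in>{1..N}. cnj (g n) * of_nat n powr (Complex x (1 * t)))" for t
  define X where "X = (\<Sum>m\<in>{1..N}. real m powr (2 * x) * (cmod (adjoint_conv a N g m))\<^sup>2)"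
  define Y where "Y = (\<Sum>m\<in>{1..N}. real m powr (2 * x) * (cmod (g m))\<^sup>2)"
  have neg: "Complex (- x) (- 1 * t) = - Complex x t" for t by (simp add: complex_eq_iff)
  have cF: "continuous_on UNIV F" and cG: "continuous_on UNIV G"
    unfolding F_def G_def by (intro continuous_intros continuous_on_nat_powr)+
  have contf: "continuous_on UNIV (\<lambda>t. f (Complex x t))"
  proof -
    have "continuous_on UNIV (\<lambda>t. Complex x t)"
      unfolding Complex_eq by (intro continuous_intros)
    moreover have "(\<lambda>t. Complex x t) ` UNIV \<subseteq> half_plane (ereal r)"
      using \<open>r < x\<close> by auto
    ultimately show ?thesis
      using continuous_on_compose2[OF holomorphic_on_imp_continuous_on[OF hol]] by blast
  qed
  have meanF: "has_mean (\<lambda>t. of_real ((cmod (F t))\<^sup>2)) (of_real X)"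
  proof -
    have "(\<Sum>m\<in>{1..N}. (cmod (u m))\<^sup>2 * real m powr (2 * - x)) = X"
      unfolding X_def
    proof (rule sum.cong[OF refl])
      fix m assume "m \<in> {1..N}"
      then have "real m powr (2 * x) * real m powr (- 2 * x) = 1"
        by (simp flip: powr_add)
      then have "(real m powr (2 * x))\<^sup>2 * real m powr (- 2 * x) = real m powr (2 * x)"
        by (simp add: power2_eq_square)
      then show "(cmod (u m))\<^sup>2 * real m powr (2 * - x) = real m powr (2 * x) * (cmod (adjoint_conv a N g m))\<^sup>2"
        by (simp add: u_def norm_mult power_mult_distrib)
    qed
    then show ?thesis
      using has_mean_norm_square[of "-1" u "-x" N] unfolding F_def by simp
  qed
  have meanG: "has_mean (\<lambda>t. of_real ((cmod (G t))\<^sup>2)) (of_real Y)"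
    using has_mean_norm_square[of 1 "\<lambda>n. cnj (g n)" x N] unfolding G_def Y_def by (simp add: mult.commute)
  have mean_fmn: "has_mean (\<lambda>t. f (Complex x t) * twist m n (Complex x t)) (if m dvd n then a (n div m) else 0)"
    if "m \<in> {1..N}" "n \<in> {1..N}" for m n
    by (rule has_mean_bounded_dirichlet[OF hol bd f \<open>r < x\<close>]) (use that in auto)
  have cont_fmn: "continuous_on UNIV (\<lambda>t. f (Complex x t) * twist m n (Complex x t))" for m n
    by (intro continuous_on_mult contf continuous_on_twist)
  have "has_mean (\<lambda>t. \<Sum>m\<in>{1..N}. \<Sum>n\<in>{1..N}. (u m * cnj (g n)) * (f (Complex x t) * twist m n (Complex x t)))
      (\<Sum>m\<in>{1..N}. \<Sum>n\<in>{1..N}. (u m * cnj (g n)) * (if m dvd n then a (n div m) else 0))"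
    by (intro has_mean_sum has_mean_cmult mean_fmn continuous_on_sum continuous_on_mult continuous_on_const cont_fmn)
  also have "(\<lambda>t. \<Sum>m\<in>{1..N}. \<Sum>n\<in>{1..N}. (u m * cnj (g n)) * (f (Complex x t) * twist m n (Complex x t)))
     = (\<lambda>t. f (Complex x t) * (F t * G t))"
  proof
    fix t
    have "F t * G t = (\<Sum>m\<in>{1..N}. \<Sum>n\<in>{1..N}. (u m * of_nat m powr (- Complex x t)) * (cnj (g n) * of_nat n powr Complex x t))"
      unfolding F_def G_def neg sum_product by simp
    then show "(\<Sum>m\<in>{1..N}. \<Sum>n\<in>{1..N}. (u m * cnj (g n)) * (f (Complex x t) * twist m n (Complex x t)))
        = f (Complex x t) * (F t * G t)"
      by (simp only: sum_distrib_left twist_def ac_simps)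
  qed
  also have "(\<Sum>m\<in>{1..N}. \<Sum>n\<in>{1..N}. (u m * cnj (g n)) * (if m dvd n then a (n div m) else 0)) = of_real X"
  proof -
    have inner: "(\<Sum>n\<in>{1..N}. (u m * cnj (g n)) * (if m dvd n then a (n div m) else 0)) =
        u m * cnj (adjoint_conv a N g m)" for m
    proof -
      have "(\<Sum>n\<in>{1..N}. (u m * cnj (g n)) * (if m dvd n then a (n div m) else 0)) =
          (\<Sum>n\<in>{1..N}. if m dvd n then u m * cnj (cnj (a (n div m)) * g n) else 0)"
        by (intro sum.cong) auto
      also have "\<dots> = (\<Sum>n | n \<in> {1..N} \<and> m dvd n. u m * cnj (cnj (a (n div m)) * g n))"
        by (rule sum.inter_filter[symmetric]) simp
      finally show ?thesis
        unfolding adjoint_conv_def cnj_sum sum_distrib_left .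
    qed
    show ?thesis
      unfolding X_def inner of_real_sum by (simp only: u_def of_real_mult complex_norm_square mult.assoc)
  qed
  finally have meanFG: "has_mean (\<lambda>t. f (Complex x t) * (F t * G t)) (of_real X)" .
  have "Re (of_real X) \<le> Re (1 / 2 * (of_real X + of_real (B\<^sup>2) * of_real Y) :: complex)"
  proof (rule has_mean_Re_mono[OF meanFG])
    show "has_mean (\<lambda>t. 1 / 2 * (of_real ((cmod (F t))\<^sup>2) + of_real (B\<^sup>2) * of_real ((cmod (G t))\<^sup>2)))
      (1 / 2 * (of_real X + of_real (B\<^sup>2) * of_real Y))"
      by (intro has_mean_cmult has_mean_add meanF meanG continuous_intros cF cG)
    show "continuous_on UNIV (\<lambda>t. f (Complex x t) * (F t * G t))"
      by (intro continuous_intros contf cF cG)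
    show "continuous_on UNIV (\<lambda>t. 1 / 2 * (complex_of_real ((cmod (F t))\<^sup>2) + of_real (B\<^sup>2) * of_real ((cmod (G t))\<^sup>2)))"
      by (intro continuous_intros cF cG)
    fix t
    have "Re (f (Complex x t) * (F t * G t)) \<le> cmod (f (Complex x t)) * (cmod (F t) * cmod (G t))"
      using complex_Re_le_cmod[of "f (Complex x t) * (F t * G t)"] by (simp add: norm_mult)
    also have "\<dots> \<le> B * (cmod (F t) * cmod (G t))"
      using bd[of "Complex x t"] \<open>r < x\<close> by (intro mult_right_mono) auto
    also have "\<dots> \<le> 1 / 2 * ((cmod (F t))\<^sup>2 + B\<^sup>2 * (cmod (G t))\<^sup>2)"
      using sum_squares_bound[of "cmod (F t)" "B * cmod (G t)"] by (simp add: power_mult_distrib ac_simps)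
    finally show "Re (f (Complex x t) * (F t * G t)) \<le>
        Re (1 / 2 * (of_real ((cmod (F t))\<^sup>2) + of_real (B\<^sup>2) * of_real ((cmod (G t))\<^sup>2)))"
      by simp
  qed
  then show ?thesis
    unfolding X_def[symmetric] Y_def[symmetric] by simp
qed

text \<open>The boundary line is reached by letting \<open>x\<close> decrease to \<open>r\<close> in finite sums.\<close>
lemma adjoint_conv_bound:
  assumes hol: "f holomorphic_on half_plane (ereal r)"
    and bd: "\<And>s. r < Re s \<Longrightarrow> cmod (f s) \<le> B"
    and f: "\<And>s. r' \<le> Re s \<Longrightarrow> abs_conv a (Re s)" "\<And>s. r' \<le> Re s \<Longrightarrow> f s = dirichlet_sum a s"
  shows "(\<Sum>m\<in>{1..N}. real m powr (2 * r) * (cmod (adjoint_conv a N g m))\<^sup>2)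
    \<le> B\<^sup>2 * (\<Sum>m\<in>{1..N}. real m powr (2 * r) * (cmod (g m))\<^sup>2)"
proof (rule tendsto_le)
  show "((\<lambda>x. B\<^sup>2 * (\<Sum>m\<in>{1..N}. real m powr (2 * x) * (cmod (g m))\<^sup>2)) \<longlongrightarrow>
      B\<^sup>2 * (\<Sum>m\<in>{1..N}. real m powr (2 * r) * (cmod (g m))\<^sup>2)) (at_right r)"
    by (intro tendsto_mult tendsto_sum tendsto_powr tendsto_const tendsto_ident_at) auto
  show "((\<lambda>x. \<Sum>m\<in>{1..N}. real m powr (2 * x) * (cmod (adjoint_conv a N g m))\<^sup>2) \<longlongrightarrow>
      (\<Sum>m\<in>{1..N}. real m powr (2 * r) * (cmod (adjoint_conv a N g m))\<^sup>2)) (at_right r)"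
    by (intro tendsto_mult tendsto_sum tendsto_powr tendsto_const tendsto_ident_at) auto
  show "\<forall>\<^sub>F x in at_right r. (\<Sum>m\<in>{1..N}. real m powr (2 * x) * (cmod (adjoint_conv a N g m))\<^sup>2)
      \<le> B\<^sup>2 * (\<Sum>m\<in>{1..N}. real m powr (2 * x) * (cmod (g m))\<^sup>2)"
    using eventually_at_right_less
    by (rule eventually_mono) (rule adjoint_conv_line_bound[OF hol bd f])
qed auto

section \<open>The cone generated by divisibility\<close>

text \<open>The convex cone generated by the indicators of the sets of multiples, with functions compared on
  \<open>{1..N}\<close> only.  The cut-off allows products over the infinitely many primes to be replaced by finite
  ones.\<close>
definition divisor_cone :: "nat \<Rightarrow> (nat \<Rightarrow> real) set" where
  "divisor_cone N = {u. \<exists>c. (\<forall>d. 0 \<le> c d) \<and> (\<forall>j\<in>{1..N}. u j = (\<Sum>d | d dvd j. c d))}"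

lemma divisor_coneE:
  assumes "u \<in> divisor_cone N"
  obtains c where "\<And>d. 0 \<le> c d" "\<And>j. j \<in> {1..N} \<Longrightarrow> u j = (\<Sum>d | d dvd j. c d)"
  using assms that unfolding divisor_cone_def by blast

lemma divisor_cone_cong:
  assumes "u \<in> divisor_cone N" "\<And>j. j \<in> {1..N} \<Longrightarrow> v j = u j"
  shows "v \<in> divisor_cone N"
  using assms unfolding divisor_cone_def by auto

lemma divisor_cone_indicator: "(\<lambda>j. if d dvd j then 1 else 0) \<in> divisor_cone N"
proof -
  have "(\<Sum>e | e dvd j. if e = d then 1 else 0) = (if d dvd j then 1 else (0::real))" if "j \<ge> 1" for j
    using that by (simp add: sum.delta)
  then show ?thesis
    unfolding divisor_cone_def by (intro CollectI exI[of _ "\<lambda>e. if e = d then 1 else 0"]) auto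
qed

lemma divisor_cone_scale:
  assumes "u \<in> divisor_cone N" "0 \<le> x"
  shows "(\<lambda>j. x * u j) \<in> divisor_cone N"
proof -
  obtain c where c: "\<And>d. 0 \<le> c d" "\<And>j. j \<in> {1..N} \<Longrightarrow> u j = (\<Sum>d | d dvd j. c d)"
    using divisor_coneE[OF assms(1)] by metis
  then show ?thesis
    using assms(2) unfolding divisor_cone_def
    by (intro CollectI exI[of _ "\<lambda>d. x * c d"]) (auto simp: sum_distrib_left)
qed

lemma divisor_cone_const:
  assumes "0 \<le> x"
  shows "(\<lambda>j. x) \<in> divisor_cone N"
  using divisor_cone_scale[OF divisor_cone_indicator[of 1] assms] by simp

lemma divisor_cone_add:
  assumes "u \<in> divisor_cone N" "v \<in> divisor_cone N"
  shows "(\<lambda>j. u j + v j) \<in> divisor_cone N"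
proof -
  obtain c where c: "\<And>d. 0 \<le> c d" "\<And>j. j \<in> {1..N} \<Longrightarrow> u j = (\<Sum>d | d dvd j. c d)"
    using divisor_coneE[OF assms(1)] by metis
  obtain c' where c': "\<And>d. 0 \<le> c' d" "\<And>j. j \<in> {1..N} \<Longrightarrow> v j = (\<Sum>d | d dvd j. c' d)"
    using divisor_coneE[OF assms(2)] by metis
  show ?thesis
    using c c' unfolding divisor_cone_def
    by (intro CollectI exI[of _ "\<lambda>d. c d + c' d"]) (auto simp: sum.distrib)
qed

lemma divisor_cone_sum:
  assumes "\<And>i. i \<in> I \<Longrightarrow> u i \<in> divisor_cone N"
  shows "(\<lambda>j. \<Sum>i\<in>I. u i j) \<in> divisor_cone N"
  using assms
  by (induction I rule: infinite_finite_induct)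
     (auto intro: divisor_cone_const divisor_cone_add)

text \<open>The product of the indicators of the multiples of \<open>d\<close> and of \<open>e\<close> is the indicator of the multiples
  of \<open>lcm d e\<close>.\<close>
lemma divisor_cone_mult:
  assumes "u \<in> divisor_cone N" "v \<in> divisor_cone N"
  shows "(\<lambda>j. u j * v j) \<in> divisor_cone N"
proof -
  obtain c where c: "\<And>d. 0 \<le> c d" "\<And>j. j \<in> {1..N} \<Longrightarrow> u j = (\<Sum>d | d dvd j. c d)"
    using divisor_coneE[OF assms(1)] by metis
  obtain c' where c': "\<And>d. 0 \<le> c' d" "\<And>j. j \<in> {1..N} \<Longrightarrow> v j = (\<Sum>d | d dvd j. c' d)"
    using divisor_coneE[OF assms(2)] by metis
  define D where "D j = {d. d dvd j} \<times> {d. d dvd j}" for j :: nat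
  define h where "h p = c (fst p) * c' (snd p)" for p
  define b where "b l = sum h {p \<in> D l. lcm (fst p) (snd p) = l}" for l
  have "u j * v j = (\<Sum>l | l dvd j. b l)" if j: "j \<in> {1..N}" for j
  proof -
    have fin: "finite {d. d dvd j}" using j by auto
    have "u j * v j = sum h (D j)"
      using c(2)[OF j] c'(2)[OF j]
      by (simp add: D_def h_def sum_product sum.cartesian_product case_prod_unfold)
    also have "\<dots> = (\<Sum>l | l dvd j. sum h {p \<in> D j. lcm (fst p) (snd p) = l})"
      using fin by (intro sum.group[symmetric]) (auto simp: D_def)
    also have "\<dots> = (\<Sum>l | l dvd j. b l)"
    proof (rule sum.cong[OF refl])
      fix l assume "l \<in> {l. l dvd j}"
      then have "{p \<in> D j. lcm (fst p) (snd p) = l} = {p \<in> D l. lcm (fst p) (snd p) = l}"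
        by (auto simp: D_def intro: dvd_trans)
      then show "sum h {p \<in> D j. lcm (fst p) (snd p) = l} = b l"
        by (simp add: b_def)
    qed
    finally show ?thesis .
  qed
  moreover have "0 \<le> b l" for l
    unfolding b_def h_def by (intro sum_nonneg mult_nonneg_nonneg c(1) c'(1))
  ultimately have "(\<forall>l. 0 \<le> b l) \<and> (\<forall>j\<in>{1..N}. u j * v j = (\<Sum>l | l dvd j. b l))"
    by blast
  then show ?thesis
    unfolding divisor_cone_def by blast
qed

lemma divisor_cone_prod:
  assumes "\<And>i. i \<in> I \<Longrightarrow> u i \<in> divisor_cone N"
  shows "(\<lambda>j. \<Prod>i\<in>I. u i j) \<in> divisor_cone N"
  using assms
  by (induction I rule: infinite_finite_induct)
     (auto intro: divisor_cone_const divisor_cone_mult)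

text \<open>A telescoping sum: passing from exponent \<open>i - 1\<close> to exponent \<open>i\<close> adds \<open>h i - h (i - 1)\<close> times the
  indicator of the multiples of \<open>q ^ i\<close>.\<close>
lemma divisor_cone_multiplicity:
  fixes h :: "nat \<Rightarrow> real"
  assumes q: "prime q" and h0: "0 \<le> h 0" and mono: "\<And>i. h i \<le> h (Suc i)"
  shows "(\<lambda>j. h (multiplicity q j)) \<in> divisor_cone N"
proof (rule divisor_cone_cong)
  have step: "0 \<le> h i - h (i - 1)" for i
    using mono[of "i - 1"] by (cases i) auto
  show "(\<lambda>j. h 0 + (\<Sum>i\<in>{1..N}. (h i - h (i - 1)) * (if q ^ i dvd j then 1 else 0))) \<in> divisor_cone N"
    by (intro divisor_cone_add divisor_cone_sum divisor_cone_scale divisor_cone_const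
        divisor_cone_indicator h0 step)
  fix j assume j: "j \<in> {1..N}"
  let ?v = "multiplicity q j"
  have dvd: "q ^ i dvd j \<longleftrightarrow> i \<le> ?v" for i
    using j q by (intro power_dvd_iff_le_multiplicity) auto
  have "?v < q ^ ?v"
    using prime_gt_1_nat[OF q] by (intro power_gt_expt) simp
  also have "\<dots> \<le> j"
    using j by (intro dvd_imp_le multiplicity_dvd) auto
  finally have v: "?v \<le> N" using j by auto
  have "(\<Sum>i\<in>{1..N}. (h i - h (i - 1)) * (if q ^ i dvd j then 1 else 0))
      = (\<Sum>i\<in>{1..?v}. (h i - h (i - 1)) * (if q ^ i dvd j then 1 else 0))"
    using v by (intro sum.mono_neutral_right) (auto simp: dvd)
  also have "\<dots> = (\<Sum>i\<in>{Suc 0..?v}. h i - h (i - 1))"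
    by (intro sum.cong) (auto simp: dvd)
  also have "\<dots> = h ?v - h 0"
    by (rule sum_telescope'') simp
  finally show "h ?v = h 0 + (\<Sum>i\<in>{1..N}. (h i - h (i - 1)) * (if q ^ i dvd j then 1 else 0))"
    by simp
qed


lemma sum_multiples:
  fixes f :: "nat \<Rightarrow> 'a :: comm_monoid_add"
  assumes "d \<ge> 1"
  shows "(\<Sum>j | j \<in> {1..N} \<and> d dvd j. f j) = (\<Sum>m\<in>{1..N div d}. f (d * m))"
  by (rule sum.reindex_bij_witness[of _ "\<lambda>m. d * m" "\<lambda>j. j div d"])
     (use assms in \<open>auto simp: div_le_mono less_eq_div_iff_mult_less_eq mult.commute dvd_imp_le
        Suc_le_eq div_greater_zero_iff\<close>)

text \<open>The quotient \<open>n div m\<close> does not change when \<open>n\<close> and \<open>m\<close> are both multiplied by \<open>d\<close>.  The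
  dilated sequence is cut off where \<open>d * n\<close> leaves the range \<open>{1..N}\<close>.\<close>
lemma adjoint_conv_multiple:
  assumes "d \<ge> 1"
  shows "adjoint_conv a N g (d * m) = adjoint_conv a N (\<lambda>n. if d * n \<le> N then g (d * n) else 0) m"
proof -
  have "adjoint_conv a N g (d * m) = (\<Sum>n | n \<in> {1..N div d} \<and> m dvd n. cnj (a (n div m)) * g (d * n))"
    unfolding adjoint_conv_def
    by (rule sum.reindex_bij_witness[of _ "\<lambda>n. d * n" "\<lambda>j. j div d"])
       (use assms in \<open>auto simp: less_eq_div_iff_mult_less_eq ac_simps elim!: dvdE\<close>)
  also have "\<dots> = adjoint_conv a N (\<lambda>n. if d * n \<le> N then g (d * n) else 0) m"
    unfolding adjoint_conv_def
  proof (rule sum.mono_neutral_cong_left)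
    show "{n. n \<in> {1..N div d} \<and> m dvd n} \<subseteq> {n. n \<in> {1..N} \<and> m dvd n}"
      using assms by (auto intro: order_trans[OF _ div_le_dividend])
  qed (use assms in \<open>auto simp: less_eq_div_iff_mult_less_eq mult.commute\<close>)
  finally show ?thesis .
qed

text \<open>Both sides are linear in \<open>u\<close>, so only the indicator of the multiples of some \<open>d\<close> matters.  For it,
  the claim is the hypothesis applied to \<open>n \<mapsto> g (d * n)\<close>, multiplied by \<open>d powr \<delta>\<close>.\<close>
lemma adjoint_conv_cone_bound:
  assumes base: "\<And>g. (\<Sum>m\<in>{1..N}. real m powr \<delta> * (cmod (adjoint_conv a N g m))\<^sup>2)
      \<le> K * (\<Sum>m\<in>{1..N}. real m powr \<delta> * (cmod (g m))\<^sup>2)"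
    and u: "u \<in> divisor_cone N"
  shows "(\<Sum>m\<in>{1..N}. real m powr \<delta> * u m * (cmod (adjoint_conv a N g m))\<^sup>2)
      \<le> K * (\<Sum>m\<in>{1..N}. real m powr \<delta> * u m * (cmod (g m))\<^sup>2)"
proof -
  obtain c where c: "\<And>d. 0 \<le> c d" "\<And>j. j \<in> {1..N} \<Longrightarrow> u j = (\<Sum>d | d dvd j. c d)"
    using divisor_coneE[OF u] by metis
  have expand: "(\<Sum>j\<in>{1..N}. real j powr \<delta> * u j * X j)
      = (\<Sum>d\<in>{1..N}. c d * (\<Sum>j | j \<in> {1..N} \<and> d dvd j. real j powr \<delta> * X j))" for X
  proof -
    have "(\<Sum>j\<in>{1..N}. real j powr \<delta> * u j * X j)
        = (\<Sum>j\<in>{1..N}. \<Sum>d | d \<in> {1..N} \<and> d dvd j. c d * (real j powr \<delta> * X j))"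
    proof (rule sum.cong[OF refl])
      fix j assume j: "j \<in> {1..N}"
      then have "{d. d dvd j} = {d. d \<in> {1..N} \<and> d dvd j}"
        by (auto dest: dvd_imp_le intro: Suc_leI dvd_pos_nat[of j])
      then show "real j powr \<delta> * u j * X j = (\<Sum>d | d \<in> {1..N} \<and> d dvd j. c d * (real j powr \<delta> * X j))"
        using c(2)[OF j] by (simp add: sum_distrib_right sum_distrib_left ac_simps)
    qed
    also have "\<dots> = (\<Sum>d\<in>{1..N}. \<Sum>j | j \<in> {1..N} \<and> d dvd j. c d * (real j powr \<delta> * X j))"
      by (rule sum.swap_restrict) auto
    finally show ?thesis by (simp add: sum_distrib_left)
  qed
  have "(\<Sum>j | j \<in> {1..N} \<and> d dvd j. real j powr \<delta> * (cmod (adjoint_conv a N g j))\<^sup>2)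
      \<le> K * (\<Sum>j | j \<in> {1..N} \<and> d dvd j. real j powr \<delta> * (cmod (g j))\<^sup>2)"
    if d: "d \<in> {1..N}" for d
  proof -
    define g' where "g' n = (if d * n \<le> N then g (d * n) else 0)" for n
    have shift: "adjoint_conv a N g (d * m) = adjoint_conv a N g' m" for m
      using d adjoint_conv_multiple[of d a N g m] by (simp add: g'_def[abs_def])
    have "(\<Sum>j | j \<in> {1..N} \<and> d dvd j. real j powr \<delta> * (cmod (adjoint_conv a N g j))\<^sup>2)
        = real d powr \<delta> * (\<Sum>m\<in>{1..N div d}. real m powr \<delta> * (cmod (adjoint_conv a N g' m))\<^sup>2)"
      using d unfolding shift[symmetric] by (subst sum_multiples)
        (auto simp: sum_distrib_left powr_mult ac_simps intro!: sum.cong)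
    also have "\<dots> \<le> real d powr \<delta> * (\<Sum>m\<in>{1..N}. real m powr \<delta> * (cmod (adjoint_conv a N g' m))\<^sup>2)"
      by (intro mult_left_mono sum_mono2) (auto intro: order_trans[OF _ div_le_dividend])
    also have "\<dots> \<le> real d powr \<delta> * (K * (\<Sum>m\<in>{1..N}. real m powr \<delta> * (cmod (g' m))\<^sup>2))"
      by (intro mult_left_mono base) auto
    also have "(\<Sum>m\<in>{1..N}. real m powr \<delta> * (cmod (g' m))\<^sup>2) = (\<Sum>m\<in>{1..N div d}. real m powr \<delta> * (cmod (g (d * m)))\<^sup>2)"
      by (rule sum.mono_neutral_cong_right)
         (use d in \<open>auto simp: g'_def less_eq_div_iff_mult_less_eq mult.commute intro: order_trans[OF _ div_le_dividend]\<close>)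
    also have "real d powr \<delta> * (K * \<dots>) = K * (\<Sum>j | j \<in> {1..N} \<and> d dvd j. real j powr \<delta> * (cmod (g j))\<^sup>2)"
      using d by (subst sum_multiples)
        (auto simp: sum_distrib_left powr_mult ac_simps intro!: sum.cong)
    finally show ?thesis .
  qed
  then have "(\<Sum>d\<in>{1..N}. c d * (\<Sum>j | j \<in> {1..N} \<and> d dvd j. real j powr \<delta> * (cmod (adjoint_conv a N g j))\<^sup>2))
     \<le> (\<Sum>d\<in>{1..N}. c d * (K * (\<Sum>j | j \<in> {1..N} \<and> d dvd j. real j powr \<delta> * (cmod (g j))\<^sup>2)))"
    by (intro sum_mono mult_left_mono c(1))
  also have "\<dots> = K * (\<Sum>d\<in>{1..N}. c d * (\<Sum>j | j \<in> {1..N} \<and> d dvd j. real j powr \<delta> * (cmod (g j))\<^sup>2))"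
    unfolding sum_distrib_left[of K _ "{1..N}"] by (intro sum.cong refl mult.left_commute)
  finally show ?thesis
    by (simp only: expand[of "\<lambda>j. (cmod (adjoint_conv a N g j))\<^sup>2"] expand[of "\<lambda>j. (cmod (g j))\<^sup>2"])
qed


section \<open>Additive weights\<close>

lemma additive_prod_prime_powers:
  fixes w :: "nat \<Rightarrow> real"
  assumes additive: "\<And>m n. m \<ge> 2 \<Longrightarrow> n \<ge> 2 \<Longrightarrow> coprime m n \<Longrightarrow> w (m * n) = w m + w n"
    and "finite S" "S \<noteq> {}" "\<And>p. p \<in> S \<Longrightarrow> prime p" "\<And>p. p \<in> S \<Longrightarrow> e p \<ge> (1::nat)"
  shows "w (\<Prod>p\<in>S. p ^ e p) = (\<Sum>p\<in>S. w (p ^ e p))"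
  using assms(2-5)
proof (induction S rule: finite_ne_induct)
  case (insert p S)
  have gt1: "1 < q ^ e q" if "q \<in> insert p S" for q
  proof -
    have "prime q" "e q \<ge> 1" using insert.prems that by auto
    then show ?thesis using prime_gt_1_nat[of q] by (intro one_less_power) auto
  qed
  have "1 < (\<Prod>q\<in>S. q ^ e q)"
  proof -
    obtain s where s: "s \<in> S" using insert.hyps by auto
    have "s ^ e s dvd (\<Prod>q\<in>S. q ^ e q)"
      using insert.hyps s by (intro dvd_prodI)
    moreover have "0 < (\<Prod>q\<in>S. q ^ e q)"
      by (intro prod_pos ballI zero_less_power prime_gt_0_nat insert.prems insertI2)
    ultimately have "s ^ e s \<le> (\<Prod>q\<in>S. q ^ e q)" by (rule dvd_imp_le)
    then show ?thesis using gt1[of s] s by simp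
  qed
  moreover have "coprime (p ^ e p) (\<Prod>q\<in>S. q ^ e q)"
    using insert.hyps insert.prems
    by (intro prod_coprime_right) (auto intro!: coprime_power_left_iff[THEN iffD2] coprime_power_right_iff[THEN iffD2] primes_coprime)
  ultimately show ?case
    using insert gt1[of p] by (simp add: additive)
qed simp

text \<open>On \<open>{1..N}\<close> the function is the sum over the primes \<open>p \<le> N\<close> of a function of the exponent of \<open>p\<close>,
  which carries \<open>w\<close>, times a power of each prime \<open>q \<noteq> p\<close>.  The hypothesis on ratios makes the first
  factor nondecreasing and \<open>\<delta> \<le> 0\<close> the others.  At \<open>1\<close> all these summands
  vanish.\<close>
lemma additive_weight_in_divisor_cone:
  fixes w :: "nat \<Rightarrow> real"
  assumes pos: "\<And>j. j \<ge> 2 \<Longrightarrow> w j > 0"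
    and additive: "\<And>m n. m \<ge> 2 \<Longrightarrow> n \<ge> 2 \<Longrightarrow> coprime m n \<Longrightarrow> w (m * n) = w m + w n"
    and ratio: "\<And>p j. prime p \<Longrightarrow> j \<ge> 2 \<Longrightarrow> w (p ^ (j - 1)) / w (p ^ j) \<le> real p powr (- \<delta>)"
    and nonpos: "\<delta> \<le> 0"
  shows "(\<lambda>j. if j \<ge> 2 then w j * real j powr (- \<delta>) else 0) \<in> divisor_cone N"
proof (rule divisor_cone_cong)
  define P where "P = {p. prime p \<and> p \<le> N}"
  define H where "H p k = (if k = 0 then 0 else w (p ^ k) * real p powr (- \<delta> * real k))" for p k :: nat
  have finP: "finite P" by (simp add: P_def)
  have prime_pow: "2 \<le> p ^ k" if "prime p" "k \<ge> 1" for p k :: nat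
    using one_less_power[of p k] prime_gt_1_nat[OF that(1)] that(2) by simp
  have H: "(\<lambda>j. H p (multiplicity p j)) \<in> divisor_cone N" if "prime p" for p
  proof (rule divisor_cone_multiplicity[OF that])
    fix k
    show "H p k \<le> H p (Suc k)"
    proof (cases "k = 0")
      case True
      then show ?thesis using pos[of p] prime_ge_2_nat[OF that] by (simp add: H_def)
    next
      case False
      have "w (p ^ k) / w (p ^ Suc k) \<le> real p powr (- \<delta>)"
        using ratio[OF that, of "Suc k"] False by simp
      then have "w (p ^ k) \<le> real p powr (- \<delta>) * w (p ^ Suc k)"
        using pos[OF prime_pow[OF that, of "Suc k"]] by (simp add: divide_le_eq)
      then have "w (p ^ k) * real p powr (- \<delta> * real k)
          \<le> real p powr (- \<delta>) * w (p ^ Suc k) * real p powr (- \<delta> * real k)"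
        by (intro mult_right_mono) auto
      also have "\<dots> = w (p ^ Suc k) * real p powr (- \<delta> * real (Suc k))"
        by (simp add: powr_add[symmetric] algebra_simps)
      finally show ?thesis using False by (simp add: H_def)
    qed
  qed (simp add: H_def)
  have E: "(\<lambda>j. real q powr (- \<delta> * real (multiplicity q j))) \<in> divisor_cone N" if "prime q" for q
  proof (rule divisor_cone_multiplicity[OF that])
    fix i
    have "- \<delta> * real i \<le> - \<delta> * real (Suc i)"
      using nonpos by (intro mult_left_mono) auto
    then show "real q powr (- \<delta> * real i) \<le> real q powr (- \<delta> * real (Suc i))"
      using prime_gt_1_nat[OF that] by (intro powr_mono) auto
  qed simp
  show "(\<lambda>j. \<Sum>p\<in>P. H p (multiplicity p j) * (\<Prod>q\<in>P - {p}. real q powr (- \<delta> * real (multiplicity q j)))) \<in> divisor_cone N"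
    by (intro divisor_cone_sum divisor_cone_mult divisor_cone_prod H E) (auto simp: P_def)
  fix j assume j: "j \<in> {1..N}"
  have sub: "prime_factors j \<subseteq> P"
    using j by (auto simp: P_def prime_factors_dvd dest: dvd_imp_le)
  have out: "multiplicity p j = 0" if "p \<in> P - prime_factors j" for p
    using that j by (auto simp: P_def prime_factors_dvd not_dvd_imp_multiplicity_0)
  have factorization: "(\<Prod>p\<in>prime_factors j. p ^ multiplicity p j) = j"
    using j by (intro prime_factorization_nat[symmetric]) simp
  have powr_j: "real j powr (- \<delta>) = (\<Prod>q\<in>P. real q powr (- \<delta> * real (multiplicity q j)))"
  proof -
    have "real j powr (- \<delta>) = (\<Prod>p\<in>prime_factors j. real p ^ multiplicity p j) powr (- \<delta>)"
      using arg_cong[OF factorization, of real] by simp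
    also have "\<dots> = (\<Prod>p\<in>prime_factors j. (real p ^ multiplicity p j) powr (- \<delta>))"
      by (rule prod_powr_distrib)
    also have "\<dots> = (\<Prod>q\<in>prime_factors j. real q powr (- \<delta> * real (multiplicity q j)))"
    proof (rule prod.cong[OF refl])
      fix q assume "q \<in> prime_factors j"
      then have "real q > 0" by (auto intro: prime_gt_0_nat in_prime_factors_imp_prime)
      then show "(real q ^ multiplicity q j) powr (- \<delta>) = real q powr (- \<delta> * real (multiplicity q j))"
        by (simp only: powr_realpow[symmetric] powr_powr mult.commute)
    qed
    also have "\<dots> = (\<Prod>q\<in>P. real q powr (- \<delta> * real (multiplicity q j)))"
      using sub out finP by (intro prod.mono_neutral_left) (auto simp: P_def prime_gt_0_nat)
    finally show ?thesis .
  qed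
  have summand: "H p (multiplicity p j) * (\<Prod>q\<in>P - {p}. real q powr (- \<delta> * real (multiplicity q j)))
      = (if multiplicity p j = 0 then 0 else w (p ^ multiplicity p j)) * real j powr (- \<delta>)" if "p \<in> P" for p
  proof -
    have "real j powr (- \<delta>) = real p powr (- \<delta> * real (multiplicity p j))
        * (\<Prod>q\<in>P - {p}. real q powr (- \<delta> * real (multiplicity q j)))"
      unfolding powr_j by (rule prod.remove[OF finP that])
    then show ?thesis
      by (cases "multiplicity p j = 0") (simp_all only: H_def if_True if_False simp_thms mult_zero_left mult.assoc)
  qed
  have sum_P: "(\<Sum>p\<in>P. if multiplicity p j = 0 then 0 else w (p ^ multiplicity p j)) = (if j \<ge> 2 then w j else 0)"
  proof (cases "j \<ge> 2")
    case True
    have "(\<Sum>p\<in>P. if multiplicity p j = 0 then 0 else w (p ^ multiplicity p j))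
        = (\<Sum>p\<in>prime_factors j. w (p ^ multiplicity p j))"
    proof (rule sum.mono_neutral_cong_right[OF finP sub])
      show "\<forall>p\<in>P - prime_factors j. (if multiplicity p j = 0 then 0 else w (p ^ multiplicity p j)) = 0"
        using out by simp
      show "(if multiplicity p j = 0 then 0 else w (p ^ multiplicity p j)) = w (p ^ multiplicity p j)"
        if "p \<in> prime_factors j" for p
        using that by (simp add: prime_factors_multiplicity)
    qed
    also have "\<dots> = w (\<Prod>p\<in>prime_factors j. p ^ multiplicity p j)"
    proof (rule additive_prod_prime_powers[symmetric, OF additive])
      show "prime_factors j \<noteq> {}"
        using True prime_factor_nat[of j] by (auto simp: prime_factors_dvd)
      show "finite (prime_factors j)" by simp
    qed (auto simp: prime_factors_multiplicity)
    finally show ?thesis using True by (simp only: factorization if_True)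
  next
    case False
    then have "j = 1" using j by simp
    then show ?thesis by (simp add: sum.neutral)
  qed
  have "(\<Sum>p\<in>P. H p (multiplicity p j) * (\<Prod>q\<in>P - {p}. real q powr (- \<delta> * real (multiplicity q j))))
     = (\<Sum>p\<in>P. if multiplicity p j = 0 then 0 else w (p ^ multiplicity p j)) * real j powr (- \<delta>)"
    unfolding sum_distrib_right by (intro sum.cong refl summand)
  then show "(if j \<ge> 2 then w j * real j powr (- \<delta>) else 0) =
      (\<Sum>p\<in>P. H p (multiplicity p j) * (\<Prod>q\<in>P - {p}. real q powr (- \<delta> * real (multiplicity q j))))"
    unfolding sum_P by simp
qed

section \<open>From the adjoint back to the convolution\<close>

definition sqnorm :: "(nat \<Rightarrow> real) \<Rightarrow> (nat \<Rightarrow> complex) \<Rightarrow> real" where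
  "sqnorm w a = (\<Sum>j. (cmod (a j))\<^sup>2 / w j)"

lemma sum_dirichlet_conv_cnj:
  assumes "f 0 = 0" "f 1 = 0"
  shows "(\<Sum>j\<in>{2..N}. dirichlet_conv a f j * cnj (g j)) = (\<Sum>m\<in>{2..N}. f m * cnj (adjoint_conv a N g m))"
proof -
  have "(\<Sum>j\<in>{2..N}. dirichlet_conv a f j * cnj (g j))
      = (\<Sum>j\<in>{2..N}. \<Sum>m | m \<in> {2..N} \<and> m dvd j. f m * (a (j div m) * cnj (g j)))"
  proof (rule sum.cong[OF refl])
    fix j assume j: "j \<in> {2..N}"
    have "dirichlet_conv a f j = (\<Sum>m | m dvd j. a (j div m) * f m)"
      unfolding dirichlet_conv_def
      by (rule sum.reindex_bij_witness[of _ "\<lambda>m. j div m" "\<lambda>d. j div d"])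
         (use j in \<open>force elim!: dvdE\<close>)+
    also have "\<dots> = (\<Sum>m | m \<in> {2..N} \<and> m dvd j. a (j div m) * f m)"
    proof (rule sum.mono_neutral_right)
      show "\<forall>m\<in>{m. m dvd j} - {m. m \<in> {2..N} \<and> m dvd j}. a (j div m) * f m = 0"
      proof
        fix m assume m: "m \<in> {m. m dvd j} - {m. m \<in> {2..N} \<and> m dvd j}"
        then have "m \<le> N" using j by (auto dest: dvd_imp_le)
        then have "m = 0 \<or> m = 1" using m by auto
        then show "a (j div m) * f m = 0" using assms by auto
      qed
    qed (use j in auto)
    finally show "dirichlet_conv a f j * cnj (g j) = (\<Sum>m | m \<in> {2..N} \<and> m dvd j. f m * (a (j div m) * cnj (g j)))"
      by (simp only: sum_distrib_right) (intro sum.cong refl, simp add: ac_simps)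
  qed
  also have "\<dots> = (\<Sum>m\<in>{2..N}. \<Sum>j | j \<in> {2..N} \<and> m dvd j. f m * (a (j div m) * cnj (g j)))"
    by (rule sum.swap_restrict) auto
  also have "\<dots> = (\<Sum>m\<in>{2..N}. f m * cnj (adjoint_conv a N g m))"
  proof (rule sum.cong[OF refl])
    fix m assume m: "m \<in> {2..N}"
    have "{j. j \<in> {2..N} \<and> m dvd j} = {j. j \<in> {1..N} \<and> m dvd j}"
      using m by (auto simp: numeral_2_eq_2 Suc_le_eq le_less dest: dvd_imp_le)
    then show "(\<Sum>j | j \<in> {2..N} \<and> m dvd j. f m * (a (j div m) * cnj (g j))) = f m * cnj (adjoint_conv a N g m)"
      by (simp add: adjoint_conv_def cnj_sum sum_distrib_left)
  qed
  finally show ?thesis .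
qed

text \<open>Duality: with \<open>g = dirichlet_conv a f / w\<close>, the left-hand side \<open>X\<close> is the pairing of \<open>f\<close> with the
  adjoint of \<open>g\<close>, and the weighted square sum of \<open>g\<close> is again \<open>X\<close>.  The Cauchy-Schwarz inequality
  then gives \<open>X^2 \<le> Y * K * X\<close>, where \<open>Y\<close> is the sum on the right.\<close>
lemma dirichlet_conv_partial_bound:
  assumes pos: "\<And>j. j \<ge> 2 \<Longrightarrow> w j > 0" and K: "0 \<le> K"
    and dual: "\<And>g. (\<Sum>m\<in>{2..N}. w m * (cmod (adjoint_conv a N g m))\<^sup>2)
      \<le> K * (\<Sum>m\<in>{2..N}. w m * (cmod (g m))\<^sup>2)"
    and f: "f 0 = 0" "f 1 = 0"
  shows "(\<Sum>j\<in>{2..N}. (cmod (dirichlet_conv a f j))\<^sup>2 / w j) \<le> K * (\<Sum>j\<in>{2..N}. (cmod (f j))\<^sup>2 / w j)"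
proof -
  define g where "g j = dirichlet_conv a f j / of_real (w j)" for j
  define X where "X = (\<Sum>j\<in>{2..N}. (cmod (dirichlet_conv a f j))\<^sup>2 / w j)"
  define Y where "Y = (\<Sum>j\<in>{2..N}. (cmod (f j))\<^sup>2 / w j)"
  have X0: "0 \<le> X" and Y0: "0 \<le> Y"
    unfolding X_def Y_def using pos by (auto intro!: sum_nonneg divide_nonneg_pos)
  have gX: "(\<Sum>m\<in>{2..N}. w m * (cmod (g m))\<^sup>2) = X"
    unfolding X_def
  proof (rule sum.cong[OF refl])
    fix m assume "m \<in> {2..N}"
    then have "w m > 0" using pos by auto
    then show "w m * (cmod (g m))\<^sup>2 = (cmod (dirichlet_conv a f m))\<^sup>2 / w m"
      by (simp add: g_def norm_divide power_divide power2_eq_square field_simps)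
  qed
  have "of_real X = (\<Sum>j\<in>{2..N}. dirichlet_conv a f j * cnj (g j))"
    unfolding X_def of_real_sum by (intro sum.cong refl) (simp add: g_def complex_norm_square[symmetric] flip: of_real_power)
  also have "\<dots> = (\<Sum>m\<in>{2..N}. f m * cnj (adjoint_conv a N g m))"
    by (rule sum_dirichlet_conv_cnj[OF f])
  finally have "X = cmod (\<Sum>m\<in>{2..N}. f m * cnj (adjoint_conv a N g m))"
    using X0 by (metis norm_of_real abs_of_nonneg)
  also have "\<dots> \<le> (\<Sum>m\<in>{2..N}. cmod (f m * cnj (adjoint_conv a N g m)))"
    by (rule norm_sum)
  also have "\<dots> = (\<Sum>m\<in>{2..N}. (cmod (f m) / sqrt (w m)) * (sqrt (w m) * cmod (adjoint_conv a N g m)))"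
    using pos by (intro sum.cong refl) (auto simp: norm_mult less_imp_neq[OF pos, symmetric])
  finally have "X\<^sup>2 \<le> (\<Sum>m\<in>{2..N}. (cmod (f m) / sqrt (w m)) * (sqrt (w m) * cmod (adjoint_conv a N g m)))\<^sup>2"
    using X0 by (intro power_mono)
  also have "\<dots> \<le> (\<Sum>m\<in>{2..N}. (cmod (f m) / sqrt (w m))\<^sup>2) * (\<Sum>m\<in>{2..N}. (sqrt (w m) * cmod (adjoint_conv a N g m))\<^sup>2)"
    by (rule Cauchy_Schwarz_ineq_sum)
  also have "(\<Sum>m\<in>{2..N}. (cmod (f m) / sqrt (w m))\<^sup>2) = Y"
    unfolding Y_def using pos by (intro sum.cong refl) (auto simp: power_divide less_imp_le)
  also have "(\<Sum>m\<in>{2..N}. (sqrt (w m) * cmod (adjoint_conv a N g m))\<^sup>2)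
      = (\<Sum>m\<in>{2..N}. w m * (cmod (adjoint_conv a N g m))\<^sup>2)"
    using pos by (intro sum.cong refl) (auto simp: power_mult_distrib less_imp_le)
  also have "Y * \<dots> \<le> Y * (K * X)"
    using dual[of g] Y0 unfolding gX by (intro mult_left_mono)
  finally have "X * X \<le> (K * Y) * X"
    by (simp add: power2_eq_square ac_simps)
  then have "X \<le> K * Y"
    using X0 Y0 K by (cases "X = 0") (auto simp: mult_le_cancel_right)
  then show ?thesis
    unfolding X_def Y_def .
qed

lemma sum_from_2:
  fixes f :: "nat \<Rightarrow> real"
  assumes "f 0 = 0" "f 1 = 0"
  shows "(\<Sum>j\<le>N. f j) = (\<Sum>j\<in>{2..N}. f j)"
proof (rule sum.mono_neutral_right)
  show "\<forall>j\<in>{..N} - {2..N}. f j = 0"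
  proof
    fix j assume "j \<in> {..N} - {2..N}"
    then have "j = 0 \<or> j = 1" by auto
    then show "f j = 0" using assms by auto
  qed
qed auto

lemma dirichlet_conv_sqnorm_bound:
  assumes pos: "\<And>j. j \<ge> 2 \<Longrightarrow> w j > 0" and K: "0 \<le> K"
    and dual: "\<And>N g. (\<Sum>m\<in>{2..N}. w m * (cmod (adjoint_conv a N g m))\<^sup>2)
      \<le> K * (\<Sum>m\<in>{2..N}. w m * (cmod (g m))\<^sup>2)"
    and f: "f \<in> dspace_coeffs w"
  shows "dirichlet_conv a f \<in> dspace_coeffs w" "sqnorm w (dirichlet_conv a f) \<le> K * sqnorm w f"
proof -
  have f01: "f 0 = 0" "f 1 = 0" and sf: "summable (\<lambda>j. (cmod (f j))\<^sup>2 / w j)"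
    using f by (auto simp: dspace_coeffs_def)
  have nn: "0 \<le> (cmod (b j))\<^sup>2 / w j" if "b 0 = 0" "b 1 = 0" for b j
  proof (cases "j \<ge> 2")
    case False
    then have "j = 0 \<or> j = 1" by auto
    then show ?thesis using that by auto
  qed (use pos[of j] in auto)
  have c01: "dirichlet_conv a f 0 = 0" "dirichlet_conv a f 1 = 0" using f01 by auto
  have le: "(\<Sum>j\<le>N. (cmod (dirichlet_conv a f j))\<^sup>2 / w j) \<le> K * sqnorm w f" for N
  proof -
    have "(\<Sum>j\<le>N. (cmod (dirichlet_conv a f j))\<^sup>2 / w j) = (\<Sum>j\<in>{2..N}. (cmod (dirichlet_conv a f j))\<^sup>2 / w j)"
      using c01 by (intro sum_from_2) auto
    also have "\<dots> \<le> K * (\<Sum>j\<in>{2..N}. (cmod (f j))\<^sup>2 / w j)"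
      by (rule dirichlet_conv_partial_bound[OF pos K dual f01])
    also have "(\<Sum>j\<in>{2..N}. (cmod (f j))\<^sup>2 / w j) \<le> sqnorm w f"
      unfolding sqnorm_def using nn[of f] f01 by (intro sum_le_suminf sf) auto
    finally show ?thesis using K by (simp add: mult_left_mono)
  qed
  have "summable (\<lambda>j. (cmod (dirichlet_conv a f j))\<^sup>2 / w j)"
    by (rule bounded_imp_summable[OF nn[OF c01] le])
  then show "dirichlet_conv a f \<in> dspace_coeffs w"
    using c01 by (auto simp: dspace_coeffs_def)
  show "sqnorm w (dirichlet_conv a f) \<le> K * sqnorm w f"
    unfolding sqnorm_def[of w "dirichlet_conv a f"]
  proof (rule suminf_le_const[OF \<open>summable (\<lambda>j. (cmod (dirichlet_conv a f j))\<^sup>2 / w j)\<close>])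
    fix n
    have "(\<Sum>j<n. (cmod (dirichlet_conv a f j))\<^sup>2 / w j) \<le> (\<Sum>j\<le>n. (cmod (dirichlet_conv a f j))\<^sup>2 / w j)"
      using nn[OF c01] by (intro sum_mono2) auto
    then show "(\<Sum>j<n. (cmod (dirichlet_conv a f j))\<^sup>2 / w j) \<le> K * sqnorm w f"
      using le[of n] by simp
  qed
qed

section \<open>Coefficients and functions of a weighted space\<close>

text \<open>Summability at \<open>s\<close> is absolute, and the terms decrease when the real part grows.\<close>
lemma weight_summable_on_mono:
  assumes pos: "\<And>j. j \<ge> 2 \<Longrightarrow> w j > 0" and J: "J \<subseteq> {2..}"
    and s: "(\<lambda>j. complex_of_real (w j) * of_nat j powr (- s)) summable_on J" and "Re s \<le> y"
  shows "(\<lambda>j. w j * real j powr (- y)) summable_on J"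
proof (rule Infinite_Sum.abs_summable_on_comparison_test'[THEN summable_on_iff_abs_summable_on_real[THEN iffD2]])
  have "(\<lambda>j. cmod (complex_of_real (w j) * of_nat j powr (- s))) summable_on J"
    by (rule summable_on_iff_abs_summable_on_complex[THEN iffD1, OF s])
  then show "(\<lambda>j. w j * real j powr (- Re s)) summable_on J"
    by (rule summable_on_cong[THEN iffD1, rotated])
       (use pos J in \<open>auto simp: norm_mult norm_nat_powr less_imp_le\<close>)
  fix j assume "j \<in> J"
  then have "j \<ge> 2" using J by auto
  then show "norm (w j * real j powr (- y)) \<le> w j * real j powr (- Re s)"
    using pos[of j] \<open>Re s \<le> y\<close> by (auto simp: abs_mult intro!: mult_left_mono powr_mono)
qed

text \<open>The inequality \<open>2 x y \<le> x^2 + y^2\<close> with \<open>x = |a j| / sqrt (w j)\<close> and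
  \<open>y = sqrt (w j) * j powr (-x)\<close>.\<close>
lemma coeff_summable_on:
  assumes pos: "\<And>j. j \<ge> 2 \<Longrightarrow> w j > (0::real)" and J: "J \<subseteq> {2..}"
    and a: "(\<lambda>j. (cmod (a j))\<^sup>2 / w j) summable_on J"
    and w: "(\<lambda>j. w j * real j powr (- (2 * x))) summable_on J"
  shows "(\<lambda>j. cmod (a j) * real j powr (- x)) summable_on J"
proof (rule Infinite_Sum.abs_summable_on_comparison_test'[THEN summable_on_iff_abs_summable_on_real[THEN iffD2]])
  show "(\<lambda>j. 1 / 2 * ((cmod (a j))\<^sup>2 / w j + w j * real j powr (- (2 * x)))) summable_on J"
    by (intro summable_on_cmult_right summable_on_add a w)
  fix j assume "j \<in> J"
  then have j: "w j > 0" using J pos by auto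
  have "real j powr (- (2 * x)) = (real j powr (- x))\<^sup>2"
    by (simp add: power2_eq_square flip: powr_add)
  then show "norm (cmod (a j) * real j powr (- x)) \<le> 1 / 2 * ((cmod (a j))\<^sup>2 / w j + w j * real j powr (- (2 * x)))"
    using sum_squares_bound[of "cmod (a j) / sqrt (w j)" "sqrt (w j) * real j powr (- x)"] j
    by (simp add: power_divide power_mult_distrib)
qed

lemma summable_on_coeffs_iff:
  fixes f :: "nat \<Rightarrow> real"
  assumes "f 0 = 0" "f 1 = 0" "\<And>j. j \<ge> 2 \<Longrightarrow> 0 \<le> f j"
  shows "summable f \<longleftrightarrow> f summable_on {2..}"
proof -
  have small: "j = 0 \<or> j = 1" if "j \<notin> {2..}" for j :: nat
    using that by auto
  have "0 \<le> f j" for j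
    using assms small[of j] by (cases "j \<ge> 2") auto
  then have "summable f \<longleftrightarrow> f summable_on UNIV"
    by (simp add: summable_on_UNIV_nonneg_real_iff)
  also have "\<dots> \<longleftrightarrow> f summable_on {2..}"
    using small assms by (intro summable_on_cong_neutral) auto
  finally show ?thesis .
qed

definition basis_vec :: "nat \<Rightarrow> nat \<Rightarrow> complex" where
  "basis_vec n j = (if j = n then 1 else 0)"

lemma abs_conv_basis_vec: "abs_conv (basis_vec n) x"
  unfolding abs_conv_def basis_vec_def by (rule summable_finite[of "{n}"]) auto

lemma dirichlet_sum_basis_vec: "dirichlet_sum (basis_vec n) s = of_nat n powr (- s)"
  unfolding dirichlet_sum_def basis_vec_def
  using suminf_finite[of "{n}" "\<lambda>j. (if j = n then 1 else 0) * of_nat j powr (- s)"] by auto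

lemma dirichlet_conv_basis_vec:
  assumes "m \<ge> 1" "n \<ge> 1"
  shows "dirichlet_conv (basis_vec n) b m = (if n dvd m then b (m div n) else 0)"
proof -
  have "dirichlet_conv (basis_vec n) b m = (\<Sum>d | d dvd m. if d = n then b (m div d) else 0)"
    unfolding dirichlet_conv_def basis_vec_def by (intro sum.cong) auto
  also have "\<dots> = (if n dvd m then b (m div n) else 0)"
    using assms by (subst sum.delta) auto
  finally show ?thesis .
qed

locale dirichlet_weight =
  fixes w :: "nat \<Rightarrow> real" and \<tau> :: real
  assumes pos: "\<And>j. j \<ge> 2 \<Longrightarrow> w j > 0"
    and sigma_abs: "sigma_abs w = ereal \<tau>"
begin

lemma weight_domain: "weight_domain w = half_plane (ereal (\<tau> / 2))"
  by (simp add: weight_domain_def sigma_abs)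

lemma weight_summable_on:
  assumes "\<tau> < y"
  shows "(\<lambda>j. w j * real j powr (- y)) summable_on {2..}"
proof -
  have "sigma_abs w < ereal y" using assms sigma_abs by simp
  then obtain s where "(\<lambda>j. complex_of_real (w j) * of_nat j powr (- s)) summable_on {2..}" "Re s < y"
    unfolding sigma_abs_def Inf_less_iff by auto
  then show ?thesis
    by (intro weight_summable_on_mono[OF pos]) auto
qed

lemma square_quot_nonneg:
  assumes "a 0 = 0" "a 1 = 0"
  shows "0 \<le> (cmod (a j))\<^sup>2 / w j"
proof (cases "j \<ge> 2")
  case False
  then have "j = 0 \<or> j = 1" by auto
  then show ?thesis using assms by auto
qed (use pos[of j] in auto)

lemma dspace_coeffs_iff:
  "a \<in> dspace_coeffs w \<longleftrightarrow> a 0 = 0 \<and> a 1 = 0 \<and> (\<lambda>j. (cmod (a j))\<^sup>2 / w j) summable_on {2..}"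
proof -
  have "summable (\<lambda>j. (cmod (a j))\<^sup>2 / w j) \<longleftrightarrow> (\<lambda>j. (cmod (a j))\<^sup>2 / w j) summable_on {2..}"
    if "a 0 = 0" "a 1 = 0"
    by (rule summable_on_coeffs_iff) (use that square_quot_nonneg[of a] in auto)
  then show ?thesis
    unfolding dspace_coeffs_def by blast
qed

lemma abs_conv_dspace_coeffs:
  assumes a: "a \<in> dspace_coeffs w" and "\<tau> / 2 < x"
  shows "abs_conv a x"
proof -
  have "(\<lambda>j. cmod (a j) * real j powr (- x)) summable_on {2..}"
    using a \<open>\<tau> / 2 < x\<close> unfolding dspace_coeffs_iff
    by (intro coeff_summable_on[where w = w] pos weight_summable_on) auto
  then show ?thesis
    using a unfolding abs_conv_def by (subst summable_on_coeffs_iff) (auto simp: dspace_coeffs_iff)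
qed

lemma dspace_coeffs_eqI:
  assumes "a 0 = 0" "b 0 = 0" "abs_conv a x" "abs_conv b x"
    and "\<And>s. Re s = x \<Longrightarrow> dirichlet_sum a s = dirichlet_sum b s"
  shows "a = b"
proof
  fix n show "a n = b n"
    using dirichlet_sum_unique[OF assms(3,4) _ assms(5), of n] assms(1,2) by (cases "n = 0") auto
qed

definition dspace_fun :: "(nat \<Rightarrow> complex) \<Rightarrow> complex \<Rightarrow> complex" where
  "dspace_fun a s = (if s \<in> weight_domain w then dirichlet_sum a s else 0)"

lemma has_dseries_on_dspace_fun:
  assumes "a \<in> dspace_coeffs w"
  shows "has_dseries_on (dspace_fun a) a (weight_domain w)"
  using abs_conv_sums[OF abs_conv_dspace_coeffs[OF assms]]
  by (auto simp: has_dseries_on_def dspace_fun_def weight_domain)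

lemma dspace_fun_in_dspace: "a \<in> dspace_coeffs w \<Longrightarrow> dspace_fun a \<in> dspace w"
  using has_dseries_on_dspace_fun by (auto simp: dspace_def funs_on_def dspace_fun_def)

lemma has_dseries_on_dspace_eq:
  assumes "f \<in> funs_on (weight_domain w)" "has_dseries_on f a (weight_domain w)"
  shows "f = dspace_fun a"
proof
  fix s
  show "f s = dspace_fun a s"
  proof (cases "s \<in> weight_domain w")
    case True
    then have "(\<lambda>j. a j * of_nat j powr (- s)) sums f s"
      using assms(2) unfolding has_dseries_on_def by blast
    then show ?thesis
      using True by (simp add: dspace_fun_def dirichlet_sum_def sums_iff)
  qed (use assms(1) in \<open>simp add: funs_on_def dspace_fun_def\<close>)
qed

lemma dspaceE:
  assumes "f \<in> dspace w"
  obtains a where "a \<in> dspace_coeffs w" "f = dspace_fun a"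
  using assms that has_dseries_on_dspace_eq unfolding dspace_def by blast

lemma dspace_fun_inject:
  assumes "a \<in> dspace_coeffs w" "b \<in> dspace_coeffs w" "dspace_fun a = dspace_fun b"
  shows "a = b"
proof (rule dspace_coeffs_eqI[where x = "\<tau> / 2 + 1"])
  show "abs_conv a (\<tau> / 2 + 1)" "abs_conv b (\<tau> / 2 + 1)"
    using assms by (auto intro: abs_conv_dspace_coeffs)
  fix s :: complex assume "Re s = \<tau> / 2 + 1"
  then show "dirichlet_sum a s = dirichlet_sum b s"
    using fun_cong[OF assms(3), of s] by (simp add: dspace_fun_def weight_domain)
qed (use assms in \<open>auto simp: dspace_coeffs_def\<close>)

lemma dspace_coeff_dspace_fun:
  assumes "a \<in> dspace_coeffs w"
  shows "dspace_coeff w (dspace_fun a) = a"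
  unfolding dspace_coeff_def
proof (rule the_equality)
  fix b assume "b \<in> dspace_coeffs w \<and> has_dseries_on (dspace_fun a) b (weight_domain w)"
  moreover from this have "dspace_fun a = dspace_fun b"
    by (intro has_dseries_on_dspace_eq) (auto simp: funs_on_def dspace_fun_def)
  ultimately show "b = a"
    using assms dspace_fun_inject[of a b] by blast
qed (use assms has_dseries_on_dspace_fun in auto)

lemma dspace_norm_dspace_fun:
  "a \<in> dspace_coeffs w \<Longrightarrow> dspace_norm w (dspace_fun a) = sqrt (sqnorm w a)"
  by (simp add: dspace_norm_def dspace_coeff_dspace_fun sqnorm_def)

lemma basis_vec_in_dspace_coeffs: "n \<ge> 2 \<Longrightarrow> basis_vec n \<in> dspace_coeffs w"
  by (auto simp: dspace_coeffs_def basis_vec_def split: if_splits intro!: summable_finite[of "{n}"])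

text \<open>A priori \<open>\<phi> * n powr (-s)\<close> is a Dirichlet series for each \<open>n \<ge> 2\<close>, so \<open>\<phi>\<close> has frequencies in
  the multiples of \<open>1/n\<close>.  Comparing \<open>n = 2\<close> with \<open>n = 3\<close> shows that the coefficients for \<open>n = 2\<close>
  vanish at odd indices, hence that the frequencies are integers.  The last conclusion records that
  \<open>\<phi> * 2 powr (-s)\<close> lies in the space; it gives convergence of the smooth parts of \<open>\<phi>\<close> further left.\<close>
lemma multiplier_dirichlet_series:
  assumes \<phi>: "\<phi> \<in> multipliers w"
  obtains a where "\<And>x. \<tau> / 2 < x \<Longrightarrow> abs_conv a x"
    "\<And>s. s \<in> weight_domain w \<Longrightarrow> \<phi> s = dirichlet_sum a s"
    "(\<lambda>k. (cmod (a k))\<^sup>2 / w (2 * k)) summable_on {1..}"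
proof -
  have mult: "\<exists>b\<in>dspace_coeffs w. \<forall>s\<in>weight_domain w. \<phi> s * of_nat n powr (- s) = dirichlet_sum b s"
    if n: "n \<ge> 2" for n
  proof -
    have "(\<lambda>s. \<phi> s * dspace_fun (basis_vec n) s) \<in> dspace w"
      using \<phi> dspace_fun_in_dspace[OF basis_vec_in_dspace_coeffs[OF n]] by (auto simp: multipliers_def)
    then obtain b where b: "b \<in> dspace_coeffs w" "(\<lambda>s. \<phi> s * dspace_fun (basis_vec n) s) = dspace_fun b"
      by (rule dspaceE)
    have "\<phi> s * of_nat n powr (- s) = dirichlet_sum b s" if "s \<in> weight_domain w" for s
      using fun_cong[OF b(2), of s] that by (simp add: dspace_fun_def dirichlet_sum_basis_vec)
    then show ?thesis using b(1) by blast
  qed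
  from mult[of 2] obtain b where b: "b \<in> dspace_coeffs w"
    and \<phi>2: "\<And>s. s \<in> weight_domain w \<Longrightarrow> \<phi> s * of_nat 2 powr (- s) = dirichlet_sum b s" by auto
  from mult[of 3] obtain c where c: "c \<in> dspace_coeffs w"
    and \<phi>3: "\<And>s. s \<in> weight_domain w \<Longrightarrow> \<phi> s * of_nat 3 powr (- s) = dirichlet_sum c s" by auto
  have conv_eq: "dirichlet_conv (basis_vec 3) b = dirichlet_conv (basis_vec 2) c"
  proof (rule dspace_coeffs_eqI[where x = "\<tau> / 2 + 1"])
    have bc: "abs_conv b (Re s)" "abs_conv c (Re s)" if "Re s = \<tau> / 2 + 1" for s
      using b c that by (auto intro: abs_conv_dspace_coeffs)
    show "abs_conv (dirichlet_conv (basis_vec 3) b) (\<tau> / 2 + 1)"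
      "abs_conv (dirichlet_conv (basis_vec 2) c) (\<tau> / 2 + 1)"
      using dirichlet_conv_abs(1)[OF abs_conv_basis_vec bc(1), of "of_real (\<tau> / 2 + 1)" 3]
        dirichlet_conv_abs(1)[OF abs_conv_basis_vec bc(2), of "of_real (\<tau> / 2 + 1)" 2] by simp_all
    fix s :: complex assume s: "Re s = \<tau> / 2 + 1"
    then have "s \<in> weight_domain w" by (simp add: weight_domain)
    then show "dirichlet_sum (dirichlet_conv (basis_vec 3) b) s = dirichlet_sum (dirichlet_conv (basis_vec 2) c) s"
      using bc[OF s]
      by (simp add: dirichlet_conv_abs abs_conv_basis_vec dirichlet_sum_basis_vec \<phi>2[symmetric] \<phi>3[symmetric])
  qed auto
  have b_odd: "b j = 0" if "odd j" for j
  proof -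
    have "j \<ge> 1" using that by (cases j) auto
    \<comment> \<open>The number \<open>3 * j\<close> is odd, so the convolution with the basis vector at \<open>2\<close> vanishes there.\<close>
    have "b j = dirichlet_conv (basis_vec 3) b (3 * j)"
      using \<open>j \<ge> 1\<close> by (simp add: dirichlet_conv_basis_vec)
    also have "\<dots> = 0"
      unfolding conv_eq using that \<open>j \<ge> 1\<close> by (simp add: dirichlet_conv_basis_vec)
    finally show ?thesis .
  qed
  define a where "a k = b (2 * k)" for k
  have a: "abs_conv a x" if "\<tau> / 2 < x" for x
  proof -
    have "summable ((\<lambda>j. cmod (b j) * real j powr (- x)) \<circ> (\<lambda>k. 2 * k))"
      using abs_conv_dspace_coeffs[OF b that]
      by (intro summable_reindex) (auto simp: abs_conv_def inj_on_def)
    then have "summable (\<lambda>k. 2 powr x * (cmod (b (2 * k)) * real (2 * k) powr (- x)))"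
      by (intro summable_mult) (simp add: o_def)
    also have "(\<lambda>k. 2 powr x * (cmod (b (2 * k)) * real (2 * k) powr (- x))) = (\<lambda>k. cmod (a k) * real k powr (- x))"
      by (auto simp: a_def powr_mult powr_minus field_simps)
    finally show ?thesis by (simp add: abs_conv_def)
  qed
  have ba: "b = dirichlet_conv (basis_vec 2) a"
  proof
    fix j show "b j = dirichlet_conv (basis_vec 2) a j"
      using b b_odd[of j] by (cases "j = 0") (auto simp: dirichlet_conv_basis_vec a_def dspace_coeffs_def)
  qed
  show ?thesis
  proof
    show "abs_conv a x" if "\<tau> / 2 < x" for x by (rule a[OF that])
    show "\<phi> s = dirichlet_sum a s" if s: "s \<in> weight_domain w" for s
    proof -
      have "abs_conv a (Re s)" using s a by (simp add: weight_domain)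
      then have "dirichlet_sum b s = of_nat 2 powr (- s) * dirichlet_sum a s"
        by (simp add: ba dirichlet_conv_abs(2) abs_conv_basis_vec dirichlet_sum_basis_vec)
      then show ?thesis using \<phi>2[OF s] by simp
    qed
    have "(\<lambda>j. (cmod (b j))\<^sup>2 / w j) summable_on (\<lambda>k. 2 * k) ` {1..}"
      using b unfolding dspace_coeffs_iff by (auto intro: summable_on_subset_banach)
    then show "(\<lambda>k. (cmod (a k))\<^sup>2 / w (2 * k)) summable_on {1..}"
      by (subst (asm) summable_on_reindex) (auto simp: inj_on_def o_def a_def)
  qed
qed

lemma multiplier_acts_by_conv:
  assumes \<phi>: "\<phi> \<in> multipliers w"
    and a: "\<And>x. \<tau> / 2 < x \<Longrightarrow> abs_conv a x"
    and \<phi>a: "\<And>s. s \<in> weight_domain w \<Longrightarrow> \<phi> s = dirichlet_sum a s"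
    and f: "f \<in> dspace_coeffs w"
  shows "dirichlet_conv a f \<in> dspace_coeffs w"
    and "(\<lambda>s. \<phi> s * dspace_fun f s) = dspace_fun (dirichlet_conv a f)"
proof -
  have "(\<lambda>s. \<phi> s * dspace_fun f s) \<in> dspace w"
    using \<phi> dspace_fun_in_dspace[OF f] by (auto simp: multipliers_def)
  then obtain g where g: "g \<in> dspace_coeffs w" "(\<lambda>s. \<phi> s * dspace_fun f s) = dspace_fun g"
    by (rule dspaceE)
  have "g = dirichlet_conv a f"
  proof (rule dspace_coeffs_eqI[where x = "\<tau> / 2 + 1"])
    show "g 0 = 0" using g by (auto simp: dspace_coeffs_def)
    show "abs_conv g (\<tau> / 2 + 1)" using g by (auto intro: abs_conv_dspace_coeffs)
    have af: "abs_conv a (Re s)" "abs_conv f (Re s)" if "Re s = \<tau> / 2 + 1" for s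
      using a f that by (auto intro: abs_conv_dspace_coeffs)
    show "abs_conv (dirichlet_conv a f) (\<tau> / 2 + 1)"
      using dirichlet_conv_abs(1)[OF af, of "of_real (\<tau> / 2 + 1)"] by simp
    fix s :: complex assume s: "Re s = \<tau> / 2 + 1"
    then show "dirichlet_sum g s = dirichlet_sum (dirichlet_conv a f) s"
      using fun_cong[OF g(2), of s] dirichlet_conv_abs(2)[OF af[OF s]]
      by (simp add: dspace_fun_def weight_domain \<phi>a)
  qed auto
  then show "dirichlet_conv a f \<in> dspace_coeffs w"
    "(\<lambda>s. \<phi> s * dspace_fun f s) = dspace_fun (dirichlet_conv a f)"
    using g by auto
qed

end

section \<open>Convolutions that preserve the space are bounded\<close>

lemma dirichlet_conv_add: "dirichlet_conv a (\<lambda>j. f j + g j) n = dirichlet_conv a f n + dirichlet_conv a g n"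
  by (simp add: dirichlet_conv_def sum.distrib distrib_left)

lemma dirichlet_conv_cmult: "dirichlet_conv a (\<lambda>j. c * f j) n = c * dirichlet_conv a f n"
  by (simp add: dirichlet_conv_def sum_distrib_left ac_simps)

lemma dirichlet_conv_local:
  assumes "\<And>i. i \<le> j \<Longrightarrow> f i = g i"
  shows "dirichlet_conv a f j = dirichlet_conv a g j"
  unfolding dirichlet_conv_def by (intro sum.cong refl) (simp add: assms)

lemma cmod_add_squared_le: "(cmod (x + y))\<^sup>2 \<le> 2 * (cmod x)\<^sup>2 + 2 * (cmod y)\<^sup>2"
proof -
  have "(cmod (x + y))\<^sup>2 \<le> (cmod x + cmod y)\<^sup>2"
    by (intro power_mono norm_triangle_ineq) auto
  also have "\<dots> \<le> 2 * (cmod x)\<^sup>2 + 2 * (cmod y)\<^sup>2"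
    using sum_squares_bound[of "cmod x" "cmod y"] by (simp add: power2_sum)
  finally show ?thesis .
qed

context dirichlet_weight
begin

definition partial_sqnorm :: "nat \<Rightarrow> (nat \<Rightarrow> complex) \<Rightarrow> real" where
  "partial_sqnorm N a = (\<Sum>j\<le>N. (cmod (a j))\<^sup>2 / w j)"

lemma dspace_coeffsD:
  assumes "a \<in> dspace_coeffs w"
  shows "a 0 = 0" "a 1 = 0" "summable (\<lambda>j. (cmod (a j))\<^sup>2 / w j)" "\<And>j. 0 \<le> (cmod (a j))\<^sup>2 / w j"
  using assms square_quot_nonneg[of a] by (auto simp: dspace_coeffs_def)

lemma sqnorm_nonneg: "a \<in> dspace_coeffs w \<Longrightarrow> 0 \<le> sqnorm w a"
  unfolding sqnorm_def by (intro suminf_nonneg dspace_coeffsD)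

lemma partial_sqnorm_le: "a \<in> dspace_coeffs w \<Longrightarrow> partial_sqnorm N a \<le> sqnorm w a"
  unfolding partial_sqnorm_def sqnorm_def by (intro sum_le_suminf dspace_coeffsD) auto

lemma coeff_le_sqnorm:
  assumes a: "a \<in> dspace_coeffs w" and j: "j \<ge> 2"
  shows "(cmod (a j))\<^sup>2 \<le> w j * sqnorm w a"
proof -
  have "(\<Sum>i\<in>{j}. (cmod (a i))\<^sup>2 / w i) \<le> sqnorm w a"
    unfolding sqnorm_def by (intro sum_le_suminf dspace_coeffsD a) auto
  then show ?thesis using pos[OF j] by (simp add: divide_le_eq mult.commute)
qed

lemma dspace_coeffs_restrict:
  assumes a: "a \<in> dspace_coeffs w" and b: "\<And>j. b j = a j \<or> b j = 0"
  shows "b \<in> dspace_coeffs w" "sqnorm w b \<le> sqnorm w a"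
proof -
  have b01: "b 0 = 0" "b 1 = 0" using b[of 0] b[of 1] dspace_coeffsD[OF a] by auto
  have le: "(cmod (b j))\<^sup>2 / w j \<le> (cmod (a j))\<^sup>2 / w j" for j
    using b[of j] dspace_coeffsD(4)[OF a, of j] by auto
  have s: "summable (\<lambda>j. (cmod (b j))\<^sup>2 / w j)"
    by (rule summable_comparison_test'[OF dspace_coeffsD(3)[OF a]])
       (simp only: real_norm_def abs_of_nonneg[OF square_quot_nonneg[OF b01]] le)
  then show "b \<in> dspace_coeffs w" using b01 by (simp add: dspace_coeffs_def)
  show "sqnorm w b \<le> sqnorm w a"
    unfolding sqnorm_def by (intro suminf_le le s dspace_coeffsD a)
qed

lemma dspace_coeffs_cmult:
  assumes a: "a \<in> dspace_coeffs w"
  shows "(\<lambda>j. c * a j) \<in> dspace_coeffs w" "sqnorm w (\<lambda>j. c * a j) = (cmod c)\<^sup>2 * sqnorm w a"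
proof -
  have eq: "(cmod (c * a j))\<^sup>2 / w j = (cmod c)\<^sup>2 * ((cmod (a j))\<^sup>2 / w j)" for j
    by (simp add: norm_mult power_mult_distrib)
  show "(\<lambda>j. c * a j) \<in> dspace_coeffs w"
    using dspace_coeffsD[OF a] summable_mult[OF dspace_coeffsD(3)[OF a], of "(cmod c)\<^sup>2"]
    by (simp add: dspace_coeffs_def eq)
  show "sqnorm w (\<lambda>j. c * a j) = (cmod c)\<^sup>2 * sqnorm w a"
    unfolding sqnorm_def eq by (intro suminf_mult dspace_coeffsD a)
qed

lemma dspace_coeffs_add:
  assumes a: "a \<in> dspace_coeffs w" and b: "b \<in> dspace_coeffs w"
  shows "(\<lambda>j. a j + b j) \<in> dspace_coeffs w" "sqnorm w (\<lambda>j. a j + b j) \<le> 2 * sqnorm w a + 2 * sqnorm w b"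
proof -
  have ab01: "a 0 + b 0 = 0" "a 1 + b 1 = 0" using dspace_coeffsD(1,2)[OF a] dspace_coeffsD(1,2)[OF b] by auto
  have le: "(cmod (a j + b j))\<^sup>2 / w j \<le> 2 * ((cmod (a j))\<^sup>2 / w j) + 2 * ((cmod (b j))\<^sup>2 / w j)" for j
  proof (cases "j \<ge> 2")
    case True
    then have "(cmod (a j + b j))\<^sup>2 / w j \<le> (2 * (cmod (a j))\<^sup>2 + 2 * (cmod (b j))\<^sup>2) / w j"
      using pos[of j] by (intro divide_right_mono cmod_add_squared_le) auto
    then show ?thesis by (simp add: add_divide_distrib)
  next
    case False
    then have "j = 0 \<or> j = 1" by auto
    then show ?thesis using dspace_coeffsD(1,2)[OF a] dspace_coeffsD(1,2)[OF b] by auto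
  qed
  have s2: "summable (\<lambda>j. 2 * ((cmod (a j))\<^sup>2 / w j) + 2 * ((cmod (b j))\<^sup>2 / w j))"
    by (intro summable_add summable_mult dspace_coeffsD a b)
  have s: "summable (\<lambda>j. (cmod (a j + b j))\<^sup>2 / w j)"
    by (rule summable_comparison_test'[OF s2])
       (simp only: real_norm_def abs_of_nonneg[OF square_quot_nonneg[of "\<lambda>j. a j + b j", OF ab01]] le)
  then show "(\<lambda>j. a j + b j) \<in> dspace_coeffs w" using ab01 by (simp add: dspace_coeffs_def)
  have "sqnorm w (\<lambda>j. a j + b j) \<le> (\<Sum>j. 2 * ((cmod (a j))\<^sup>2 / w j) + 2 * ((cmod (b j))\<^sup>2 / w j))"
    unfolding sqnorm_def by (intro suminf_le le s s2)
  also have "\<dots> = 2 * sqnorm w a + 2 * sqnorm w b"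
    unfolding sqnorm_def
    by (simp only: suminf_add[OF summable_mult summable_mult, symmetric] suminf_mult
        dspace_coeffsD(3)[OF a] dspace_coeffsD(3)[OF b])
  finally show "sqnorm w (\<lambda>j. a j + b j) \<le> 2 * sqnorm w a + 2 * sqnorm w b" .
qed

definition bounded_beyond :: "(nat \<Rightarrow> complex) \<Rightarrow> nat \<Rightarrow> bool" where
  "bounded_beyond a M \<longleftrightarrow> (\<exists>K. \<forall>f\<in>dspace_coeffs w. (\<forall>j<M. f j = 0) \<longrightarrow>
     sqnorm w (dirichlet_conv a f) \<le> K * sqnorm w f)"

text \<open>One coordinate at a time: each contributes a bounded operator of rank one.\<close>
lemma bounded_beyond_0:
  assumes A: "\<And>f. f \<in> dspace_coeffs w \<Longrightarrow> dirichlet_conv a f \<in> dspace_coeffs w"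
    and "bounded_beyond a M"
  shows "bounded_beyond a 0"
  using assms(2)
proof (induction M)
  case (Suc M)
  then obtain K where "\<forall>f\<in>dspace_coeffs w. (\<forall>j<Suc M. f j = 0) \<longrightarrow>
      sqnorm w (dirichlet_conv a f) \<le> K * sqnorm w f"
    unfolding bounded_beyond_def by blast
  then have K: "sqnorm w (dirichlet_conv a f) \<le> K * sqnorm w f"
    if "f \<in> dspace_coeffs w" "\<And>j. j < Suc M \<Longrightarrow> f j = 0" for f
    using that by blast
  have "bounded_beyond a M"
  proof (cases "M \<ge> 2")
    case False
    then have "M = 0 \<or> M = 1" by auto
    then have "f j = 0" if "f \<in> dspace_coeffs w" "j < Suc M" for f j
      using that dspace_coeffsD(1,2)[OF that(1)] by (auto simp: less_Suc_eq)
    then show ?thesis using K unfolding bounded_beyond_def by blast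
  next
    case True
    define L where "L = 2 * \<bar>K\<bar> + 2 * (w M * sqnorm w (dirichlet_conv a (basis_vec M)))"
    have "sqnorm w (dirichlet_conv a f) \<le> L * sqnorm w f"
      if f: "f \<in> dspace_coeffs w" and f0: "\<And>j. j < M \<Longrightarrow> f j = 0" for f
    proof -
      define g where "g j = (if j = M then 0 else f j)" for j
      have g: "g \<in> dspace_coeffs w" "sqnorm w g \<le> sqnorm w f"
        by (rule dspace_coeffs_restrict[OF f]; simp add: g_def)+
      have e: "basis_vec M \<in> dspace_coeffs w" using True by (rule basis_vec_in_dspace_coeffs)
      have f_eq: "f = (\<lambda>j. g j + f M * basis_vec M j)" by (auto simp: g_def basis_vec_def)
      have "dirichlet_conv a f = (\<lambda>n. dirichlet_conv a g n + f M * dirichlet_conv a (basis_vec M) n)"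
        by (subst f_eq) (simp add: dirichlet_conv_add dirichlet_conv_cmult fun_eq_iff)
      then have "sqnorm w (dirichlet_conv a f)
          \<le> 2 * sqnorm w (dirichlet_conv a g) + 2 * ((cmod (f M))\<^sup>2 * sqnorm w (dirichlet_conv a (basis_vec M)))"
        using dspace_coeffs_add(2)[OF A[OF g(1)] dspace_coeffs_cmult(1)[OF A[OF e]], of "f M"]
        by (simp add: dspace_coeffs_cmult(2)[OF A[OF e]])
      moreover have "sqnorm w (dirichlet_conv a g) \<le> \<bar>K\<bar> * sqnorm w f"
      proof -
        have "sqnorm w (dirichlet_conv a g) \<le> K * sqnorm w g"
          using g(1) f0 by (intro K) (auto simp: g_def less_Suc_eq)
        also have "\<dots> \<le> \<bar>K\<bar> * sqnorm w g"
          using sqnorm_nonneg[OF g(1)] by (intro mult_right_mono) auto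
        also have "\<dots> \<le> \<bar>K\<bar> * sqnorm w f" using g(2) by (intro mult_left_mono) auto
        finally show ?thesis .
      qed
      moreover have "(cmod (f M))\<^sup>2 * sqnorm w (dirichlet_conv a (basis_vec M))
          \<le> (w M * sqnorm w f) * sqnorm w (dirichlet_conv a (basis_vec M))"
        by (intro mult_right_mono coeff_le_sqnorm f True sqnorm_nonneg A e)
      ultimately show ?thesis
        unfolding L_def by (simp add: algebra_simps)
    qed
    then show ?thesis unfolding bounded_beyond_def by blast
  qed
  then show ?case by (rule Suc.IH)
qed

text \<open>The hump \<open>f2\<close> lives beyond \<open>N\<close>, has squared norm at most \<open>\<epsilon>\<close>, and its image is so large that adding
  the image of \<open>S\<close> cannot destroy it.  Since entry \<open>j\<close> of the image depends only on entries up to \<open>j\<close>,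
  the hump may be cut off at the index \<open>N'\<close> where its image is measured.\<close>
lemma gliding_hump_step:
  assumes A: "\<And>f. f \<in> dspace_coeffs w \<Longrightarrow> dirichlet_conv a f \<in> dspace_coeffs w"
    and unbounded: "\<not> bounded_beyond a (Suc N)"
    and S: "S \<in> dspace_coeffs w" "\<And>j. N < j \<Longrightarrow> S j = 0" and "0 < \<epsilon>" "0 \<le> R"
  obtains S' N' where "N < N'" "S' \<in> dspace_coeffs w" "\<And>j. N' < j \<Longrightarrow> S' j = 0" "\<And>j. j \<le> N \<Longrightarrow> S' j = S j"
    "sqnorm w S' \<le> sqnorm w S + \<epsilon>" "R \<le> partial_sqnorm N' (dirichlet_conv a S')"
proof -
  let ?A = "dirichlet_conv a"
  \<comment> \<open>From \<open>f2 = S' - S\<close> the image of \<open>S'\<close> has at least half the square norm of the image of \<open>f2\<close>, less that of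
    the image of \<open>S\<close>.\<close>
  define Q where "Q = 2 * R + 2 * sqnorm w (?A S)"
  have Q: "0 \<le> Q" using \<open>0 \<le> R\<close> sqnorm_nonneg[OF A[OF S(1)]] by (simp add: Q_def)
  obtain f where f: "f \<in> dspace_coeffs w" "\<And>j. j < Suc N \<Longrightarrow> f j = 0"
    and big: "Q / \<epsilon> * sqnorm w f < sqnorm w (?A f)"
    using unbounded unfolding bounded_beyond_def by (meson not_le)
  have nf: "sqnorm w f > 0"
  proof (rule ccontr)
    assume "\<not> sqnorm w f > 0"
    then have "sqnorm w f = 0" using sqnorm_nonneg[OF f(1)] by simp
    then have "(cmod (f j))\<^sup>2 \<le> 0" if "j \<ge> 2" for j using coeff_le_sqnorm[OF f(1) that] by simp
    then have "f j = 0" for j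
      using dspace_coeffsD(1,2)[OF f(1)] by (cases "j \<ge> 2") (auto simp: not_le less_2_cases_iff)
    then have "?A f = (\<lambda>n. 0)" by (auto simp: dirichlet_conv_def)
    then show False using big \<open>sqnorm w f = 0\<close> by (simp add: sqnorm_def)
  qed
  define t where "t = sqrt (\<epsilon> / sqnorm w f)"
  have t2: "(cmod (of_real t))\<^sup>2 = \<epsilon> / sqnorm w f"
    using nf \<open>0 < \<epsilon>\<close> by (simp add: t_def)
  define f1 where "f1 j = of_real t * f j" for j
  have f1: "f1 \<in> dspace_coeffs w" "sqnorm w f1 = \<epsilon>"
    using dspace_coeffs_cmult[OF f(1), of "of_real t"] nf unfolding f1_def[symmetric] t2 by auto
  have Af1: "?A f1 = (\<lambda>n. of_real t * ?A f n)"
    unfolding f1_def by (auto simp: dirichlet_conv_cmult)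
  have "Q < sqnorm w (?A f1)"
    unfolding Af1 dspace_coeffs_cmult(2)[OF A[OF f(1)]] t2
    using big nf \<open>0 < \<epsilon>\<close> by (simp add: field_simps)
  moreover have "(\<lambda>n. partial_sqnorm n (?A f1)) \<longlonglongrightarrow> sqnorm w (?A f1)"
    using dspace_coeffsD(3)[OF A[OF f1(1)]] unfolding partial_sqnorm_def sqnorm_def by (rule summable_LIMSEQ')
  ultimately have "\<forall>\<^sub>F n in sequentially. Q < partial_sqnorm n (?A f1)"
    by (rule order_tendstoD(1)[rotated])
  then have "\<forall>\<^sub>F n in sequentially. Q < partial_sqnorm n (?A f1) \<and> N < n"
    using eventually_gt_at_top by (rule eventually_conj)
  then obtain N' where N': "Q < partial_sqnorm N' (?A f1)" "N < N'"
    using eventually_happens'[OF sequentially_bot] by auto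
  define f2 where "f2 j = (if j \<le> N' then f1 j else 0)" for j
  have f2: "f2 \<in> dspace_coeffs w" "sqnorm w f2 \<le> \<epsilon>"
    using dspace_coeffs_restrict[OF f1(1), of f2] f1(2) by (auto simp: f2_def)
  have Af2: "partial_sqnorm N' (?A f2) = partial_sqnorm N' (?A f1)"
    unfolding partial_sqnorm_def
    by (intro sum.cong refl arg_cong2[where f = "(/)"] arg_cong[where f = "\<lambda>z. (cmod z)\<^sup>2"] dirichlet_conv_local)
       (simp add: f2_def)
  define S' where "S' j = S j + f2 j" for j
  have S': "S' \<in> dspace_coeffs w"
    using dspace_coeffs_add(1)[OF S(1) f2(1)] by (simp add: S'_def[abs_def])
  show ?thesis
  proof
    show "N < N'" "S' \<in> dspace_coeffs w" by fact+
    show "S' j = 0" if "N' < j" for j using that S(2) N' by (simp add: S'_def f2_def)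
    show "S' j = S j" if "j \<le> N" for j using that f(2) by (simp add: S'_def f2_def f1_def)
    have "(cmod (S' j))\<^sup>2 / w j = (cmod (S j))\<^sup>2 / w j + (cmod (f2 j))\<^sup>2 / w j" for j
      using S(2)[of j] f(2)[of j] by (cases "j \<le> N") (auto simp: S'_def f2_def f1_def)
    then have "sqnorm w S' = sqnorm w S + sqnorm w f2"
      unfolding sqnorm_def using suminf_add[OF dspace_coeffsD(3)[OF S(1)] dspace_coeffsD(3)[OF f2(1)]] by simp
    then show "sqnorm w S' \<le> sqnorm w S + \<epsilon>" using f2(2) by simp
    have "partial_sqnorm N' (?A f2) \<le> 2 * partial_sqnorm N' (?A S') + 2 * partial_sqnorm N' (?A S)"
      unfolding partial_sqnorm_def sum_distrib_left sum.distrib[symmetric]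
    proof (rule sum_mono)
      fix j
      have "f2 = (\<lambda>j. S' j + (- 1) * S j)" by (simp add: S'_def)
      then have eq: "?A f2 j = ?A S' j + (- 1) * ?A S j"
        using dirichlet_conv_add[of a S' "\<lambda>j. (- 1) * S j" j] by (simp only: dirichlet_conv_cmult)
      show "(cmod (?A f2 j))\<^sup>2 / w j \<le> 2 * ((cmod (?A S' j))\<^sup>2 / w j) + 2 * ((cmod (?A S j))\<^sup>2 / w j)"
      proof (cases "j \<ge> 2")
        case True
        then have "(cmod (?A f2 j))\<^sup>2 / w j \<le> (2 * (cmod (?A S' j))\<^sup>2 + 2 * (cmod (- 1 * ?A S j))\<^sup>2) / w j"
          unfolding eq using pos[of j] by (intro divide_right_mono cmod_add_squared_le) auto
        then show ?thesis by (simp add: add_divide_distrib)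
      next
        case False
        then have "j = 0 \<or> j = 1" by auto
        then show ?thesis
          using dspace_coeffsD(1,2)[OF A[OF f2(1)]] dspace_coeffsD(1,2)[OF A[OF S(1)]] dspace_coeffsD(1,2)[OF A[OF S']]
          by auto
      qed
    qed
    then show "R \<le> partial_sqnorm N' (?A S')"
      using N'(1) partial_sqnorm_le[OF A[OF S(1)], of N'] unfolding Af2 Q_def by simp
  qed
qed

text \<open>If the operator were unbounded, it would be so beyond every index, and the humps with
  \<open>\<epsilon> = (1 / 2) ^ n\<close> would add up to a sequence of the space.  The image of that sequence would agree up to
  the index \<open>N n\<close> with the image of the \<open>n\<close>-th partial sum, and so have infinite norm.\<close>
lemma dirichlet_conv_bounded:
  assumes A: "\<And>f. f \<in> dspace_coeffs w \<Longrightarrow> dirichlet_conv a f \<in> dspace_coeffs w"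
  obtains K where "\<And>f. f \<in> dspace_coeffs w \<Longrightarrow> sqnorm w (dirichlet_conv a f) \<le> K * sqnorm w f"
proof (cases "bounded_beyond a 0")
  case True
  then show ?thesis using that unfolding bounded_beyond_def by auto
next
  case False
  then have unb: "\<not> bounded_beyond a M" for M using bounded_beyond_0[OF A] by blast
  \<comment> \<open>The pairs \<open>X\<close> consist of a partial sum of humps and a bound for its support; the squared norm
    is at most \<open>2 - 2 * (1 / 2) ^ n\<close>, the sum of the first \<open>n\<close> powers of \<open>1 / 2\<close>.\<close>
  define P where "P n X \<longleftrightarrow> fst X \<in> dspace_coeffs w \<and> (\<forall>j>snd X. fst X j = 0) \<and>
    sqnorm w (fst X) \<le> 2 - 2 * (1 / 2) ^ n" for n :: nat and X :: "(nat \<Rightarrow> complex) \<times> nat"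
  define Q where "Q n X Y \<longleftrightarrow> snd X < snd Y \<and> (\<forall>j\<le>snd X. fst Y j = fst X j) \<and>
    real n \<le> partial_sqnorm (snd Y) (dirichlet_conv a (fst Y))" for n :: nat and X Y :: "(nat \<Rightarrow> complex) \<times> nat"
  have "\<exists>F. \<forall>n. P n (F n) \<and> Q n (F n) (F (Suc n))"
  proof (rule dependent_nat_choice)
    have "P 0 ((\<lambda>j. 0), 0)" by (simp add: P_def dspace_coeffs_def sqnorm_def)
    then show "\<exists>X. P 0 X" by blast
    fix X n assume X: "P n X"
    obtain S' N' where S': "snd X < N'" "S' \<in> dspace_coeffs w" "\<And>j. N' < j \<Longrightarrow> S' j = 0"
      "\<And>j. j \<le> snd X \<Longrightarrow> S' j = fst X j" "sqnorm w S' \<le> sqnorm w (fst X) + (1 / 2) ^ n"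
      "real n \<le> partial_sqnorm N' (dirichlet_conv a S')"
      by (rule gliding_hump_step[OF A unb, of "fst X" "snd X" "(1 / 2) ^ n" "real n"])
         (use X in \<open>auto simp: P_def\<close>)
    then have "P (Suc n) (S', N')" "Q n X (S', N')"
      using X by (auto simp: P_def Q_def)
    then show "\<exists>Y. P (Suc n) Y \<and> Q n X Y" by blast
  qed
  then obtain F where P: "\<And>n. P n (F n)" and Q: "\<And>n. Q n (F n) (F (Suc n))" by blast
  define S where "S n = fst (F n)" for n
  define N where "N n = snd (F n)" for n
  have S: "S n \<in> dspace_coeffs w" "sqnorm w (S n) \<le> 2" for n
    using P[of n] zero_le_power[of "1 / 2 :: real" n] unfolding P_def S_def by (auto intro: order_trans)
  have "strict_mono N"
    using Q unfolding strict_mono_Suc_iff Q_def N_def by blast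
  then have N: "n \<le> N n" "m \<le> n \<Longrightarrow> N m \<le> N n" for m n
    using strict_mono_imp_increasing strict_mono_leD by blast+
  have agree: "S n j = S m j" if "m \<le> n" "j \<le> N m" for m n j
    using that
  proof (induction n rule: dec_induct)
    case (step n)
    then have "j \<le> N n" using N(2)[of m n] by simp
    then show ?case using Q[of n] step unfolding Q_def S_def N_def by simp
  qed simp
  \<comment> \<open>The partial sums agree up to the index \<open>N n \<ge> n\<close> from the \<open>n\<close>-th on, so the diagonal is their limit.\<close>
  define f where "f j = S j j" for j
  have f_S: "f j = S n j" if "j \<le> N n" for j n
    using that agree[of n j j] agree[of j n j] N(1)[of j] by (cases "n \<le> j") (auto simp: f_def)
  have f01: "f 0 = 0" "f 1 = 0" using dspace_coeffsD(1,2)[OF S(1)] by (simp_all add: f_def)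
  have partial_eq: "partial_sqnorm (N n) (dirichlet_conv a f) = partial_sqnorm (N n) (dirichlet_conv a (S n))" for n
    unfolding partial_sqnorm_def
    by (intro sum.cong refl arg_cong2[where f = "(/)"] arg_cong[where f = "\<lambda>z. (cmod z)\<^sup>2"] dirichlet_conv_local f_S) simp
  have "summable (\<lambda>j. (cmod (f j))\<^sup>2 / w j)"
  proof (rule bounded_imp_summable)
    show "0 \<le> (cmod (f j))\<^sup>2 / w j" for j by (rule square_quot_nonneg[OF f01])
    fix n
    have "(\<Sum>j\<le>n. (cmod (f j))\<^sup>2 / w j) = partial_sqnorm n (S n)"
      unfolding partial_sqnorm_def using N(1)[of n] by (intro sum.cong refl) (simp add: f_S[of _ n])
    also have "\<dots> \<le> sqnorm w (S n)" by (rule partial_sqnorm_le[OF S(1)])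
    also have "\<dots> \<le> 2" by (rule S(2))
    finally show "(\<Sum>j\<le>n. (cmod (f j))\<^sup>2 / w j) \<le> 2" .
  qed
  then have "f \<in> dspace_coeffs w" using f01 by (simp add: dspace_coeffs_def)
  have "real n \<le> sqnorm w (dirichlet_conv a f)" for n
  proof -
    have "real n \<le> partial_sqnorm (N (Suc n)) (dirichlet_conv a (S (Suc n)))"
      using Q[of n] unfolding Q_def S_def N_def by simp
    also have "\<dots> \<le> sqnorm w (dirichlet_conv a f)"
      unfolding partial_eq[symmetric] by (rule partial_sqnorm_le[OF A]) fact
    finally show ?thesis .
  qed
  then show ?thesis using reals_Archimedean2 not_le by blast
qed

end

section \<open>Smooth integers and the extension of multipliers\<close>

definition smooth :: "nat \<Rightarrow> nat set" where
  "smooth p = {k. k \<ge> 1 \<and> (\<forall>q. prime q \<longrightarrow> q dvd k \<longrightarrow> q \<le> p)}"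

lemma gpf_le_iff:
  assumes "j \<ge> 2"
  shows "gpf j \<le> p \<longleftrightarrow> j \<in> smooth p"
proof -
  obtain q where "prime q" "q dvd j" using prime_factor_nat[of j] assms by auto
  then have "prime_factors j \<noteq> {}" using assms by (auto simp: prime_factors_dvd)
  then have "gpf j \<le> p \<longleftrightarrow> (\<forall>q\<in>prime_factors j. q \<le> p)"
    by (simp add: gpf_def)
  also have "\<dots> \<longleftrightarrow> j \<in> smooth p"
    using assms by (auto simp: smooth_def prime_factors_dvd)
  finally show ?thesis .
qed

lemma smooth_mult_iff: "k * m \<in> smooth p \<longleftrightarrow> k \<in> smooth p \<and> m \<in> smooth p"
  by (auto simp: smooth_def prime_dvd_mult_iff Suc_le_eq)

lemma smooth_mono_le: "1 \<le> k \<Longrightarrow> k \<le> p \<Longrightarrow> k \<in> smooth p"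
  by (auto simp: smooth_def dest: dvd_imp_le)

definition smooth_part :: "nat \<Rightarrow> (nat \<Rightarrow> complex) \<Rightarrow> nat \<Rightarrow> complex" where
  "smooth_part p a k = (if k \<in> smooth p then a k else 0)"

text \<open>A product is smooth if and only if both factors are.\<close>
lemma dirichlet_conv_smooth_part:
  "dirichlet_conv (smooth_part p a) (smooth_part p b) = smooth_part p (dirichlet_conv a b)"
proof
  fix n
  have *: "smooth_part p a d * smooth_part p b (n div d) = (if n \<in> smooth p then a d * b (n div d) else 0)"
    if "d dvd n" for d
    using that smooth_mult_iff[of d "n div d" p] by (auto simp: smooth_part_def)
  show "dirichlet_conv (smooth_part p a) (smooth_part p b) n = smooth_part p (dirichlet_conv a b) n"
  proof -
    have "dirichlet_conv (smooth_part p a) (smooth_part p b) n =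
        (\<Sum>d | d dvd n. if n \<in> smooth p then a d * b (n div d) else 0)"
      unfolding dirichlet_conv_def by (intro sum.cong refl) (simp add: *)
    then show ?thesis by (simp add: smooth_part_def dirichlet_conv_def)
  qed
qed

text \<open>Dominated convergence for series: every positive index is eventually smooth.\<close>
lemma tendsto_smooth_dirichlet_sum:
  assumes a: "abs_conv a (Re s)" and P: "\<And>n. n \<le> P n"
  shows "(\<lambda>n. dirichlet_sum (smooth_part (P n) a) s) \<longlonglongrightarrow> dirichlet_sum a s"
  unfolding dirichlet_sum_def
proof (rule tannerys_theorem[THEN conjunct2, THEN conjunct2])
  show "(\<lambda>n. smooth_part (P n) a k * of_nat k powr (- s)) \<longlonglongrightarrow> a k * of_nat k powr (- s)" for k
  proof (rule tendsto_eventually)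
    show "\<forall>\<^sub>F n in sequentially. smooth_part (P n) a k * of_nat k powr (- s) = a k * of_nat k powr (- s)"
      using eventually_ge_at_top[of k]
    proof eventually_elim
      case (elim n)
      then have "k \<le> P n" using P[of n] by simp
      then show ?case using smooth_mono_le[of k "P n"] by (cases "k = 0") (auto simp: smooth_part_def)
    qed
  qed
  show "\<forall>\<^sub>F (k, n) in at_top \<times>\<^sub>F sequentially. norm (smooth_part (P n) a k * of_nat k powr (- s))
      \<le> cmod (a k * of_nat k powr (- s))"
    by (intro always_eventually) (auto simp: smooth_part_def)
qed (use abs_conv_summable_norm[OF a] in auto)

lemma delta_abs_le_sigma_abs: "delta_abs w \<le> sigma_abs w"
  unfolding delta_abs_def sigma_abs_def
  by (rule Inf_superset_mono) (auto intro: summable_on_subset_banach)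

locale dirichlet_weight_delta = dirichlet_weight +
  fixes \<delta> :: real
  assumes delta_abs: "delta_abs w = ereal \<delta>"
begin

lemma delta_le_tau: "\<delta> \<le> \<tau>"
  using delta_abs_le_sigma_abs[of w] by (simp add: delta_abs sigma_abs)

lemma smooth_weight_summable_on:
  assumes "\<delta> < y" "prime p"
  shows "(\<lambda>j. w j * real j powr (- y)) summable_on (smooth p \<inter> {2..})"
proof -
  have "delta_abs w < ereal y" using assms delta_abs by simp
  then obtain s where s: "\<forall>p. prime p \<longrightarrow> (\<lambda>j. complex_of_real (w j) * of_nat j powr (- s)) summable_on {j. 2 \<le> j \<and> gpf j \<le> p}" "Re s < y"
    unfolding delta_abs_def Inf_less_iff by fastforce
  have "{j. 2 \<le> j \<and> gpf j \<le> p} = smooth p \<inter> {2..}" using gpf_le_iff by auto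
  then show ?thesis
    using s(1)[rule_format, OF \<open>prime p\<close>] s(2) by (intro weight_summable_on_mono[OF pos]) auto
qed

text \<open>The coefficients \<open>a k\<close> sit at the indices \<open>2 * k\<close> of an element of the space, and \<open>2\<close> is
  \<open>p\<close>-smooth.\<close>
lemma abs_conv_smooth_part:
  assumes a: "(\<lambda>k. (cmod (a k))\<^sup>2 / w (2 * k)) summable_on {1..}" and "\<delta> / 2 < x" "prime p"
  shows "abs_conv (smooth_part p a) x"
proof -
  have p: "p \<ge> 2" using \<open>prime p\<close> by (rule prime_ge_2_nat)
  let ?J = "(\<lambda>k. 2 * k) ` smooth p"
  have two: "2 \<in> smooth p" using p by (intro smooth_mono_le) auto
  have inj: "inj_on (\<lambda>k. 2 * k) (smooth p)" by (simp add: inj_on_def)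
  have J: "?J \<subseteq> smooth p \<inter> {2..}"
    using two by (auto simp: smooth_mult_iff) (auto simp: smooth_def)
  have "(\<lambda>j. cmod (a (j div 2)) * real j powr (- x)) summable_on ?J"
  proof (rule coeff_summable_on[where w = w])
    show "?J \<subseteq> {2..}" using J by auto
    show "(\<lambda>j. w j * real j powr (- (2 * x))) summable_on ?J"
      using assms by (intro summable_on_subset_banach[OF smooth_weight_summable_on J]) auto
    have "(\<lambda>k. (cmod (a k))\<^sup>2 / w (2 * k)) summable_on smooth p"
      by (rule summable_on_subset_banach[OF a]) (auto simp: smooth_def)
    then show "(\<lambda>j. (cmod (a (j div 2)))\<^sup>2 / w j) summable_on ?J"
      by (subst summable_on_reindex[OF inj]) (simp add: o_def)
  qed (rule pos)
  then have "(\<lambda>k. cmod (a k) * real (2 * k) powr (- x)) summable_on smooth p"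
    by (subst (asm) summable_on_reindex[OF inj]) (simp add: o_def)
  then have "(\<lambda>k. 2 powr x * (cmod (a k) * real (2 * k) powr (- x))) summable_on smooth p"
    by (rule summable_on_cmult_right)
  also have "(\<lambda>k. 2 powr x * (cmod (a k) * real (2 * k) powr (- x))) = (\<lambda>k. cmod (a k) * real k powr (- x))"
    by (auto simp: powr_mult powr_minus field_simps)
  finally have "(\<lambda>k. cmod (smooth_part p a k) * real k powr (- x)) summable_on UNIV"
    by (rule summable_on_cong_neutral[THEN iffD1, rotated -1]) (auto simp: smooth_part_def)
  then show ?thesis
    unfolding abs_conv_def by (subst summable_on_UNIV_nonneg_real_iff[symmetric]) auto
qed

text \<open>The sum is the inner product of the coefficient space; the Cauchy-Schwarz inequality for its partial
  sums passes to the limit.\<close>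
lemma inner_product_bound:
  assumes h: "h \<in> dspace_coeffs w" and f: "f \<in> dspace_coeffs w"
    and S: "(\<lambda>j. h j * cnj (f j) / of_real (w j)) sums S"
  shows "(cmod S)\<^sup>2 \<le> sqnorm w h * sqnorm w f"
proof (rule LIMSEQ_le_const2)
  show "(\<lambda>N. (cmod (\<Sum>j\<le>N. h j * cnj (f j) / of_real (w j)))\<^sup>2) \<longlonglongrightarrow> (cmod S)\<^sup>2"
    using S by (intro tendsto_power tendsto_norm) (simp add: sums_def_le)
  have squares: "(\<Sum>j\<le>N. (cmod (b j) / sqrt (w j))\<^sup>2) = partial_sqnorm N b"
    if "b \<in> dspace_coeffs w" for b N
    unfolding partial_sqnorm_def
  proof (rule sum.cong[OF refl])
    fix j
    have "0 \<le> w j \<or> b j = 0"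
      using pos[of j] dspace_coeffsD(1,2)[OF that] by (cases "j \<ge> 2") (auto simp: not_le less_2_cases_iff)
    then show "(cmod (b j) / sqrt (w j))\<^sup>2 = (cmod (b j))\<^sup>2 / w j" by (auto simp: power_divide)
  qed
  have "(cmod (\<Sum>j\<le>N. h j * cnj (f j) / of_real (w j)))\<^sup>2 \<le> sqnorm w h * sqnorm w f" for N
  proof -
    have "cmod (\<Sum>j\<le>N. h j * cnj (f j) / of_real (w j)) \<le> (\<Sum>j\<le>N. cmod (h j) / sqrt (w j) * (cmod (f j) / sqrt (w j)))"
    proof (rule sum_norm_le)
      fix j
      have "0 \<le> w j \<or> h j = 0"
        using pos[of j] dspace_coeffsD(1,2)[OF h] by (cases "j \<ge> 2") (auto simp: not_le less_2_cases_iff)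
      then show "norm (h j * cnj (f j) / of_real (w j)) \<le> cmod (h j) / sqrt (w j) * (cmod (f j) / sqrt (w j))"
        by (auto simp: norm_mult norm_divide)
    qed
    then have "(cmod (\<Sum>j\<le>N. h j * cnj (f j) / of_real (w j)))\<^sup>2
        \<le> (\<Sum>j\<le>N. cmod (h j) / sqrt (w j) * (cmod (f j) / sqrt (w j)))\<^sup>2"
      by (intro power_mono) auto
    also have "\<dots> \<le> (\<Sum>j\<le>N. (cmod (h j) / sqrt (w j))\<^sup>2) * (\<Sum>j\<le>N. (cmod (f j) / sqrt (w j))\<^sup>2)"
      by (rule Cauchy_Schwarz_ineq_sum)
    also have "\<dots> = partial_sqnorm N h * partial_sqnorm N f"
      by (simp only: squares[OF h] squares[OF f])
    also have "partial_sqnorm N h * partial_sqnorm N f \<le> sqnorm w h * sqnorm w f"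
      using h f by (intro mult_mono partial_sqnorm_le sqnorm_nonneg)
        (auto simp: partial_sqnorm_def intro!: sum_nonneg dspace_coeffsD(4))
    finally show ?thesis .
  qed
  then show "\<exists>N. \<forall>n\<ge>N. (cmod (\<Sum>j\<le>n. h j * cnj (f j) / of_real (w j)))\<^sup>2 \<le> sqnorm w h * sqnorm w f"
    by blast
qed

text \<open>The sequence \<open>f\<close> consists of the coefficients of the reproducing kernel at \<open>u\<close> for the subspace of
  \<open>p\<close>-smooth indices: pairing a sequence of the subspace with \<open>f\<close> evaluates its function at \<open>u\<close>.  The
  kernel at \<open>(u, u)\<close> is \<open>\<kappa>\<close>, both the value at \<open>u\<close> of the function with coefficients \<open>f\<close> and its
  squared norm.  Evaluating the product of the multiplier with this function gives
  \<open>|\<phi>_p(u)| * \<kappa> \<le> c * sqrt \<kappa> * sqrt \<kappa>\<close>.\<close>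
lemma smooth_multiplier_bound:
  assumes a: "(\<lambda>k. (cmod (a k))\<^sup>2 / w (2 * k)) summable_on {1..}"
    and A: "\<And>f. f \<in> dspace_coeffs w \<Longrightarrow> dirichlet_conv a f \<in> dspace_coeffs w"
    and c: "0 \<le> c" "\<And>f. f \<in> dspace_coeffs w \<Longrightarrow> sqnorm w (dirichlet_conv a f) \<le> c\<^sup>2 * sqnorm w f"
    and "prime p" and u: "\<delta> / 2 < Re u"
  shows "cmod (dirichlet_sum (smooth_part p a) u) \<le> c"
proof -
  define f where "f j = (if j \<in> smooth p \<inter> {2..} then of_real (w j) * cnj (of_nat j powr (- u)) else 0)" for j
  define \<kappa> where "\<kappa> = sqnorm w f"
  have f01: "f 0 = 0" "f 1 = 0" by (auto simp: f_def)
  have f_smooth: "smooth_part p f = f" by (auto simp: smooth_part_def f_def fun_eq_iff)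
  have kernel: "(cmod (f j))\<^sup>2 / w j = (if j \<in> smooth p \<inter> {2..} then w j * real j powr (- (2 * Re u)) else 0)" for j
  proof (cases "j \<in> smooth p \<inter> {2..}")
    case True
    then have "w j > 0" using pos by auto
    moreover have "real j powr (- (2 * Re u)) = (real j powr (- Re u))\<^sup>2"
      by (simp add: power2_eq_square flip: powr_add)
    ultimately show ?thesis
      using True by (simp add: f_def norm_mult norm_nat_powr power_mult_distrib power2_eq_square)
  next
    case False
    then have "f j = 0" by (simp only: f_def if_False)
    then show ?thesis using False by (simp only: if_False) simp
  qed
  have "(\<lambda>j. (cmod (f j))\<^sup>2 / w j) summable_on UNIV \<longleftrightarrow>
      (\<lambda>j. w j * real j powr (- (2 * Re u))) summable_on (smooth p \<inter> {2..})"
    unfolding kernel by (rule summable_on_cong_neutral) auto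
  then have "(\<lambda>j. (cmod (f j))\<^sup>2 / w j) summable_on UNIV"
    using smooth_weight_summable_on[of "2 * Re u" p] u \<open>prime p\<close> by simp
  then have "summable (\<lambda>j. (cmod (f j))\<^sup>2 / w j)"
    using square_quot_nonneg[OF f01] by (subst (asm) summable_on_UNIV_nonneg_real_iff) auto
  then have f: "f \<in> dspace_coeffs w" using f01 by (simp add: dspace_coeffs_def)
  have pair: "h j * cnj (f j) / of_real (w j) = h j * of_nat j powr (- u)"
    if "h \<in> dspace_coeffs w" "smooth_part p h = h" for h j
  proof (cases "j \<in> smooth p \<inter> {2..}")
    case True
    then have "w j > 0" using pos by auto
    then show ?thesis using True by (simp add: f_def)
  next
    case False
    then have "h j = 0"
      using fun_cong[OF that(2), of j] dspace_coeffsD(1,2)[OF that(1)]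
      by (auto simp: smooth_part_def not_le less_2_cases_iff split: if_splits)
    then show ?thesis by simp
  qed
  have ff: "f j * of_nat j powr (- u) = of_real ((cmod (f j))\<^sup>2 / w j)" for j
    unfolding pair[OF f f_smooth, symmetric] by (simp only: of_real_divide complex_norm_square)
  have sum_f: "dirichlet_sum f u = of_real \<kappa>"
    unfolding dirichlet_sum_def ff \<kappa>_def sqnorm_def by (rule suminf_of_real[symmetric]) (rule dspace_coeffsD[OF f])
  have conv_f: "abs_conv f (Re u)"
  proof -
    have "cmod (f j) * real j powr (- Re u) = (cmod (f j))\<^sup>2 / w j" for j
      using arg_cong[OF ff[of j], of cmod] dspace_coeffsD(4)[OF f, of j]
      by (simp only: norm_dirichlet_term norm_of_real abs_of_nonneg)
    then show ?thesis using dspace_coeffsD(3)[OF f] by (simp add: abs_conv_def)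
  qed
  have conv_a: "abs_conv (smooth_part p a) (Re u)"
    by (rule abs_conv_smooth_part[OF a u \<open>prime p\<close>])
  define g where "g = smooth_part p (dirichlet_conv a f)"
  have g: "g \<in> dspace_coeffs w" "sqnorm w g \<le> sqnorm w (dirichlet_conv a f)"
    using dspace_coeffs_restrict[OF A[OF f], of g] by (auto simp: g_def smooth_part_def)
  have g_eq: "g = dirichlet_conv (smooth_part p a) f"
    using dirichlet_conv_smooth_part[of p a f] by (simp add: g_def f_smooth)
  have conv_g: "abs_conv g (Re u)"
    using dirichlet_conv_abs(1)[OF conv_a conv_f] by (simp only: g_eq)
  have g_smooth: "smooth_part p g = g" by (auto simp: g_def smooth_part_def)
  have "dirichlet_sum g u = dirichlet_sum (smooth_part p a) u * of_real \<kappa>"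
    unfolding g_eq dirichlet_conv_abs(2)[OF conv_a conv_f] sum_f ..
  then have "(cmod (dirichlet_sum (smooth_part p a) u))\<^sup>2 * \<kappa>\<^sup>2 = (cmod (dirichlet_sum g u))\<^sup>2"
    by (simp add: norm_mult power_mult_distrib)
  also have "(cmod (dirichlet_sum g u))\<^sup>2 \<le> sqnorm w g * sqnorm w f"
  proof (rule inner_product_bound[OF g(1) f])
    show "(\<lambda>j. g j * cnj (f j) / of_real (w j)) sums dirichlet_sum g u"
      unfolding pair[OF g(1) g_smooth] by (rule abs_conv_sums[OF conv_g])
  qed
  also have "sqnorm w g * sqnorm w f \<le> c\<^sup>2 * \<kappa> * \<kappa>"
    unfolding \<kappa>_def using g(2) c(2)[OF f] sqnorm_nonneg[OF f] by (intro mult_right_mono) auto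
  also have "\<dots> = c\<^sup>2 * \<kappa>\<^sup>2" by (simp add: power2_eq_square)
  finally have "(cmod (dirichlet_sum (smooth_part p a) u))\<^sup>2 * \<kappa>\<^sup>2 \<le> c\<^sup>2 * \<kappa>\<^sup>2" .
  moreover have "\<kappa> > 0"
  proof -
    have "2 \<in> smooth p" using prime_ge_2_nat[OF \<open>prime p\<close>] by (intro smooth_mono_le) auto
    then have "0 < (cmod (f 2))\<^sup>2 / w 2" unfolding kernel using pos[of 2] by simp
    also have "\<dots> \<le> \<kappa>"
      using coeff_le_sqnorm[OF f, of 2] pos[of 2] by (simp add: \<kappa>_def divide_le_eq mult.commute)
    finally show ?thesis .
  qed
  ultimately have "(cmod (dirichlet_sum (smooth_part p a) u))\<^sup>2 \<le> c\<^sup>2"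
    by (simp add: mult_le_cancel_right)
  then show ?thesis using c(1) by (rule power2_le_imp_le)
qed

text \<open>The smooth parts of the multiplier are holomorphic and bounded by \<open>c\<close> on the large half-plane, so a
  subsequence converges there; on the domain of the space the full sequence converges to \<open>\<phi>\<close> by
  absolute convergence.\<close>
lemma multiplier_extends:
  assumes \<phi>: "\<phi> \<in> multipliers w"
    and c: "0 \<le> c" "\<And>f. f \<in> dspace w \<Longrightarrow> dspace_norm w (\<lambda>s. \<phi> s * f s) \<le> c * dspace_norm w f"
  obtains \<psi> where "\<psi> \<in> Hinf (half_plane (ereal (\<delta> / 2)))" "\<psi> \<in> dirichlet_functions"
    "\<And>s. s \<in> weight_domain w \<Longrightarrow> \<psi> s = \<phi> s" "\<And>s. \<delta> / 2 < Re s \<Longrightarrow> cmod (\<psi> s) \<le> c"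
proof -
  obtain a where a: "\<And>x. \<tau> / 2 < x \<Longrightarrow> abs_conv a x"
    and \<phi>a: "\<And>s. s \<in> weight_domain w \<Longrightarrow> \<phi> s = dirichlet_sum a s"
    and a2: "(\<lambda>k. (cmod (a k))\<^sup>2 / w (2 * k)) summable_on {1..}"
    by (rule multiplier_dirichlet_series[OF \<phi>]) blast
  have acts: "dirichlet_conv a f \<in> dspace_coeffs w"
    "(\<lambda>s. \<phi> s * dspace_fun f s) = dspace_fun (dirichlet_conv a f)" if "f \<in> dspace_coeffs w" for f
    using multiplier_acts_by_conv[OF \<phi> _ _ that, of a] a \<phi>a by blast+
  have bound: "sqnorm w (dirichlet_conv a f) \<le> c\<^sup>2 * sqnorm w f" if f: "f \<in> dspace_coeffs w" for f
  proof -
    have "sqrt (sqnorm w (dirichlet_conv a f)) \<le> c * sqrt (sqnorm w f)"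
      using c(2)[OF dspace_fun_in_dspace[OF f]] unfolding acts(2)[OF f]
      by (simp add: dspace_norm_dspace_fun f acts(1))
    then have "(sqrt (sqnorm w (dirichlet_conv a f)))\<^sup>2 \<le> (c * sqrt (sqnorm w f))\<^sup>2"
      using sqnorm_nonneg[OF acts(1)[OF f]] by (intro power_mono) auto
    then show ?thesis
      using sqnorm_nonneg[OF acts(1)[OF f]] sqnorm_nonneg[OF f] by (simp add: power_mult_distrib)
  qed
  let ?X = "half_plane (ereal (\<delta> / 2))"
  define P where "P n = (SOME p. prime p \<and> n < p)" for n :: nat
  have P: "prime (P n)" "n < P n" for n
    using someI_ex[OF bigger_prime[of n]] by (auto simp: P_def)
  define F where "F n = dirichlet_sum (smooth_part (P n) a)" for n
  have F_bound: "cmod (F n s) \<le> c" if "s \<in> ?X" for n s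
    unfolding F_def using that P(1)
    by (intro smooth_multiplier_bound[OF a2 acts(1) c(1) bound]) auto
  have F_hol: "F n holomorphic_on ?X" for n
    unfolding F_def by (intro holomorphic_dirichlet_sum abs_conv_smooth_part[OF a2] P(1))
  obtain g r where g: "g holomorphic_on ?X" "strict_mono (r :: nat \<Rightarrow> nat)"
      "\<And>s. s \<in> ?X \<Longrightarrow> (\<lambda>n. F (r n) s) \<longlonglongrightarrow> g s"
  proof (rule Montel[where S = ?X and \<H> = "{h. h holomorphic_on ?X \<and> (\<forall>s\<in>?X. cmod (h s) \<le> c)}" and \<F> = F])
    show "range F \<subseteq> {h. h holomorphic_on ?X \<and> (\<forall>s\<in>?X. cmod (h s) \<le> c)}"
      using F_bound F_hol by auto
    show "\<exists>B. \<forall>h\<in>{h. h holomorphic_on ?X \<and> (\<forall>s\<in>?X. cmod (h s) \<le> c)}. \<forall>z\<in>K. cmod (h z) \<le> B"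
      if "compact K" "K \<subseteq> ?X" for K
      using that(2) by (intro exI[of _ c]) blast
  qed (auto simp: open_half_plane)
  have g_bound: "cmod (g s) \<le> c" if "s \<in> ?X" for s
    by (rule LIMSEQ_le_const2[OF tendsto_norm[OF g(3)[OF that]]]) (use F_bound that in auto)
  have dom: "s \<in> ?X" if "s \<in> weight_domain w" for s
    using that delta_le_tau by (simp add: weight_domain)
  have g_eq: "g s = \<phi> s" if s: "s \<in> weight_domain w" for s
  proof -
    have "(\<lambda>n. F n s) \<longlonglongrightarrow> \<phi> s"
      unfolding F_def \<phi>a[OF s] using s a P(2)
      by (intro tendsto_smooth_dirichlet_sum) (auto simp: weight_domain less_imp_le)
    then have "(\<lambda>n. F (r n) s) \<longlonglongrightarrow> \<phi> s"
      using LIMSEQ_subseq_LIMSEQ[OF _ g(2)] by (auto simp: o_def)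
    then show ?thesis using g(3)[OF dom[OF s]] LIMSEQ_unique by blast
  qed
  define \<psi> where "\<psi> s = (if s \<in> ?X then g s else 0)" for s
  show ?thesis
  proof
    have "\<psi> holomorphic_on ?X"
      using g(1) by (rule holomorphic_transform) (simp add: \<psi>_def)
    moreover have "cmod (\<psi> s) \<le> c" if "s \<in> ?X" for s
      using g_bound[OF that] that by (simp add: \<psi>_def)
    then have "bounded (\<psi> ` ?X)"
      unfolding bounded_iff by blast
    ultimately show "\<psi> \<in> Hinf ?X" by (auto simp: Hinf_def funs_on_def \<psi>_def)
    show eq: "\<psi> s = \<phi> s" if "s \<in> weight_domain w" for s
      using that g_eq dom by (simp add: \<psi>_def)
    have "has_dseries_on \<psi> a (half_plane (ereal (\<tau> / 2)))"
      unfolding has_dseries_on_def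
    proof
      fix s assume s: "s \<in> half_plane (ereal (\<tau> / 2))"
      then have "\<psi> s = dirichlet_sum a s" using eq \<phi>a by (simp add: weight_domain)
      then show "(\<lambda>j. a j * of_nat j powr (- s)) sums \<psi> s"
        using abs_conv_sums[of a s] a s by simp
    qed
    then show "\<psi> \<in> dirichlet_functions" unfolding dirichlet_functions_def by blast
    show "cmod (\<psi> s) \<le> c" if "\<delta> / 2 < Re s" for s
      using g_bound that by (simp add: \<psi>_def)
  qed
qed

end

section \<open>The multiplier norm\<close>

context dirichlet_weight
begin

lemma dspace_add:
  assumes "f \<in> dspace w" "g \<in> dspace w"
  shows "(\<lambda>s. f s + g s) \<in> dspace w"
proof -
  obtain a where a: "a \<in> dspace_coeffs w" "f = dspace_fun a" using assms(1) by (rule dspaceE)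
  obtain b where b: "b \<in> dspace_coeffs w" "g = dspace_fun b" using assms(2) by (rule dspaceE)
  have "has_dseries_on (\<lambda>s. f s + g s) (\<lambda>j. a j + b j) (weight_domain w)"
    using has_dseries_on_dspace_fun[OF a(1)] has_dseries_on_dspace_fun[OF b(1)]
    unfolding has_dseries_on_def a(2) b(2) by (auto simp: distrib_right intro: sums_add)
  then show ?thesis
    using dspace_coeffs_add(1)[OF a(1) b(1)] assms unfolding dspace_def funs_on_def by auto
qed

lemma dspace_cmult:
  assumes "f \<in> dspace w"
  shows "(\<lambda>s. c * f s) \<in> dspace w"
proof -
  obtain a where a: "a \<in> dspace_coeffs w" "f = dspace_fun a" using assms(1) by (rule dspaceE)
  have "has_dseries_on (\<lambda>s. c * f s) (\<lambda>j. c * a j) (weight_domain w)"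
    using has_dseries_on_dspace_fun[OF a(1)]
    unfolding has_dseries_on_def a(2) by (auto simp: mult.assoc intro: sums_mult)
  then show ?thesis
    using dspace_coeffs_cmult(1)[OF a(1)] assms unfolding dspace_def funs_on_def by auto
qed

lemma multipliers_add:
  assumes "\<phi> \<in> multipliers w" "\<psi> \<in> multipliers w"
  shows "(\<lambda>s. \<phi> s + \<psi> s) \<in> multipliers w"
  using assms dspace_add by (auto simp: multipliers_def funs_on_def distrib_right)

lemma multipliers_cmult:
  assumes "\<phi> \<in> multipliers w"
  shows "(\<lambda>s. c * \<phi> s) \<in> multipliers w"
  using assms dspace_cmult by (auto simp: multipliers_def funs_on_def mult.assoc)

lemma multipliers_mult:
  assumes "\<phi> \<in> multipliers w" "\<psi> \<in> multipliers w"
  shows "(\<lambda>s. \<phi> s * \<psi> s) \<in> multipliers w"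
  using assms by (auto simp: multipliers_def funs_on_def mult.assoc)

lemma zero_in_dspace: "(\<lambda>s. 0) \<in> dspace w" and dspace_norm_zero: "dspace_norm w (\<lambda>s. 0) = 0"
proof -
  have z: "(\<lambda>j. 0) \<in> dspace_coeffs w" by (simp add: dspace_coeffs_def)
  have eq: "dspace_fun (\<lambda>j. 0) = (\<lambda>s. 0)" by (auto simp: dspace_fun_def dirichlet_sum_def)
  show "(\<lambda>s. 0) \<in> dspace w" "dspace_norm w (\<lambda>s. 0) = 0"
    using dspace_fun_in_dspace[OF z] dspace_norm_dspace_fun[OF z] unfolding eq by (simp_all add: sqnorm_def)
qed

lemma multiplier_norm_le:
  assumes "\<And>f. f \<in> dspace w \<Longrightarrow> dspace_norm w (\<lambda>s. \<phi> s * f s) \<le> c * dspace_norm w f" "0 \<le> c"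
  shows "multiplier_norm w \<phi> \<le> ereal c"
  unfolding multiplier_norm_def
proof (rule SUP_least)
  fix f assume f: "f \<in> {f \<in> dspace w. dspace_norm w f \<le> 1}"
  then have "dspace_norm w (\<lambda>s. \<phi> s * f s) \<le> c * dspace_norm w f" using assms(1) by blast
  also have "\<dots> \<le> c * 1" using f assms(2) by (intro mult_left_mono) auto
  finally show "ereal (dspace_norm w (\<lambda>s. \<phi> s * f s)) \<le> ereal c" by simp
qed

text \<open>The supremum that defines the norm is finite because the convolution is bounded.  The case of norm
  \<open>0\<close> needs this bound as well, since such a function cannot be scaled to norm \<open>1\<close>.\<close>
lemma multiplier_norm_bound:
  assumes \<phi>: "\<phi> \<in> multipliers w"
  obtains c where "0 \<le> c" "multiplier_norm w \<phi> = ereal c"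
    "\<And>f. f \<in> dspace w \<Longrightarrow> dspace_norm w (\<lambda>s. \<phi> s * f s) \<le> c * dspace_norm w f"
proof -
  obtain a where a: "\<And>x. \<tau> / 2 < x \<Longrightarrow> abs_conv a x"
    and \<phi>a: "\<And>s. s \<in> weight_domain w \<Longrightarrow> \<phi> s = dirichlet_sum a s"
    by (rule multiplier_dirichlet_series[OF \<phi>]) blast
  have acts: "dirichlet_conv a f \<in> dspace_coeffs w"
    "(\<lambda>s. \<phi> s * dspace_fun f s) = dspace_fun (dirichlet_conv a f)" if "f \<in> dspace_coeffs w" for f
    using multiplier_acts_by_conv[OF \<phi> _ _ that, of a] a \<phi>a by blast+
  have norm_acts: "dspace_norm w (\<lambda>s. \<phi> s * dspace_fun f s) = sqrt (sqnorm w (dirichlet_conv a f))"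
    if "f \<in> dspace_coeffs w" for f
    by (simp add: acts[OF that] dspace_norm_dspace_fun)
  obtain K where K: "\<And>f. f \<in> dspace_coeffs w \<Longrightarrow> sqnorm w (dirichlet_conv a f) \<le> K * sqnorm w f"
    using dirichlet_conv_bounded[of a] acts(1) by blast
  have K': "dspace_norm w (\<lambda>s. \<phi> s * f s) \<le> sqrt \<bar>K\<bar> * dspace_norm w f" if f: "f \<in> dspace w" for f
  proof -
    obtain b where b: "b \<in> dspace_coeffs w" "f = dspace_fun b" using f by (rule dspaceE)
    have "sqnorm w (dirichlet_conv a b) \<le> \<bar>K\<bar> * sqnorm w b"
      using K[OF b(1)] mult_right_mono[OF abs_ge_self[of K] sqnorm_nonneg[OF b(1)]] by simp
    then show ?thesis
      by (simp add: b norm_acts dspace_norm_dspace_fun flip: real_sqrt_mult)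
  qed
  have le: "multiplier_norm w \<phi> \<le> ereal (sqrt \<bar>K\<bar>)"
    by (rule multiplier_norm_le[OF K']) auto
  have "ereal (dspace_norm w (\<lambda>s. \<phi> s * 0)) \<le> multiplier_norm w \<phi>"
    unfolding multiplier_norm_def by (rule SUP_upper) (simp add: zero_in_dspace dspace_norm_zero)
  then have ge: "0 \<le> multiplier_norm w \<phi>" by (simp add: dspace_norm_zero zero_ereal_def)
  obtain c where c: "multiplier_norm w \<phi> = ereal c" "0 \<le> c"
    using le ge by (cases "multiplier_norm w \<phi>") auto
  show ?thesis
  proof
    show "0 \<le> c" "multiplier_norm w \<phi> = ereal c" by fact+
    fix f assume "f \<in> dspace w"
    then obtain b where b: "b \<in> dspace_coeffs w" "f = dspace_fun b" by (rule dspaceE)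
    define n where "n = dspace_norm w f"
    have n: "n = sqrt (sqnorm w b)" by (simp add: n_def b dspace_norm_dspace_fun)
    show "dspace_norm w (\<lambda>s. \<phi> s * f s) \<le> c * dspace_norm w f"
    proof (cases "n = 0")
      case True
      then show ?thesis using K'[OF \<open>f \<in> dspace w\<close>] by (simp add: n_def)
    next
      case False
      then have "n > 0" using n sqnorm_nonneg[OF b(1)] by simp
      define b' where "b' j = of_real (1 / n) * b j" for j
      have b': "b' \<in> dspace_coeffs w" "sqnorm w b' = (1 / n)\<^sup>2 * sqnorm w b"
        using dspace_coeffs_cmult[OF b(1), of "of_real (1 / n)"] by (simp_all add: b'_def[abs_def] norm_divide power_divide)
      have "sqnorm w b = n\<^sup>2" using n sqnorm_nonneg[OF b(1)] by simp
      then have "dspace_norm w (dspace_fun b') = 1"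
        using \<open>n > 0\<close> by (simp add: dspace_norm_dspace_fun b' power_divide)
      then have "ereal (dspace_norm w (\<lambda>s. \<phi> s * dspace_fun b' s)) \<le> ereal c"
        unfolding c(1)[symmetric] multiplier_norm_def
        by (intro SUP_upper) (simp add: dspace_fun_in_dspace b')
      moreover have "dirichlet_conv a b' = (\<lambda>j. of_real (1 / n) * dirichlet_conv a b j)"
        unfolding b'_def[abs_def] by (rule ext) (rule dirichlet_conv_cmult)
      then have "sqnorm w (dirichlet_conv a b') = (1 / n)\<^sup>2 * sqnorm w (dirichlet_conv a b)"
        using dspace_coeffs_cmult(2)[OF acts(1)[OF b(1)], of "of_real (1 / n)"] by (simp add: norm_divide power_divide)
      then have "dspace_norm w (\<lambda>s. \<phi> s * dspace_fun b' s) = dspace_norm w (\<lambda>s. \<phi> s * f s) / n"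
        using \<open>n > 0\<close> by (simp add: norm_acts b b' real_sqrt_mult real_sqrt_divide power_divide)
      ultimately have "dspace_norm w (\<lambda>s. \<phi> s * f s) / n \<le> c" by simp
      then show ?thesis using \<open>n > 0\<close> by (simp add: n_def divide_le_eq)
    qed
  qed
qed

end


section \<open>Bounded Dirichlet functions as multipliers\<close>

lemma HinfE:
  assumes "\<psi> \<in> Hinf X"
  obtains B where "\<And>s. s \<in> X \<Longrightarrow> cmod (\<psi> s) \<le> B"
  using assms unfolding Hinf_def bounded_iff by blast

locale additive_dirichlet_weight = dirichlet_weight_delta +
  assumes additive: "\<And>m n. m \<ge> 2 \<Longrightarrow> n \<ge> 2 \<Longrightarrow> coprime m n \<Longrightarrow> w (m * n) = w m + w n"
    and ratio: "\<And>p j. prime p \<Longrightarrow> j \<ge> 2 \<Longrightarrow> w (p ^ (j - 1)) / w (p ^ j) \<le> real p powr (- \<delta>)"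
    and nonpos: "\<delta> \<le> 0"
begin

abbreviation H\<delta> :: "complex set" where "H\<delta> \<equiv> half_plane (ereal (\<delta> / 2))"

lemma adjoint_conv_weight_bound:
  assumes hol: "\<psi> holomorphic_on H\<delta>" and bd: "\<And>s. s \<in> H\<delta> \<Longrightarrow> cmod (\<psi> s) \<le> B"
    and a: "\<And>s. r \<le> Re s \<Longrightarrow> abs_conv a (Re s)" "\<And>s. r \<le> Re s \<Longrightarrow> \<psi> s = dirichlet_sum a s"
  shows "(\<Sum>m\<in>{2..N}. w m * (cmod (adjoint_conv a N g m))\<^sup>2) \<le> B\<^sup>2 * (\<Sum>m\<in>{2..N}. w m * (cmod (g m))\<^sup>2)"
proof -
  define u where "u j = (if j \<ge> 2 then w j * real j powr (- \<delta>) else 0)" for j :: nat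
  have u: "u \<in> divisor_cone N"
    unfolding u_def[abs_def] by (rule additive_weight_in_divisor_cone[OF pos additive ratio nonpos])
  have base: "(\<Sum>m\<in>{1..N}. real m powr \<delta> * (cmod (adjoint_conv a N g m))\<^sup>2)
      \<le> B\<^sup>2 * (\<Sum>m\<in>{1..N}. real m powr \<delta> * (cmod (g m))\<^sup>2)" for g
    using adjoint_conv_bound[OF hol _ a, where B = B and N = N and g = g] bd by simp
  have eq: "(\<Sum>m\<in>{1..N}. real m powr \<delta> * u m * X m) = (\<Sum>m\<in>{2..N}. w m * X m)" for X
  proof (rule sum.mono_neutral_cong_right)
    show "\<forall>m\<in>{1..N} - {2..N}. real m powr \<delta> * u m * X m = 0" by (auto simp: u_def)
    show "real m powr \<delta> * u m * X m = w m * X m" if "m \<in> {2..N}" for m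
    proof -
      have "real m powr \<delta> * real m powr (- \<delta>) = 1" using that by (simp flip: powr_add)
      then have "real m powr \<delta> * u m = w m" using that by (simp add: u_def)
      then show ?thesis by simp
    qed
  qed auto
  show ?thesis
    using adjoint_conv_cone_bound[OF base u, of g]
    unfolding eq[of "\<lambda>m. (cmod (adjoint_conv a N g m))\<^sup>2"] eq[of "\<lambda>m. (cmod (g m))\<^sup>2"] .
qed

text \<open>The convolution is bounded by \<open>B\<close> on the space.  That its image has the product as function is
  clear where the Dirichlet series of \<open>\<psi>\<close> converges absolutely, possibly only far to the right, and
  follows on the whole domain of the space by the identity theorem.\<close>
lemma bounded_dirichlet_multiplies:
  assumes \<psi>: "\<psi> \<in> Hinf H\<delta>" "\<psi> \<in> dirichlet_functions"
    and bd: "\<And>s. s \<in> H\<delta> \<Longrightarrow> cmod (\<psi> s) \<le> B" and f: "f \<in> dspace w"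
  shows "(\<lambda>s. \<psi> s * f s) \<in> dspace w" "dspace_norm w (\<lambda>s. \<psi> s * f s) \<le> B * dspace_norm w f"
proof -
  have hol: "\<psi> holomorphic_on H\<delta>" using \<psi>(1) by (simp add: Hinf_def)
  have B: "0 \<le> B" using order_trans[OF norm_ge_zero bd[of "of_real (\<delta> / 2 + 1)"]] by simp
  obtain a \<rho> where "has_dseries_on \<psi> a (half_plane (ereal \<rho>))"
    using \<psi>(2) unfolding dirichlet_functions_def by blast
  then obtain r where a: "\<And>s. r \<le> Re s \<Longrightarrow> abs_conv a (Re s)" "\<And>s. r \<le> Re s \<Longrightarrow> \<psi> s = dirichlet_sum a s"
    by (rule has_dseries_on_imp_abs_conv) blast
  obtain b where b: "b \<in> dspace_coeffs w" "f = dspace_fun b" using f by (rule dspaceE)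
  have conv: "dirichlet_conv a b \<in> dspace_coeffs w" "sqnorm w (dirichlet_conv a b) \<le> B\<^sup>2 * sqnorm w b"
    using dirichlet_conv_sqnorm_bound[OF pos _ adjoint_conv_weight_bound[OF hol bd a] b(1)] by auto
  let ?W = "half_plane (ereal (\<tau> / 2))"
  define x where "x = max r (\<tau> / 2)"
  have x: "r \<le> x" "\<tau> / 2 \<le> x" by (simp_all add: x_def)
  have prod: "\<psi> s * dirichlet_sum b s = dirichlet_sum (dirichlet_conv a b) s" if "s \<in> ?W" for s
  proof (rule analytic_continuation_open[where s = "half_plane (ereal x)" and s' = ?W
        and f = "\<lambda>s. \<psi> s * dirichlet_sum b s" and g = "dirichlet_sum (dirichlet_conv a b)"])
    have "of_real (x + 1) \<in> half_plane (ereal x)" by simp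
    then show "half_plane (ereal x) \<noteq> {}" by blast
    show "connected ?W" by (rule convex_connected[OF convex_half_plane])
    show "half_plane (ereal x) \<subseteq> ?W" using x by auto
    have "?W \<subseteq> H\<delta>" using delta_le_tau by auto
    then show "(\<lambda>s. \<psi> s * dirichlet_sum b s) holomorphic_on ?W"
      using b(1) by (intro holomorphic_on_mult holomorphic_on_subset[OF hol] holomorphic_dirichlet_sum)
        (auto intro: abs_conv_dspace_coeffs)
    show "dirichlet_sum (dirichlet_conv a b) holomorphic_on ?W"
      using conv(1) by (intro holomorphic_dirichlet_sum) (auto intro: abs_conv_dspace_coeffs)
    fix z assume z: "z \<in> half_plane (ereal x)"
    then have "abs_conv a (Re z)" "abs_conv b (Re z)" "\<psi> z = dirichlet_sum a z"
      using a b(1) x by (auto intro: abs_conv_dspace_coeffs)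
    then show "\<psi> z * dirichlet_sum b z = dirichlet_sum (dirichlet_conv a b) z"
      by (simp add: dirichlet_conv_abs(2))
  qed (use that open_half_plane in auto)
  have eq: "(\<lambda>s. \<psi> s * f s) = dspace_fun (dirichlet_conv a b)"
    using prod by (auto simp: b(2) dspace_fun_def weight_domain fun_eq_iff)
  show "(\<lambda>s. \<psi> s * f s) \<in> dspace w"
    unfolding eq by (rule dspace_fun_in_dspace[OF conv(1)])
  have "sqrt (sqnorm w (dirichlet_conv a b)) \<le> sqrt (B\<^sup>2 * sqnorm w b)" using conv(2) by simp
  also have "\<dots> = B * sqrt (sqnorm w b)" using B by (simp add: real_sqrt_mult)
  finally show "dspace_norm w (\<lambda>s. \<psi> s * f s) \<le> B * dspace_norm w f"
    unfolding eq by (simp add: b conv(1) dspace_norm_dspace_fun)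
qed

definition restrict_domain :: "(complex \<Rightarrow> complex) \<Rightarrow> complex \<Rightarrow> complex" where
  "restrict_domain \<psi> s = (if s \<in> weight_domain w then \<psi> s else 0)"

lemma restrict_domain_times:
  assumes "f \<in> dspace w"
  shows "(\<lambda>s. restrict_domain \<psi> s * f s) = (\<lambda>s. \<psi> s * f s)"
  using assms by (auto simp: restrict_domain_def dspace_def funs_on_def fun_eq_iff)

lemma restrict_domain_multiplier:
  assumes "\<psi> \<in> Hinf H\<delta> \<inter> dirichlet_functions"
  shows "restrict_domain \<psi> \<in> multipliers w"
proof -
  obtain B where "\<And>s. s \<in> H\<delta> \<Longrightarrow> cmod (\<psi> s) \<le> B"
    by (rule HinfE[OF IntD1[OF assms]]) blast
  then have "(\<lambda>s. restrict_domain \<psi> s * f s) \<in> dspace w" if "f \<in> dspace w" for f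
    using bounded_dirichlet_multiplies(1)[of \<psi> B f] assms that by (simp add: restrict_domain_times)
  then show ?thesis by (auto simp: multipliers_def funs_on_def restrict_domain_def)
qed

text \<open>By the identity theorem, as the domain of the space is a non-empty open subset of the half-plane.
  Injectivity on all bounded holomorphic functions makes extension compatible with the algebra
  operations: sums and products of extensions are such functions.\<close>
lemma inj_on_restrict_domain: "inj_on restrict_domain (Hinf H\<delta>)"
proof (rule inj_onI)
  fix \<psi> \<eta> assume \<psi>: "\<psi> \<in> Hinf H\<delta>" and \<eta>: "\<eta> \<in> Hinf H\<delta>" and eq: "restrict_domain \<psi> = restrict_domain \<eta>"
  have "\<psi> s = \<eta> s" if "s \<in> H\<delta>" for s
  proof (rule analytic_continuation_open[where s = "half_plane (ereal (\<tau> / 2))" and s' = H\<delta> and f = \<psi> and g = \<eta>])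
    have "of_real (\<tau> / 2 + 1) \<in> half_plane (ereal (\<tau> / 2))" by simp
    then show "half_plane (ereal (\<tau> / 2)) \<noteq> {}" by blast
    show "connected H\<delta>" by (rule convex_connected[OF convex_half_plane])
    show "half_plane (ereal (\<tau> / 2)) \<subseteq> H\<delta>" using delta_le_tau by auto
    show "\<psi> holomorphic_on H\<delta>" "\<eta> holomorphic_on H\<delta>" using \<psi> \<eta> by (auto simp: Hinf_def)
    show "\<psi> z = \<eta> z" if "z \<in> half_plane (ereal (\<tau> / 2))" for z
      using fun_cong[OF eq, of z] that by (simp add: restrict_domain_def weight_domain)
  qed (use that open_half_plane in auto)
  moreover have "\<psi> s = \<eta> s" if "s \<notin> H\<delta>" for s
    using \<psi> \<eta> that unfolding Hinf_def funs_on_def by simp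
  ultimately show "\<psi> = \<eta>" by blast
qed

text \<open>The extension of multipliers with the multiplier norm itself as the bound \<open>c\<close>.\<close>
lemma restrict_domain_extension:
  assumes "\<phi> \<in> multipliers w"
  obtains \<psi> where "\<psi> \<in> Hinf H\<delta> \<inter> dirichlet_functions" "restrict_domain \<psi> = \<phi>"
    "sup_norm_on H\<delta> \<psi> \<le> multiplier_norm w \<phi>"
proof -
  obtain c where c: "0 \<le> c" "multiplier_norm w \<phi> = ereal c"
    "\<And>f. f \<in> dspace w \<Longrightarrow> dspace_norm w (\<lambda>s. \<phi> s * f s) \<le> c * dspace_norm w f"
    by (rule multiplier_norm_bound[OF assms]) blast
  obtain \<psi> where \<psi>: "\<psi> \<in> Hinf H\<delta>" "\<psi> \<in> dirichlet_functions"
    "\<And>s. s \<in> weight_domain w \<Longrightarrow> \<psi> s = \<phi> s" "\<And>s. \<delta> / 2 < Re s \<Longrightarrow> cmod (\<psi> s) \<le> c"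
    by (rule multiplier_extends[OF assms c(1,3)]) blast+
  show ?thesis
  proof
    show "\<psi> \<in> Hinf H\<delta> \<inter> dirichlet_functions" using \<psi> by blast
    show "restrict_domain \<psi> = \<phi>"
      using \<psi>(3) assms by (auto simp: restrict_domain_def multipliers_def funs_on_def fun_eq_iff)
    show "sup_norm_on H\<delta> \<psi> \<le> multiplier_norm w \<phi>"
      unfolding sup_norm_on_def c(2) using \<psi>(4) by (intro SUP_least) auto
  qed
qed

lemma bij_betw_restrict_domain: "bij_betw restrict_domain (Hinf H\<delta> \<inter> dirichlet_functions) (multipliers w)"
  unfolding bij_betw_def
proof
  show "inj_on restrict_domain (Hinf H\<delta> \<inter> dirichlet_functions)"
    by (rule inj_on_subset[OF inj_on_restrict_domain]) auto
  show "restrict_domain ` (Hinf H\<delta> \<inter> dirichlet_functions) = multipliers w"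
  proof
    show "multipliers w \<subseteq> restrict_domain ` (Hinf H\<delta> \<inter> dirichlet_functions)"
    proof
      fix \<phi> assume "\<phi> \<in> multipliers w"
      then obtain \<psi> where "\<psi> \<in> Hinf H\<delta> \<inter> dirichlet_functions" "restrict_domain \<psi> = \<phi>"
        by (rule restrict_domain_extension) blast
      then show "\<phi> \<in> restrict_domain ` (Hinf H\<delta> \<inter> dirichlet_functions)" by blast
    qed
  qed (use restrict_domain_multiplier in blast)
qed

lemma multiplier_norm_restrict_domain:
  assumes \<psi>: "\<psi> \<in> Hinf H\<delta> \<inter> dirichlet_functions"
  shows "multiplier_norm w (restrict_domain \<psi>) = sup_norm_on H\<delta> \<psi>"
proof (rule antisym)
  obtain \<eta> where \<eta>: "\<eta> \<in> Hinf H\<delta> \<inter> dirichlet_functions" "restrict_domain \<eta> = restrict_domain \<psi>"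
    "sup_norm_on H\<delta> \<eta> \<le> multiplier_norm w (restrict_domain \<psi>)"
    by (rule restrict_domain_extension[OF restrict_domain_multiplier[OF \<psi>]]) blast
  then have "\<eta> = \<psi>" using inj_onD[OF inj_on_restrict_domain] \<psi> by blast
  then show "sup_norm_on H\<delta> \<psi> \<le> multiplier_norm w (restrict_domain \<psi>)" using \<eta>(3) by simp
  obtain B where B: "\<And>s. s \<in> H\<delta> \<Longrightarrow> cmod (\<psi> s) \<le> B"
    by (rule HinfE[OF IntD1[OF \<psi>]]) blast
  have "of_real (\<delta> / 2 + 1) \<in> H\<delta>" by simp
  then have "0 \<le> sup_norm_on H\<delta> \<psi>"
    unfolding sup_norm_on_def by (intro SUP_upper2[of "of_real (\<delta> / 2 + 1)"]) auto
  moreover have "sup_norm_on H\<delta> \<psi> \<le> ereal B"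
    unfolding sup_norm_on_def using B by (intro SUP_least) auto
  ultimately obtain C where C: "sup_norm_on H\<delta> \<psi> = ereal C" "0 \<le> C"
    by (cases "sup_norm_on H\<delta> \<psi>") auto
  have "cmod (\<psi> s) \<le> C" if "s \<in> H\<delta>" for s
    using SUP_upper[OF that, of "\<lambda>s. ereal (cmod (\<psi> s))"] C(1) by (simp add: sup_norm_on_def)
  then have "dspace_norm w (\<lambda>s. restrict_domain \<psi> s * f s) \<le> C * dspace_norm w f" if "f \<in> dspace w" for f
    using bounded_dirichlet_multiplies(2)[of \<psi> C f] \<psi> that by (simp add: restrict_domain_times)
  then show "multiplier_norm w (restrict_domain \<psi>) \<le> sup_norm_on H\<delta> \<psi>"
    unfolding C(1) by (rule multiplier_norm_le) (use C(2) in auto)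
qed

text \<open>The isomorphism is the inverse of restriction.  It respects the operations because the sum or product
  of two extensions is a bounded holomorphic function that extends the sum or product.\<close>
theorem multipliers_isometrically_isomorphic:
  "isometrically_isomorphic (multipliers w) (multiplier_norm w) (Hinf H\<delta> \<inter> dirichlet_functions) (sup_norm_on H\<delta>)"
proof -
  define B where "B = Hinf H\<delta> \<inter> dirichlet_functions"
  define \<Phi> where "\<Phi> = inv_into B restrict_domain"
  have bij: "bij_betw restrict_domain B (multipliers w)"
    unfolding B_def by (rule bij_betw_restrict_domain)
  have \<Phi>: "\<Phi> \<phi> \<in> B" "restrict_domain (\<Phi> \<phi>) = \<phi>" if "\<phi> \<in> multipliers w" for \<phi>
    using bij_betwE[OF bij_betw_inv_into[OF bij]] bij_betw_inv_into_right[OF bij] that by (auto simp: \<Phi>_def)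
  have \<Phi>_Hinf: "\<Phi> \<phi> \<in> Hinf H\<delta>" if "\<phi> \<in> multipliers w" for \<phi>
    using \<Phi>(1)[OF that] by (simp add: B_def)
  have \<Phi>_eq: "\<Phi> \<phi> = \<psi>" if "\<phi> \<in> multipliers w" "\<psi> \<in> Hinf H\<delta>" "\<phi> = restrict_domain \<psi>" for \<phi> \<psi>
    using inj_onD[OF inj_on_restrict_domain _ \<Phi>_Hinf that(2)] \<Phi>(2) that by simp
  have val: "\<phi> s = (if s \<in> weight_domain w then \<Phi> \<phi> s else 0)" if "\<phi> \<in> multipliers w" for \<phi> s
    using fun_cong[OF \<Phi>(2)[OF that], of s] by (simp add: restrict_domain_def)
  have bdd: "bounded ((\<lambda>s. f s + g s) ` X)" "bounded ((\<lambda>s. c * f s) ` X)" "bounded ((\<lambda>s. f s * g s) ` X)"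
    if bounds: "bounded (f ` X)" "bounded (g ` X)" for f g :: "complex \<Rightarrow> complex" and c and X
  proof -
    obtain K L where KL: "\<And>s. s \<in> X \<Longrightarrow> cmod (f s) \<le> K" "\<And>s. s \<in> X \<Longrightarrow> cmod (g s) \<le> L"
      using bounds unfolding bounded_iff by blast
    have "cmod (f s + g s) \<le> K + L" if "s \<in> X" for s
      using norm_triangle_mono[OF KL(1)[OF that] KL(2)[OF that]] .
    then show "bounded ((\<lambda>s. f s + g s) ` X)" by (auto simp: bounded_iff)
    have "cmod (c * f s) \<le> cmod c * K" if "s \<in> X" for s
      unfolding norm_mult using KL(1)[OF that] by (intro mult_left_mono) auto
    then show "bounded ((\<lambda>s. c * f s) ` X)" unfolding bounded_iff by blast
    have "cmod (f s * g s) \<le> K * L" if "s \<in> X" for s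
      unfolding norm_mult using KL[OF that] order_trans[OF norm_ge_zero KL(1)[OF that]] by (intro mult_mono) auto
    then show "bounded ((\<lambda>s. f s * g s) ` X)" unfolding bounded_iff by blast
  qed
  show ?thesis
    unfolding isometrically_isomorphic_def
  proof (intro exI[of _ \<Phi>] conjI ballI allI)
    show "bij_betw \<Phi> (multipliers w) (Hinf H\<delta> \<inter> dirichlet_functions)"
      using bij_betw_inv_into[OF bij] by (simp add: \<Phi>_def B_def)
    fix \<phi> assume \<phi>: "\<phi> \<in> multipliers w"
    show "sup_norm_on H\<delta> (\<Phi> \<phi>) = multiplier_norm w \<phi>"
      using multiplier_norm_restrict_domain[of "\<Phi> \<phi>"] \<Phi>[OF \<phi>] by (simp add: B_def)
    show "\<Phi> (\<lambda>s. c * \<phi> s) = (\<lambda>s. c * \<Phi> \<phi> s)" for c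
    proof (rule \<Phi>_eq[OF multipliers_cmult[OF \<phi>]])
      show "(\<lambda>s. c * \<Phi> \<phi> s) \<in> Hinf H\<delta>"
        using \<Phi>_Hinf[OF \<phi>] bdd(2) by (auto simp: Hinf_def funs_on_def intro!: holomorphic_intros)
      show "(\<lambda>s. c * \<phi> s) = restrict_domain (\<lambda>s. c * \<Phi> \<phi> s)"
        using val[OF \<phi>] by (auto simp: restrict_domain_def)
    qed
    fix \<eta> assume \<eta>: "\<eta> \<in> multipliers w"
    show "\<Phi> (\<lambda>s. \<phi> s + \<eta> s) = (\<lambda>s. \<Phi> \<phi> s + \<Phi> \<eta> s)"
    proof (rule \<Phi>_eq[OF multipliers_add[OF \<phi> \<eta>]])
      show "(\<lambda>s. \<Phi> \<phi> s + \<Phi> \<eta> s) \<in> Hinf H\<delta>"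
        using \<Phi>_Hinf[OF \<phi>] \<Phi>_Hinf[OF \<eta>] bdd(1) by (auto simp: Hinf_def funs_on_def intro!: holomorphic_intros)
      show "(\<lambda>s. \<phi> s + \<eta> s) = restrict_domain (\<lambda>s. \<Phi> \<phi> s + \<Phi> \<eta> s)"
        using val[OF \<phi>] val[OF \<eta>] by (auto simp: restrict_domain_def)
    qed
    show "\<Phi> (\<lambda>s. \<phi> s * \<eta> s) = (\<lambda>s. \<Phi> \<phi> s * \<Phi> \<eta> s)"
    proof (rule \<Phi>_eq[OF multipliers_mult[OF \<phi> \<eta>]])
      show "(\<lambda>s. \<Phi> \<phi> s * \<Phi> \<eta> s) \<in> Hinf H\<delta>"
        using \<Phi>_Hinf[OF \<phi>] \<Phi>_Hinf[OF \<eta>] bdd(3) by (auto simp: Hinf_def funs_on_def intro!: holomorphic_intros)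
      show "(\<lambda>s. \<phi> s * \<eta> s) = restrict_domain (\<lambda>s. \<Phi> \<phi> s * \<Phi> \<eta> s)"
        using val[OF \<phi>] val[OF \<eta>] by (auto simp: restrict_domain_def)
    qed
  qed
qed

end

theorem corollary1p5:
  fixes w :: "nat \<Rightarrow> real" and \<delta> :: real
  assumes pos: "\<And>j. j \<ge> 2 \<Longrightarrow> w j > 0"
    and sigma: "sigma_abs w < \<infinity>"
    and delta: "delta_abs w = ereal \<delta>"
    and additive: "\<And>m n. m \<ge> 2 \<Longrightarrow> n \<ge> 2 \<Longrightarrow> coprime m n \<Longrightarrow> w (m * n) = w m + w n"
    and ratio: "\<And>p j. prime p \<Longrightarrow> j \<ge> 2 \<Longrightarrow> w (p ^ (j - 1)) / w (p ^ j) \<le> real p powr (- \<delta>)"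
    and nonpos: "\<delta> \<le> 0"
  shows "isometrically_isomorphic
           (multipliers w) (multiplier_norm w)
           (Hinf (half_plane (ereal (\<delta> / 2))) \<inter> dirichlet_functions)
           (sup_norm_on (half_plane (ereal (\<delta> / 2))))"
proof -
  have "delta_abs w \<le> sigma_abs w" by (rule delta_abs_le_sigma_abs)
  then obtain \<tau> where \<tau>: "sigma_abs w = ereal \<tau>"
    using sigma delta by (cases "sigma_abs w") auto
  interpret additive_dirichlet_weight w \<tau> \<delta>
    by unfold_locales (fact pos \<tau> delta additive ratio nonpos)+
  show ?thesis by (rule multipliers_isometrically_isomorphic)
qed

end
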